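(* Let $\Gamma$ be the defining graph of an Artin group $A_\Gamma$, and let $T\subseteq V(\Gamma)$ be the set of cone points of $\Gamma$. If the Artin group $A_T$ (the special subgroup of $A_\Gamma$ generated by $T$) satisfies the Center Conjecture, then $A_\Gamma$ satisfies the Center Conjecture.
   Context: $Z(G)$ denotes the center of a group $G$. A defining graph is a finite simplicial graph $\Gamma$ with vertex set $V(\Gamma)=\{s_1,\dots,s_n\}$ in which each edge $(s_i,s_j)$ carries an integer label $m_{ij}=m_{ji}\ge 2$; if $s_i\ne s_j$ are not joined by an edge, one writes $m_{ij}=\infty$. The Artin group $A_\Gamma$ is the group with generators $V(\Gamma)$ and, for each edge $(s_i,s_j)$, the relation $s_is_js_i\cdots=s_js_is_j\cdots$ with $m_{ij}$ letters on each side (no relation is imposed when $m_{ij}=\infty$). The Coxeter group $W_\Gamma$ is the quotient of $A_\Gamma$ by the relations $s_i^2=1$ for all $i$. $A_\Gamma$ is spherical if $W_\Gamma$ is finite, and of infinite type otherwise. For $K\subseteq V(\Gamma)$, the special subgroup $A_K$ is the subgroup of $A_\Gamma$ generated by $K$; by a theorem of van der Lek it is isomorphic (via the identity on generators) to the Artin group whose defining graph is the labelled subgraph $\Gamma_K$ induced by $K$, and it is regarded as an Artin group with this defining graph. $A_\emptyset$ is trivial. A 2-labelled join $\Gamma_1*_2\Gamma_2$ is the graph join of labelled graphs $\Gamma_1,\Gamma_2$ in which every edge between a vertex of $\Gamma_1$ and a vertex of $\Gamma_2$ has label $2$, and the edges within each factor keep their labels. A (nonempty) defining graph $\Gamma$,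 and the group $A_\Gamma$, are irreducible if $\Gamma$ does not split as a 2-labelled join of two nonempty graphs. Every $\Gamma$ has a maximal decomposition $\Gamma=\Gamma_1*_2\cdots*_2\Gamma_n$ with each $\Gamma_i$ irreducible, giving the decomposition into irreducible factors $A_\Gamma=A_{\Gamma_1}\times\cdots\times A_{\Gamma_n}$. The Artin group $A_\Gamma$ satisfies the Center Conjecture if $Z(A_\Gamma)\cong\mathbb{Z}^k$, where $k$ is the number of irreducible factors $A_{\Gamma_i}$ of $A_\Gamma$ that are spherical. (The trivial group $A_\emptyset$ has no factors, $k=0$, and satisfies it.) A cone point of $\Gamma$ is a vertex that is adjacent to every other vertex of $\Gamma$ (the edge labels being arbitrary). The set of cone points may be empty. *)

theory Defs
  imports "HOL-Algebra.Product_Groups" "HOL-Library.Multiset"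
begin

section \<open>Defining graphs\<close>

text \<open>The edges are the two-element sets in the domain of the labelling; a pair \<open>{s, t}\<close>
  outside the domain is a pair with \<open>m = \<infinity>\<close>.\<close>

record 'a labelled_graph =
  vertices :: "'a set"
  label :: "'a set \<Rightarrow> nat option"

definition defining_graph :: "'a labelled_graph \<Rightarrow> bool" where
  "defining_graph \<Gamma> \<longleftrightarrow>
     finite (vertices \<Gamma>) \<and>
     (\<forall>e \<in> dom (label \<Gamma>). \<exists>s \<in> vertices \<Gamma>. \<exists>t \<in> vertices \<Gamma>. s \<noteq> t \<and> e = {s, t}) \<and>
     (\<forall>m \<in> ran (label \<Gamma>). m \<ge> 2)"

definition adjacent :: "'a labelled_graph \<Rightarrow> 'a \<Rightarrow> 'a \<Rightarrow> bool" where
  "adjacent \<Gamma> s t \<longleftrightarrow> {s, t} \<in> dom (label \<Gamma>)"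

definition cone_points :: "'a labelled_graph \<Rightarrow> 'a set" where
  "cone_points \<Gamma> = {s \<in> vertices \<Gamma>. \<forall>t \<in> vertices \<Gamma>. t \<noteq> s \<longrightarrow> adjacent \<Gamma> s t}"

definition induced_subgraph :: "'a labelled_graph \<Rightarrow> 'a set \<Rightarrow> 'a labelled_graph" where
  "induced_subgraph \<Gamma> K = \<lparr>vertices = K, label = label \<Gamma> |` Pow K\<rparr>"

definition empty_graph :: "'a labelled_graph" where
  "empty_graph = \<lparr>vertices = {}, label = Map.empty\<rparr>"

text \<open>Only meaningful for graphs with disjoint vertex sets.\<close>

definition two_join :: "'a labelled_graph \<Rightarrow> 'a labelled_graph \<Rightarrow> 'a labelled_graph" where
  "two_join \<Gamma> \<Delta> =
     \<lparr>vertices = vertices \<Gamma> \<union> vertices \<Delta>,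
      label = label \<Gamma> ++ label \<Delta> ++
        (\<lambda>e. if \<exists>s \<in> vertices \<Gamma>. \<exists>t \<in> vertices \<Delta>. e = {s, t} then Some 2 else None)\<rparr>"

definition irreducible_graph :: "'a labelled_graph \<Rightarrow> bool" where
  "irreducible_graph \<Gamma> \<longleftrightarrow>
     vertices \<Gamma> \<noteq> {} \<and>
     \<not> (\<exists>\<Gamma>1 \<Gamma>2. defining_graph \<Gamma>1 \<and> defining_graph \<Gamma>2 \<and>
          vertices \<Gamma>1 \<noteq> {} \<and> vertices \<Gamma>2 \<noteq> {} \<and> vertices \<Gamma>1 \<inter> vertices \<Gamma>2 = {} \<and>
          \<Gamma> = two_join \<Gamma>1 \<Gamma>2)"

definition irreducible_decomposition :: "'a labelled_graph \<Rightarrow> 'a labelled_graph list \<Rightarrow> bool" where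
  "irreducible_decomposition \<Gamma> \<Gamma>s \<longleftrightarrow>
     (\<forall>\<Delta> \<in> set \<Gamma>s. defining_graph \<Delta> \<and> irreducible_graph \<Delta>) \<and>
     sorted_wrt (\<lambda>\<Delta> \<Delta>'. vertices \<Delta> \<inter> vertices \<Delta>' = {}) \<Gamma>s \<and>
     \<Gamma> = foldr two_join \<Gamma>s empty_graph"


section \<open>Group presentations\<close>

text \<open>The letter \<open>(s, True)\<close> stands for \<open>s\<close>, and \<open>(s, False)\<close> for its inverse.\<close>

type_synonym 'a word = "('a \<times> bool) list"

definition words :: "'a set \<Rightarrow> 'a word set" where
  "words S = lists (S \<times> UNIV)"

inductive pres_eq :: "'a set \<Rightarrow> ('a word \<times> 'a word) set \<Rightarrow> 'a word \<Rightarrow> 'a word \<Rightarrow> bool"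
  for S R where
  refl: "w \<in> words S \<Longrightarrow> pres_eq S R w w"
| sym: "pres_eq S R u v \<Longrightarrow> pres_eq S R v u"
| trans: "pres_eq S R u v \<Longrightarrow> pres_eq S R v w \<Longrightarrow> pres_eq S R u w"
| append: "pres_eq S R u u' \<Longrightarrow> pres_eq S R v v' \<Longrightarrow> pres_eq S R (u @ v) (u' @ v')"
| cancel: "s \<in> S \<Longrightarrow> pres_eq S R [(s, b), (s, \<not> b)] []"
| relator: "(u, v) \<in> R \<Longrightarrow> u \<in> words S \<Longrightarrow> v \<in> words S \<Longrightarrow> pres_eq S R u v"

definition pres_rel :: "'a set \<Rightarrow> ('a word \<times> 'a word) set \<Rightarrow> ('a word \<times> 'a word) set" where
  "pres_rel S R = {(u, v). pres_eq S R u v}"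

definition presented_group :: "'a set \<Rightarrow> ('a word \<times> 'a word) set \<Rightarrow> 'a word set monoid" where
  "presented_group S R =
     \<lparr>carrier = words S // pres_rel S R,
      monoid.mult = (\<lambda>X Y. \<Union>x \<in> X. \<Union>y \<in> Y. pres_rel S R `` {x @ y}),
      one = pres_rel S R `` {[]}\<rparr>"

definition pres_gen :: "'a set \<Rightarrow> ('a word \<times> 'a word) set \<Rightarrow> 'a \<Rightarrow> 'a word set" where
  "pres_gen S R s = pres_rel S R `` {[(s, True)]}"


section \<open>Artin and Coxeter groups\<close>

text \<open>\<open>s t s \<dots>\<close> with \<open>m\<close> letters.\<close>

fun alternating :: "'a \<Rightarrow> 'a \<Rightarrow> nat \<Rightarrow> 'a word" where
  "alternating s t 0 = []"
| "alternating s t (Suc m) = (s, True) # alternating t s m"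

definition artin_relations :: "'a labelled_graph \<Rightarrow> ('a word \<times> 'a word) set" where
  "artin_relations \<Gamma> =
     {(alternating s t m, alternating t s m) | s t m. label \<Gamma> {s, t} = Some m}"

definition artin_group :: "'a labelled_graph \<Rightarrow> 'a word set monoid" where
  "artin_group \<Gamma> = presented_group (vertices \<Gamma>) (artin_relations \<Gamma>)"

definition special_subgroup :: "'a labelled_graph \<Rightarrow> 'a set \<Rightarrow> 'a word set monoid" where
  "special_subgroup \<Gamma> K =
     subgroup_generated (artin_group \<Gamma>) (pres_gen (vertices \<Gamma>) (artin_relations \<Gamma>) ` K)"

definition coxeter_group :: "'a labelled_graph \<Rightarrow> 'a word set monoid" where
  "coxeter_group \<Gamma> =
     presented_group (vertices \<Gamma>)
       (artin_relations \<Gamma> \<union> {([(s, True), (s, True)], []) | s. s \<in> vertices \<Gamma>})"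

definition spherical :: "'a labelled_graph \<Rightarrow> bool" where
  "spherical \<Gamma> \<longleftrightarrow> finite (carrier (coxeter_group \<Gamma>))"


section \<open>The Center Conjecture\<close>

definition center :: "'g monoid \<Rightarrow> 'g monoid" where
  "center G = G\<lparr>carrier := {z \<in> carrier G. \<forall>g \<in> carrier G. z \<otimes>\<^bsub>G\<^esub> g = g \<otimes>\<^bsub>G\<^esub> z}\<rparr>"

text \<open>Well defined on defining graphs by \<open>irreducible_decomposition_exists\<close> and
  \<open>irreducible_decomposition_unique\<close> below.\<close>

definition num_spherical_factors :: "'a labelled_graph \<Rightarrow> nat" where
  "num_spherical_factors \<Gamma> =
     (THE k. \<exists>\<Gamma>s. irreducible_decomposition \<Gamma> \<Gamma>s \<and> k = length (filter spherical \<Gamma>s))"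

text \<open>The conjecture for a group \<open>G\<close> regarded as an Artin group with defining graph \<open>\<Gamma>\<close>. Here
  \<open>G\<close> is \<open>artin_group \<Gamma>\<close> itself or, by van der Lek's theorem, \<open>special_subgroup \<Gamma>' K\<close>
  with \<open>\<Gamma> = induced_subgraph \<Gamma>' K\<close>.\<close>

definition satisfies_center_conjecture :: "'g monoid \<Rightarrow> 'a labelled_graph \<Rightarrow> bool" where
  "satisfies_center_conjecture G \<Gamma> \<longleftrightarrow>
     center G \<cong> product_group {..<num_spherical_factors \<Gamma>} (\<lambda>_. integer_group)"


section \<open>Well-definedness\<close>

lemma pres_eq_words:
  assumes "pres_eq S R u v"
  shows "u \<in> words S \<and> v \<in> words S"
  using assms by induction (auto simp: words_def)

lemma equiv_pres_rel: "equiv (words S) (pres_rel S R)"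
proof (rule equivI)
  show "pres_rel S R \<subseteq> words S \<times> words S"
    using pres_eq_words by (fastforce simp: pres_rel_def)
  show "refl_on (words S) (pres_rel S R)"
    by (rule refl_onI) (simp add: pres_rel_def pres_eq.refl)
  show "sym (pres_rel S R)"
    by (rule symI) (simp add: pres_rel_def pres_eq.sym)
  show "trans (pres_rel S R)"
    by (rule transI) (unfold pres_rel_def mem_Collect_eq case_prod_conv, rule pres_eq.trans)
qed

lemma mult_pres_class:
  assumes "u \<in> words S" "v \<in> words S"
  shows "pres_rel S R `` {u} \<otimes>\<^bsub>presented_group S R\<^esub> pres_rel S R `` {v} = pres_rel S R `` {u @ v}"
proof -
  have "pres_rel S R `` {x @ y} = pres_rel S R `` {u @ v}"
    if "x \<in> pres_rel S R `` {u}" "y \<in> pres_rel S R `` {v}" for x y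
  proof -
    have "pres_eq S R (u @ v) (x @ y)"
      using that by (intro pres_eq.append) (simp_all add: pres_rel_def)
    then show ?thesis
      using equiv_class_eq[OF equiv_pres_rel, of "u @ v" "x @ y" S R] by (simp add: pres_rel_def)
  qed
  moreover have "u \<in> pres_rel S R `` {u}" "v \<in> pres_rel S R `` {v}"
    using assms by (simp_all add: pres_rel_def pres_eq.refl)
  ultimately have "(\<Union>x \<in> pres_rel S R `` {u}. \<Union>y \<in> pres_rel S R `` {v}. pres_rel S R `` {x @ y}) =
      pres_rel S R `` {u @ v}"
    by blast
  then show ?thesis by (simp add: presented_group_def)
qed

lemma group_presented_group: "group (presented_group S R)"
proof -
  let ?G = "presented_group S R" and ?c = "\<lambda>w. pres_rel S R `` {w}"
  have car: "X \<in> carrier ?G \<longleftrightarrow> (\<exists>w \<in> words S. X = ?c w)" for X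
    by (auto simp: presented_group_def quotient_def)
  have app: "u @ v \<in> words S" if "u \<in> words S" "v \<in> words S" for u v
    using that by (auto simp: words_def)
  have nil: "[] \<in> words S" and one: "\<one>\<^bsub>?G\<^esub> = ?c []"
    by (auto simp: words_def presented_group_def)
  have inv: "\<exists>v \<in> words S. pres_eq S R (v @ w) []" if "w \<in> words S" for w
    using that
  proof (induction w)
    case Nil
    then show ?case by (metis append_Nil pres_eq.refl)
  next
    case (Cons a w)
    obtain s b where a: "a = (s, b)" by fastforce
    have s: "s \<in> S" and w: "w \<in> words S" using Cons.prems a by (auto simp: words_def)
    obtain v where v: "v \<in> words S" "pres_eq S R (v @ w) []" using Cons.IH w by blast
    have 1: "pres_eq S R [(s, \<not> b), (s, b)] []"
      using pres_eq.cancel[OF s, of R "\<not> b"] by simp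
    have "pres_eq S R (v @ ([(s, \<not> b), (s, b)] @ w)) (v @ ([] @ w))"
      by (intro pres_eq.append 1 pres_eq.refl v w)
    then have "pres_eq S R ((v @ [(s, \<not> b)]) @ (a # w)) []"
      using v(2) a by (auto intro: pres_eq.trans)
    moreover have "v @ [(s, \<not> b)] \<in> words S" using v(1) s by (auto simp: words_def)
    ultimately show ?case by blast
  qed
  show ?thesis
  proof (rule groupI)
    show "\<one>\<^bsub>?G\<^esub> \<in> carrier ?G" using car one nil by blast
  next
    fix X Y assume "X \<in> carrier ?G" "Y \<in> carrier ?G"
    then show "X \<otimes>\<^bsub>?G\<^esub> Y \<in> carrier ?G" using car app by (auto simp: mult_pres_class)
  next
    fix X Y Z assume "X \<in> carrier ?G" "Y \<in> carrier ?G" "Z \<in> carrier ?G"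
    then show "X \<otimes>\<^bsub>?G\<^esub> Y \<otimes>\<^bsub>?G\<^esub> Z = X \<otimes>\<^bsub>?G\<^esub> (Y \<otimes>\<^bsub>?G\<^esub> Z)"
      using car app by (auto simp: mult_pres_class)
  next
    fix X assume "X \<in> carrier ?G"
    then obtain w where w: "w \<in> words S" "X = ?c w" using car by blast
    then show "\<one>\<^bsub>?G\<^esub> \<otimes>\<^bsub>?G\<^esub> X = X" using one nil by (simp add: mult_pres_class)
    obtain v where v: "v \<in> words S" "pres_eq S R (v @ w) []" using inv w by blast
    have "?c (v @ w) = ?c []"
      by (rule equiv_class_eq[OF equiv_pres_rel]) (simp add: pres_rel_def v)
    then show "\<exists>Y \<in> carrier ?G. Y \<otimes>\<^bsub>?G\<^esub> X = \<one>\<^bsub>?G\<^esub>"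
      using v w car one by (metis mult_pres_class)
  qed
qed

lemma group_artin_group: "group (artin_group \<Gamma>)"
  unfolding artin_group_def by (rule group_presented_group)

lemma defining_graph_dom:
  "defining_graph \<Gamma> \<Longrightarrow> label \<Gamma> e = Some m \<Longrightarrow>
     \<exists>s t. s \<in> vertices \<Gamma> \<and> t \<in> vertices \<Gamma> \<and> s \<noteq> t \<and> e = {s, t}"
  unfolding defining_graph_def by (meson domI)

lemma defining_graph_ge2: "defining_graph \<Gamma> \<Longrightarrow> label \<Gamma> e = Some m \<Longrightarrow> m \<ge> 2"
  unfolding defining_graph_def by (meson ranI)

lemma defining_graphI:
  assumes "finite (vertices \<Gamma>)"
    and "\<And>e m. label \<Gamma> e = Some m \<Longrightarrow>
      m \<ge> 2 \<and> (\<exists>s t. s \<in> vertices \<Gamma> \<and> t \<in> vertices \<Gamma> \<and> s \<noteq> t \<and> e = {s, t})"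
  shows "defining_graph \<Gamma>"
  unfolding defining_graph_def
proof (intro conjI ballI)
  fix e assume "e \<in> dom (label \<Gamma>)"
  then obtain m where "label \<Gamma> e = Some m" by blast
  then show "\<exists>s \<in> vertices \<Gamma>. \<exists>t \<in> vertices \<Gamma>. s \<noteq> t \<and> e = {s, t}"
    using assms(2) by meson
next
  fix m assume "m \<in> ran (label \<Gamma>)"
  then obtain e where "label \<Gamma> e = Some m" unfolding ran_def by blast
  then show "m \<ge> 2" using assms(2) by meson
qed (rule assms(1))

lemma defining_graph_induced:
  assumes "defining_graph \<Gamma>" "K \<subseteq> vertices \<Gamma>"
  shows "defining_graph (induced_subgraph \<Gamma> K)"
proof (rule defining_graphI)
  show "finite (vertices (induced_subgraph \<Gamma> K))"
    using assms by (auto simp: defining_graph_def induced_subgraph_def intro: finite_subset)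
next
  fix e m assume "label (induced_subgraph \<Gamma> K) e = Some m"
  then have e: "label \<Gamma> e = Some m" "e \<subseteq> K"
    by (auto simp: induced_subgraph_def restrict_map_def split: if_splits)
  then show "m \<ge> 2 \<and> (\<exists>s t. s \<in> vertices (induced_subgraph \<Gamma> K) \<and>
      t \<in> vertices (induced_subgraph \<Gamma> K) \<and> s \<noteq> t \<and> e = {s, t})"
    using defining_graph_dom[OF assms(1) e(1)] defining_graph_ge2[OF assms(1) e(1)]
    by (auto simp: induced_subgraph_def)
qed

lemma label_outside:
  "defining_graph \<Gamma> \<Longrightarrow> \<not> e \<subseteq> vertices \<Gamma> \<Longrightarrow> label \<Gamma> e = None"
  by (cases "label \<Gamma> e") (auto dest: defining_graph_dom)

lemma label_empty: "defining_graph \<Gamma> \<Longrightarrow> label \<Gamma> {} = None"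
  using defining_graph_dom[of \<Gamma> "{}"] by (cases "label \<Gamma> {}") auto

lemma vertices_two_join [simp]: "vertices (two_join \<Gamma> \<Delta>) = vertices \<Gamma> \<union> vertices \<Delta>"
  by (simp add: two_join_def)

lemma label_two_join:
  assumes "defining_graph \<Gamma>" "defining_graph \<Delta>" "vertices \<Gamma> \<inter> vertices \<Delta> = {}"
  shows "label (two_join \<Gamma> \<Delta>) e =
    (if e \<subseteq> vertices \<Gamma> then label \<Gamma> e else if e \<subseteq> vertices \<Delta> then label \<Delta> e
     else if \<exists>s \<in> vertices \<Gamma>. \<exists>t \<in> vertices \<Delta>. e = {s, t} then Some 2 else None)"
proof -
  let ?P = "\<exists>s \<in> vertices \<Gamma>. \<exists>t \<in> vertices \<Delta>. e = {s, t}"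
  have lab: "label (two_join \<Gamma> \<Delta>) e =
      (if ?P then Some 2 else case label \<Delta> e of None \<Rightarrow> label \<Gamma> e | Some m \<Rightarrow> Some m)"
    by (simp add: two_join_def map_add_def)
  have P: "\<not> e \<subseteq> vertices \<Gamma> \<and> \<not> e \<subseteq> vertices \<Delta>" if ?P
    using that assms(3) by auto
  consider "e \<subseteq> vertices \<Gamma>" | "e \<subseteq> vertices \<Delta>" "\<not> e \<subseteq> vertices \<Gamma>"
    | "\<not> e \<subseteq> vertices \<Delta>" "\<not> e \<subseteq> vertices \<Gamma>"
    by blast
  then show ?thesis
  proof cases
    case 1
    have "label \<Delta> e = None"
      using 1 assms(3) defining_graph_dom[OF assms(2), of e] by (cases "label \<Delta> e") auto
    moreover have "\<not> ?P" using P 1 by argo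
    ultimately show ?thesis using 1 by (simp only: lab) simp
  next
    case 2
    moreover have "\<not> ?P" using P 2 by argo
    ultimately show ?thesis
      using label_outside[OF assms(1), of e] by (simp only: lab) (simp split: option.splits)
  next
    case 3
    then show ?thesis
      using label_outside[OF assms(1), of e] label_outside[OF assms(2), of e]
      by (simp only: lab if_False simp_thms option.case)
  qed
qed

lemma defining_graph_two_join:
  assumes "defining_graph \<Gamma>" "defining_graph \<Delta>" "vertices \<Gamma> \<inter> vertices \<Delta> = {}"
  shows "defining_graph (two_join \<Gamma> \<Delta>)"
proof (rule defining_graphI)
  show "finite (vertices (two_join \<Gamma> \<Delta>))"
    using assms by (simp add: defining_graph_def)
next
  fix e m assume l: "label (two_join \<Gamma> \<Delta>) e = Some m"
  consider "label \<Gamma> e = Some m" | "label \<Delta> e = Some m"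
    | s t where "s \<in> vertices \<Gamma>" "t \<in> vertices \<Delta>" "e = {s, t}" "m = 2"
  proof -
    have "label \<Gamma> e = Some m \<or> label \<Delta> e = Some m \<or>
        (\<exists>s \<in> vertices \<Gamma>. \<exists>t \<in> vertices \<Delta>. e = {s, t}) \<and> m = 2"
      using l unfolding label_two_join[OF assms] by (simp split: if_split_asm)
    then show ?thesis using that by blast
  qed
  then show "m \<ge> 2 \<and> (\<exists>s t. s \<in> vertices (two_join \<Gamma> \<Delta>) \<and> t \<in> vertices (two_join \<Gamma> \<Delta>) \<and>
      s \<noteq> t \<and> e = {s, t})"
  proof cases
    case 1
    then show ?thesis
      using defining_graph_dom[OF assms(1) 1] defining_graph_ge2[OF assms(1) 1] by auto
  next
    case 2
    then show ?thesis
      using defining_graph_dom[OF assms(2) 2] defining_graph_ge2[OF assms(2) 2] by auto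
  next
    case (3 s t)
    then have "s \<noteq> t" using assms(3) by auto
    then show ?thesis using 3 by auto
  qed
qed

lemma defining_graph_empty [simp]: "defining_graph empty_graph"
  by (simp add: defining_graph_def empty_graph_def)

lemma vertices_empty [simp]: "vertices empty_graph = {}"
  by (simp add: empty_graph_def)

lemma two_join_empty [simp]: "two_join \<Gamma> empty_graph = \<Gamma>" "two_join empty_graph \<Gamma> = \<Gamma>"
  by (simp_all add: two_join_def empty_graph_def)

lemma two_join_assoc:
  assumes "defining_graph A" "defining_graph B" "defining_graph C"
    "vertices A \<inter> vertices B = {}" "vertices A \<inter> vertices C = {}" "vertices B \<inter> vertices C = {}"
  shows "two_join (two_join A B) C = two_join A (two_join B C)"
proof -
  have AB: "defining_graph (two_join A B)" and BC: "defining_graph (two_join B C)"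
    using assms by (auto intro: defining_graph_two_join)
  have d1: "vertices (two_join A B) \<inter> vertices C = {}"
    and d2: "vertices A \<inter> vertices (two_join B C) = {}" using assms by auto
  have pair: "(\<exists>x \<in> X. \<exists>y \<in> Y. {s, t} = {x, y}) \<longleftrightarrow> s \<in> X \<and> t \<in> Y \<or> t \<in> X \<and> s \<in> Y"
    for s t :: 'a and X Y
    by (auto simp: doubleton_eq_iff)
  have disj: "x \<in> vertices A \<and> x \<notin> vertices B \<and> x \<notin> vertices C \<or>
    x \<notin> vertices A \<and> x \<in> vertices B \<and> x \<notin> vertices C \<or>
    x \<notin> vertices A \<and> x \<notin> vertices B \<and> x \<in> vertices C \<or>
    x \<notin> vertices A \<and> x \<notin> vertices B \<and> x \<notin> vertices C" for x
    using assms(4-6) by blast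
  have "label (two_join (two_join A B) C) e = label (two_join A (two_join B C)) e" for e
  proof (cases "\<exists>s t. e = {s, t}")
    case True
    then obtain s t where e: "e = {s, t}" by blast
    show ?thesis
      unfolding label_two_join[OF AB assms(3) d1] label_two_join[OF assms(1) BC d2]
        label_two_join[OF assms(1,2,4)] label_two_join[OF assms(2,3,6)] e
        pair vertices_two_join insert_subset Un_iff
      using disj[of s] disj[of t]
      by (elim disjE conjE) simp_all
  next
    case False
    then have no: "label G e = None" if "defining_graph G" for G
      using defining_graph_dom[OF that, of e] by (cases "label G e") metis+
    show ?thesis
      using no[OF defining_graph_two_join[OF AB assms(3) d1]]
        no[OF defining_graph_two_join[OF assms(1) BC d2]] by simp
  qed
  then show ?thesis by (intro labelled_graph.equality) auto
qed

lemma vertices_foldr_two_join [simp]: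
  "vertices (foldr two_join \<Gamma>s empty_graph) = (\<Union>\<Delta> \<in> set \<Gamma>s. vertices \<Delta>)"
  by (induction \<Gamma>s) auto

lemma defining_graph_foldr_two_join:
  assumes "\<forall>\<Delta> \<in> set \<Gamma>s. defining_graph \<Delta>"
    "sorted_wrt (\<lambda>\<Delta> \<Delta>'. vertices \<Delta> \<inter> vertices \<Delta>' = {}) \<Gamma>s"
  shows "defining_graph (foldr two_join \<Gamma>s empty_graph)"
  using assms by (induction \<Gamma>s) (auto intro!: defining_graph_two_join, blast)

lemma foldr_two_join_append:
  assumes "\<forall>\<Delta> \<in> set (\<Gamma>s @ \<Gamma>s'). defining_graph \<Delta>"
    "sorted_wrt (\<lambda>\<Delta> \<Delta>'. vertices \<Delta> \<inter> vertices \<Delta>' = {}) (\<Gamma>s @ \<Gamma>s')"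
  shows "foldr two_join (\<Gamma>s @ \<Gamma>s') empty_graph =
    two_join (foldr two_join \<Gamma>s empty_graph) (foldr two_join \<Gamma>s' empty_graph)"
  using assms
proof (induction \<Gamma>s)
  case Nil
  then show ?case by simp
next
  case (Cons \<Delta> \<Gamma>s)
  have IH: "foldr two_join (\<Gamma>s @ \<Gamma>s') empty_graph =
      two_join (foldr two_join \<Gamma>s empty_graph) (foldr two_join \<Gamma>s' empty_graph)"
    using Cons by simp
  show ?case
    unfolding append_Cons foldr_Cons o_apply IH
    by (rule two_join_assoc[symmetric])
      (use Cons.prems in \<open>auto intro!: defining_graph_foldr_two_join simp: sorted_wrt_append,
        (fastforce+)?\<close>)
qed

lemma irreducible_decomposition_exists:
  assumes "defining_graph \<Gamma>"
  shows "\<exists>\<Gamma>s. irreducible_decomposition \<Gamma> \<Gamma>s"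
  using assms
proof (induction "card (vertices \<Gamma>)" arbitrary: \<Gamma> rule: less_induct)
  case less
  consider "vertices \<Gamma> = {}" | "irreducible_graph \<Gamma>"
    | A B where "defining_graph A" "defining_graph B" "vertices A \<noteq> {}" "vertices B \<noteq> {}"
      "vertices A \<inter> vertices B = {}" "\<Gamma> = two_join A B"
    unfolding irreducible_graph_def by blast
  then show ?case
  proof cases
    case 1
    then have "label \<Gamma> e = None" for e
      using defining_graph_dom[OF less.prems] by (cases "label \<Gamma> e") auto
    then have "\<Gamma> = empty_graph"
      using 1 by (intro labelled_graph.equality) (auto simp: empty_graph_def)
    then have "irreducible_decomposition \<Gamma> []" by (simp add: irreducible_decomposition_def)
    then show ?thesis by blast
  next
    case 2
    then have "irreducible_decomposition \<Gamma> [\<Gamma>]"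
      using less.prems by (simp add: irreducible_decomposition_def)
    then show ?thesis by blast
  next
    case 3
    have fin: "finite (vertices A)" "finite (vertices B)"
      using 3(1,2) by (auto simp: defining_graph_def)
    then have "card (vertices A) > 0" "card (vertices B) > 0"
      using 3(3,4) by (simp_all add: card_gt_0_iff)
    then have "card (vertices A) < card (vertices \<Gamma>)" "card (vertices B) < card (vertices \<Gamma>)"
      using fin 3(5,6) by (simp_all add: card_Un_disjoint)
    then obtain As Bs where AB: "irreducible_decomposition A As" "irreducible_decomposition B Bs"
      using less.hyps 3(1,2) by blast
    have "vertices A = (\<Union>\<Delta> \<in> set As. vertices \<Delta>)" "vertices B = (\<Union>\<Delta> \<in> set Bs. vertices \<Delta>)"
      using AB unfolding irreducible_decomposition_def by auto
    then have d: "sorted_wrt (\<lambda>\<Delta> \<Delta>'. vertices \<Delta> \<inter> vertices \<Delta>' = {}) (As @ Bs)"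
      using AB 3(5) unfolding irreducible_decomposition_def sorted_wrt_append by blast
    have def: "\<forall>\<Delta> \<in> set (As @ Bs). defining_graph \<Delta>"
      using AB unfolding irreducible_decomposition_def by auto
    have "irreducible_decomposition \<Gamma> (As @ Bs)"
      using AB 3(6) d foldr_two_join_append[OF def d] unfolding irreducible_decomposition_def
      by auto
    then show ?thesis by blast
  qed
qed

lemma decomposition_structure:
  assumes "\<forall>\<Delta> \<in> set \<Gamma>s. defining_graph \<Delta>"
    "sorted_wrt (\<lambda>\<Delta> \<Delta>'. vertices \<Delta> \<inter> vertices \<Delta>' = {}) \<Gamma>s"
    "\<Delta> \<in> set \<Gamma>s"
  shows "induced_subgraph (foldr two_join \<Gamma>s empty_graph) (vertices \<Delta>) = \<Delta> \<and>
    (\<forall>s \<in> vertices \<Delta>. \<forall>t \<in> vertices (foldr two_join \<Gamma>s empty_graph) - vertices \<Delta>.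
       label (foldr two_join \<Gamma>s empty_graph) {s, t} = Some 2)"
  using assms
proof (induction \<Gamma>s)
  case Nil
  then show ?case by simp
next
  case (Cons \<Theta> \<Gamma>s)
  let ?F = "foldr two_join \<Gamma>s empty_graph"
  have dT: "defining_graph \<Theta>" and dF: "defining_graph ?F"
    using Cons.prems by (auto intro: defining_graph_foldr_two_join)
  have dj: "vertices \<Theta> \<inter> vertices ?F = {}" using Cons.prems by auto
  note lab = label_two_join[OF dT dF dj]
  show ?case
  proof (cases "\<Delta> = \<Theta>")
    case True
    have "(label (two_join \<Theta> ?F) |` Pow (vertices \<Theta>)) e = label \<Theta> e" for e
      using label_outside[OF dT, of e] by (simp add: restrict_map_def lab)
    moreover have "label (two_join \<Theta> ?F) {s, t} = Some 2"
      if "s \<in> vertices \<Theta>" "t \<in> vertices ?F" for s t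
    proof -
      have "s \<notin> vertices ?F" "t \<notin> vertices \<Theta>" using that dj by auto
      then show ?thesis using that by (simp only: lab) auto
    qed
    ultimately show ?thesis
      using True by (auto simp: induced_subgraph_def intro!: labelled_graph.equality)
  next
    case False
    then have D: "\<Delta> \<in> set \<Gamma>s" using Cons.prems by simp
    then have IH: "induced_subgraph ?F (vertices \<Delta>) = \<Delta>"
      "\<And>s t. s \<in> vertices \<Delta> \<Longrightarrow> t \<in> vertices ?F - vertices \<Delta> \<Longrightarrow> label ?F {s, t} = Some 2"
      using Cons by auto
    have dD: "defining_graph \<Delta>" and sub: "vertices \<Delta> \<subseteq> vertices ?F"
      using D Cons.prems by auto
    have lF: "label (two_join \<Theta> ?F) e = label ?F e" if "e \<subseteq> vertices ?F" for e
    proof (cases "e = {}")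
      case True
      then show ?thesis
        using label_empty[OF dT] label_empty[OF dF] by (simp add: lab)
    next
      case False
      then have "\<not> e \<subseteq> vertices \<Theta>" using that dj by auto
      then show ?thesis using that by (simp only: lab) simp
    qed
    have "label (two_join \<Theta> ?F) |` Pow (vertices \<Delta>) = label ?F |` Pow (vertices \<Delta>)"
      using lF sub by (auto simp: restrict_map_def fun_eq_iff)
    then have "induced_subgraph (two_join \<Theta> ?F) (vertices \<Delta>) = \<Delta>"
      using IH(1) by (simp add: induced_subgraph_def)
    moreover have "label (two_join \<Theta> ?F) {s, t} = Some 2"
      if s: "s \<in> vertices \<Delta>" and t: "t \<in> vertices (two_join \<Theta> ?F) - vertices \<Delta>" for s t
    proof (cases "t \<in> vertices ?F")
      case True
      then show ?thesis using IH(2)[OF s] t s sub lF[of "{s, t}"] by auto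
    next
      case False
      then have "t \<in> vertices \<Theta>" "s \<in> vertices ?F" "s \<notin> vertices \<Theta>"
        using t s sub dj by auto
      then show ?thesis using False by (simp only: lab) (auto simp: insert_commute)
    qed
    ultimately show ?thesis by simp
  qed
qed

lemma irreducible_graph_no_split:
  assumes "defining_graph \<Gamma>" "irreducible_graph \<Gamma>" "A \<subseteq> vertices \<Gamma>"
    and 2: "\<And>s t. s \<in> A \<Longrightarrow> t \<in> vertices \<Gamma> - A \<Longrightarrow> label \<Gamma> {s, t} = Some 2"
  shows "A = {} \<or> A = vertices \<Gamma>"
proof (rule ccontr)
  assume contr: "\<not> ?thesis"
  let ?B = "vertices \<Gamma> - A"
  let ?G = "induced_subgraph \<Gamma> A" and ?H = "induced_subgraph \<Gamma> ?B"
  have d: "defining_graph ?G" "defining_graph ?H"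
    using assms by (auto intro: defining_graph_induced)
  have v: "vertices ?G = A" "vertices ?H = ?B" by (auto simp: induced_subgraph_def)
  have dj: "vertices ?G \<inter> vertices ?H = {}" using v by auto
  have lG: "label ?G e = label \<Gamma> e" if "e \<subseteq> A" for e
    using that by (simp add: induced_subgraph_def)
  have lH: "label ?H e = label \<Gamma> e" if "e \<subseteq> ?B" for e
    using that by (simp add: induced_subgraph_def)
  have "label \<Gamma> e = label (two_join ?G ?H) e" for e
  proof -
    consider "e \<subseteq> A" | "e \<subseteq> ?B" "\<not> e \<subseteq> A"
      | s t where "s \<in> A" "t \<in> ?B" "e = {s, t}" "\<not> e \<subseteq> ?B" "\<not> e \<subseteq> A"
      | "\<not> e \<subseteq> A" "\<not> e \<subseteq> ?B" "\<not> (\<exists>s \<in> A. \<exists>t \<in> ?B. e = {s, t})"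
      by blast
    then show ?thesis
    proof cases
      case 1
      then show ?thesis by (simp add: label_two_join[OF d dj] v lG)
    next
      case 2
      then show ?thesis by (simp add: label_two_join[OF d dj] v lH)
    next
      case (3 s t)
      then have "\<exists>s \<in> A. \<exists>t \<in> ?B. e = {s, t}" by blast
      then show ?thesis
        using 3(3-5) 2[OF 3(1,2)] unfolding label_two_join[OF d dj] v by argo
    next
      case 4
      have "label \<Gamma> e = None"
      proof (cases "label \<Gamma> e")
        case (Some m)
        then obtain s t where st: "s \<in> vertices \<Gamma>" "t \<in> vertices \<Gamma>" "e = {s, t}"
          using defining_graph_dom[OF assms(1)] by blast
        have "e = {t, s}" using st by auto
        then show ?thesis using 4 st by blast
      qed
      then show ?thesis using 4 unfolding label_two_join[OF d dj] v by presburger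
    qed
  qed
  then have "\<Gamma> = two_join ?G ?H"
    using assms(3) v by (intro labelled_graph.equality) auto
  moreover have "A \<noteq> {}" "?B \<noteq> {}" using contr assms(3) by auto
  ultimately show False
    using assms(2) d v dj unfolding irreducible_graph_def by metis
qed

lemma irreducible_decomposition_unique:
  assumes "irreducible_decomposition \<Gamma> \<Gamma>s" "irreducible_decomposition \<Gamma> \<Gamma>s'"
  shows "mset \<Gamma>s = mset \<Gamma>s'"
proof -
  have subset: "\<Delta> \<in> set Ys"
    if X: "irreducible_decomposition \<Gamma> Xs" and Y: "irreducible_decomposition \<Gamma> Ys"
      and D: "\<Delta> \<in> set Xs" for Xs Ys \<Delta>
  proof -
    have key: "vertices \<Delta> \<subseteq> vertices \<Theta>"
      if "irreducible_decomposition \<Gamma> Us" "irreducible_decomposition \<Gamma> Ws"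
        "\<Delta> \<in> set Us" "\<Theta> \<in> set Ws" "vertices \<Delta> \<inter> vertices \<Theta> \<noteq> {}" for Us Ws \<Delta> \<Theta>
    proof -
      have U: "induced_subgraph \<Gamma> (vertices \<Delta>) = \<Delta>" "vertices \<Delta> \<subseteq> vertices \<Gamma>"
        "defining_graph \<Delta>" "irreducible_graph \<Delta>"
        using that decomposition_structure[of Us \<Delta>] unfolding irreducible_decomposition_def
        by auto
      have W: "label \<Gamma> {s, t} = Some 2"
        if "s \<in> vertices \<Theta>" "t \<in> vertices \<Gamma> - vertices \<Theta>" for s t
        using that \<open>irreducible_decomposition \<Gamma> Ws\<close> \<open>\<Theta> \<in> set Ws\<close>
          decomposition_structure[of Ws \<Theta>] unfolding irreducible_decomposition_def by blast
      have "label \<Delta> {s, t} = Some 2"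
        if "s \<in> vertices \<Delta> \<inter> vertices \<Theta>" "t \<in> vertices \<Delta> - vertices \<Delta> \<inter> vertices \<Theta>" for s t
      proof -
        have "label (induced_subgraph \<Gamma> (vertices \<Delta>)) {s, t} = label \<Gamma> {s, t}"
          using that by (simp add: induced_subgraph_def)
        then show ?thesis using W[of s t] that U(1,2) by auto
      qed
      then have "vertices \<Delta> \<inter> vertices \<Theta> = {} \<or> vertices \<Delta> \<inter> vertices \<Theta> = vertices \<Delta>"
        by (intro irreducible_graph_no_split[OF U(3,4)]) auto
      then show ?thesis using that by blast
    qed
    have "vertices \<Delta> \<noteq> {}"
      using X D unfolding irreducible_decomposition_def irreducible_graph_def by blast
    moreover have "vertices \<Delta> \<subseteq> (\<Union>\<Theta> \<in> set Ys. vertices \<Theta>)"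
      using X Y D unfolding irreducible_decomposition_def
      by (metis UN_upper vertices_foldr_two_join)
    ultimately obtain \<Theta> where T: "\<Theta> \<in> set Ys" "vertices \<Delta> \<inter> vertices \<Theta> \<noteq> {}" by blast
    then have "vertices \<Delta> = vertices \<Theta>"
      using key[OF X Y D T(1)] key[OF Y X T(1) D] by blast
    moreover have "induced_subgraph \<Gamma> (vertices \<Delta>) = \<Delta>" "induced_subgraph \<Gamma> (vertices \<Theta>) = \<Theta>"
      using X Y D T(1) decomposition_structure[of Xs \<Delta>] decomposition_structure[of Ys \<Theta>]
      unfolding irreducible_decomposition_def by auto
    ultimately show ?thesis using T(1) by metis
  qed
  have dist: "distinct Xs" if "irreducible_decomposition \<Gamma> Xs" for Xs
  proof -
    have "sorted_wrt (\<lambda>\<Delta> \<Delta>'. vertices \<Delta> \<inter> vertices \<Delta>' = {}) Xs" "\<forall>\<Delta> \<in> set Xs. vertices \<Delta> \<noteq> {}"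
      using that by (auto simp: irreducible_decomposition_def irreducible_graph_def)
    then show ?thesis by (induction Xs) auto
  qed
  have "set \<Gamma>s = set \<Gamma>s'" using subset assms by blast
  then show ?thesis using dist assms by (simp add: set_eq_iff_mset_eq_distinct)
qed

lemma num_spherical_factors_eq:
  assumes "irreducible_decomposition \<Gamma> \<Gamma>s"
  shows "num_spherical_factors \<Gamma> = length (filter spherical \<Gamma>s)"
  unfolding num_spherical_factors_def
proof (rule the_equality)
  fix k assume "\<exists>\<Gamma>s. irreducible_decomposition \<Gamma> \<Gamma>s \<and> k = length (filter spherical \<Gamma>s)"
  then show "k = length (filter spherical \<Gamma>s)"
    using irreducible_decomposition_unique[OF assms] by (metis mset_filter size_mset)
qed (use assms in blast)

end

theory Submission
  imports Defs Complex_Main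
begin

text \<open>If \<open>s\<close> and \<open>t\<close> are not adjacent, the Artin group is the amalgam of the subgroups generated by
  \<open>V - {s}\<close> and \<open>V - {t}\<close> over the one generated by \<open>V - {s, t}\<close>, and a central element of an
  amalgam lies in the amalgamated subgroup. Special subgroups satisfy
  \<open>A\<^sub>X \<inter> A\<^sub>Y = A\<^bsub>X \<inter> Y\<^esub>\<close> by the retraction of Charney and Paris, so the center lies in \<open>A\<^sub>T\<close> and
  hence in the center of \<open>A\<^sub>T\<close>, a lattice whose rank is the number of spherical factors of \<open>T\<close>.

  In the Burau representation with a small parameter, an element of the center of \<open>A\<^sub>T\<close> multiplies
  each basis vector \<open>e\<^sub>u\<close> with \<open>u \<in> T\<close> by a scalar, and the logarithms of these scalars are additive
  functionals. The square of the Garside element of a spherical factor \<open>S\<close> of \<open>T\<close> is central,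
      and its
  scalar at \<open>u\<close> is trivial if and only if \<open>u \<notin> S\<close>. If \<open>S\<close> is not a factor of the whole graph, some
  \<open>u \<in> S\<close> and some \<open>s \<notin> T\<close> do not have label 2; then the scalars of a central element of the whole
  group at \<open>u\<close> and \<open>s\<close> agree, and the one at \<open>s\<close> is trivial because the element lies in \<open>A\<^sub>T\<close>. Thus
  the rank of the center is the number of spherical factors of \<open>T\<close> that are factors of the whole
  graph, and every spherical factor of the whole graph is of this kind because it is complete.\<close>

section \<open>Groups as types\<close>

text \<open>The square of a Garside element need not generate the center of its factor, and the
  hypothesis gives only an abstract isomorphism between the center of A_T and a lattice. Generators
  of the center of the whole group are therefore never computed: it is treated as a subgroup of that
  lattice, hence free, and only its rank is found, by means of central elements and functionals that
  are dual to each other up to nonzero factors. The functionals need a representation in which these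
  central elements are visible. At parameter 1 the Burau operators are the reflections of the
  Coxeter group, where the square of a Garside element acts trivially and every scalar is 1. As the
  parameter tends to 0, each generator tends to a projection killing its own coordinate, so a
  positive word that starts with u has a scalar at u of modulus less than 1. This is why the central
  word is required to be positive and to be rewritable so that it starts with any letter of the
  factor; no determinant and no explicit form of the word enters.\<close>

text \<open>Every presented group acts faithfully on itself, so it can be studied inside a type of
  permutations, where the group operations are total and no carrier conditions arise.\<close>

class mult_group = monoid_mult +
  fixes ginv :: "'a \<Rightarrow> 'a"
  assumes left_ginv [simp]: "ginv a * a = 1"
begin

lemma ginv_mult_cancel [simp]: "ginv a * (a * b) = b"
  by (metis left_ginv local.mult.assoc local.mult.left_neutral)

lemma right_ginv [simp]: "a * ginv a = 1"
  by (metis ginv_mult_cancel left_ginv local.mult.right_neutral)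

lemma mult_ginv_cancel [simp]: "a * (ginv a * b) = b"
  by (metis right_ginv local.mult.assoc local.mult.left_neutral)

lemma ginv_ginv [simp]: "ginv (ginv a) = a"
  by (metis ginv_mult_cancel left_ginv local.mult.right_neutral)

lemma ginv_one [simp]: "ginv 1 = 1"
  by (metis left_ginv local.mult.right_neutral)

lemma ginv_mult [simp]: "ginv (a * b) = ginv b * ginv a"
  by (metis ginv_mult_cancel left_ginv local.mult.assoc local.mult.right_neutral)

lemma gmult_left_cancel [simp]: "a * b = a * c \<longleftrightarrow> b = c"
  by (metis ginv_mult_cancel)

lemma gmult_right_cancel [simp]: "b * a = c * a \<longleftrightarrow> b = c"
  by (metis local.mult.assoc local.mult.right_neutral right_ginv)

lemma ginv_inject [simp]: "ginv a = ginv b \<longleftrightarrow> a = b"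
  by (metis ginv_ginv)

lemma ginv_unique: "a * b = 1 \<Longrightarrow> ginv a = b"
  by (metis ginv_mult_cancel local.mult.right_neutral)

end

typedef 'x perm = "{f :: 'x \<Rightarrow> 'x. bij f}" morphisms perm_apply Perm
  by (rule exI[of _ id]) simp

lemma bij_perm_apply [simp]: "bij (perm_apply p)"
  using perm_apply by auto

lemma perm_apply_Perm [simp]: "bij f \<Longrightarrow> perm_apply (Perm f) = f"
  by (simp add: Perm_inverse)

instantiation perm :: (type) mult_group
begin

definition "1 = Perm id"
definition "p * q = Perm (perm_apply p \<circ> perm_apply q)"
definition "ginv p = Perm (inv_into UNIV (perm_apply p))"

lemma perm_apply_one [simp]: "perm_apply 1 x = x"
  by (simp add: one_perm_def)

lemma perm_apply_mult [simp]: "perm_apply (p * q) x = perm_apply p (perm_apply q x)"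
  by (simp add: times_perm_def bij_comp)

lemma perm_apply_ginv: "perm_apply (ginv p) = inv_into UNIV (perm_apply p)"
  by (simp add: ginv_perm_def bij_imp_bij_inv)

instance
proof
  fix p q r :: "'a perm"
  show "p * q * r = p * (q * r)"
    by (auto simp: perm_apply_inject[symmetric] fun_eq_iff)
  show "1 * p = p" "p * 1 = p"
    by (auto simp: perm_apply_inject[symmetric] fun_eq_iff)
  show "ginv p * p = 1"
    by (auto simp: perm_apply_inject[symmetric] fun_eq_iff perm_apply_ginv bij_is_inj)
qed

end

lemma perm_eqI: "(\<And>x. perm_apply p x = perm_apply q x) \<Longrightarrow> p = q"
  by (auto simp: perm_apply_inject[symmetric] fun_eq_iff)

text \<open>\<open>Perm\<close> wants a bijection of the whole type, but the actions on group
  elements, normal forms and states make sense only on a set \<open>A\<close>. They are extended by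
  the identity, and \<open>g\<close> has to invert \<open>f\<close> on \<open>A\<close>
  alone.\<close>

lemma bij_if_inverse:
  assumes "\<And>x. x \<in> A \<Longrightarrow> f x \<in> A" "\<And>x. x \<in> A \<Longrightarrow> g x \<in> A"
    "\<And>x. x \<in> A \<Longrightarrow> g (f x) = x" "\<And>x. x \<in> A \<Longrightarrow> f (g x) = x"
  shows "bij (\<lambda>x. if x \<in> A then f x else x)"
  by (rule bij_betw_byWitness[of _ "\<lambda>x. if x \<in> A then g x else x"]) (use assms in auto)

section \<open>Evaluation of words and subgroups\<close>

definition letter_val :: "('a \<Rightarrow> 'g :: mult_group) \<Rightarrow> 'a \<times> bool \<Rightarrow> 'g" where
  "letter_val f l = (if snd l then f (fst l) else ginv (f (fst l)))"

definition word_val :: "('a \<Rightarrow> 'g :: mult_group) \<Rightarrow> 'a word \<Rightarrow> 'g" where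
  "word_val f w = prod_list (map (letter_val f) w)"

lemma word_val_simps [simp]:
  "word_val f [] = 1" "word_val f (l # w) = letter_val f l * word_val f w"
  "word_val f (u @ v) = word_val f u * word_val f v"
  by (auto simp: word_val_def)

lemma letter_val_simps [simp]:
  "letter_val f (s, True) = f s" "letter_val f (s, False) = ginv (f s)"
  by (auto simp: letter_val_def)

definition inverse_word :: "'a word \<Rightarrow> 'a word" where
  "inverse_word w = map (\<lambda>(s, b). (s, \<not> b)) (rev w)"

lemma word_val_inverse_word [simp]: "word_val f (inverse_word w) = ginv (word_val f w)"
  by (induction w) (auto simp: inverse_word_def letter_val_def)

lemma words_simps [simp]:
  "[] \<in> words S" "l # w \<in> words S \<longleftrightarrow> fst l \<in> S \<and> w \<in> words S"
  "u @ v \<in> words S \<longleftrightarrow> u \<in> words S \<and> v \<in> words S"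
  by (auto simp: words_def mem_Times_iff)

lemma inverse_word_words [simp]: "inverse_word w \<in> words S \<longleftrightarrow> w \<in> words S"
  by (induction w) (auto simp: inverse_word_def)

lemma words_mono: "K \<subseteq> L \<Longrightarrow> words K \<subseteq> words L"
  by (auto simp: words_def)

definition generated_by :: "('a \<Rightarrow> 'g :: mult_group) \<Rightarrow> 'a set \<Rightarrow> 'g set" where
  "generated_by f K = word_val f ` words K"

lemma generated_by_one [simp]: "1 \<in> generated_by f K"
  unfolding generated_by_def by (rule image_eqI[of _ _ "[]"]) auto

lemma generated_by_mult [simp]:
  "x \<in> generated_by f K \<Longrightarrow> y \<in> generated_by f K \<Longrightarrow> x * y \<in> generated_by f K"
  unfolding generated_by_def by (auto intro!: image_eqI[where x = "_ @ _"])

lemma generated_by_ginv [simp]: "x \<in> generated_by f K \<Longrightarrow> ginv x \<in> generated_by f K"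
  unfolding generated_by_def by (auto intro!: image_eqI[where x = "inverse_word _"])

lemma generated_by_gen [simp]: "s \<in> K \<Longrightarrow> f s \<in> generated_by f K"
  unfolding generated_by_def by (rule image_eqI[of _ _ "[(s, True)]"]) auto

lemma generated_by_mono: "K \<subseteq> L \<Longrightarrow> generated_by f K \<subseteq> generated_by f L"
  unfolding generated_by_def using words_mono by blast

lemma generated_by_induct [consumes 1, case_names one mult]:
  assumes "x \<in> generated_by f K" "P 1"
    "\<And>s b x. s \<in> K \<Longrightarrow> x \<in> generated_by f K \<Longrightarrow> P x \<Longrightarrow> P (letter_val f (s, b) * x)"
  shows "P x"
proof -
  obtain w where w: "w \<in> words K" "x = word_val f w"
    using assms(1) by (auto simp: generated_by_def)
  have "P (word_val f w)" using w(1)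
  proof (induction w)
    case (Cons l w)
    then have "word_val f w \<in> generated_by f K" by (simp add: generated_by_def)
    then show ?case
      using assms(3)[of "fst l" "word_val f w" "snd l"] Cons by simp
  qed (use assms(2) in simp)
  then show ?thesis using w by simp
qed

lemma letter_val_generated_by [simp]: "s \<in> K \<Longrightarrow> letter_val f (s, b) \<in> generated_by f K"
  by (cases b) auto

lemma commute_ginv:
  fixes x y :: "'g :: mult_group"
  assumes "x * y = y * x"
  shows "x * ginv y = ginv y * x"
proof -
  have "x * ginv y = ginv y * (y * x) * ginv y" by simp
  also have "\<dots> = ginv y * x" unfolding assms[symmetric]
    by (simp only: mult.assoc right_ginv mult_1_right)
  finally show ?thesis .
qed

lemma commute_letter_val:
  "x * f s = f s * (x :: 'g :: mult_group) \<Longrightarrow> x * letter_val f (s, b) = letter_val f (s, b) * x"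
  by (cases b) (simp_all only: letter_val_simps commute_ginv)

lemma commute_generated_by:
  assumes "\<And>s. s \<in> K \<Longrightarrow> z * f s = f s * z" "x \<in> generated_by f K"
  shows "z * x = x * z"
  using assms(2)
proof (induction rule: generated_by_induct)
  case (mult s b x)
  have "z * (letter_val f (s, b) * x) = letter_val f (s, b) * (z * x)"
    using commute_letter_val[of z f s b] assms(1)[OF mult(1)] by (metis mult.assoc)
  then show ?case by (simp only: mult.IH mult.assoc)
qed simp

definition positive_word :: "'a list \<Rightarrow> 'a word" where
  "positive_word u = map (\<lambda>s. (s, True)) u"

lemma positive_word_simps [simp]:
  "positive_word [] = []" "positive_word (s # u) = (s, True) # positive_word u"
  "positive_word (u @ v) = positive_word u @ positive_word v"
  by (auto simp: positive_word_def)

lemma positive_word_words [simp]: "positive_word u \<in> words K \<longleftrightarrow> set u \<subseteq> K"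
  by (induction u) auto

lemma word_val_positive_word: "word_val f (positive_word u) = prod_list (map f u)"
  by (induction u) auto

section \<open>Presentations\<close>

definition satisfies_relations ::
    "'a set \<Rightarrow> ('a word \<times> 'a word) set \<Rightarrow> ('a \<Rightarrow> 'g :: mult_group) \<Rightarrow> bool" where
  "satisfies_relations S R f \<longleftrightarrow>
     (\<forall>u v. (u, v) \<in> R \<longrightarrow> u \<in> words S \<longrightarrow> v \<in> words S \<longrightarrow> word_val f u = word_val f v)"

lemma word_val_pres_eq:
  assumes "pres_eq S R u v" "satisfies_relations S R f"
  shows "word_val f u = word_val f v"
  using assms(1)
proof induction
  case (cancel s b)
  then show ?case by (cases b) auto
qed (use assms(2) in \<open>auto simp: satisfies_relations_def\<close>)

text \<open>\<open>\<gamma>\<close> realises the presented group faithfully inside a type. The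
  universal property of the presentation then takes the form of
  \<open>word_val_transfer\<close>.\<close>

locale presentation =
  fixes S :: "'a set" and R :: "('a word \<times> 'a word) set" and \<gamma> :: "'a \<Rightarrow> 'g :: mult_group"
  assumes word_val_eq_iff:
    "u \<in> words S \<Longrightarrow> v \<in> words S \<Longrightarrow> word_val \<gamma> u = word_val \<gamma> v \<longleftrightarrow> pres_eq S R u v"
begin

lemma satisfies: "satisfies_relations S R \<gamma>"
  unfolding satisfies_relations_def by (simp add: word_val_eq_iff pres_eq.relator)

lemma word_val_transfer:
  assumes "satisfies_relations S R f" "u \<in> words S" "v \<in> words S" "word_val \<gamma> u = word_val \<gamma> v"
  shows "word_val f u = word_val f v"
  using assms word_val_eq_iff word_val_pres_eq by blast

end

definition translation :: "('g, 'b) monoid_scheme \<Rightarrow> 'g \<Rightarrow> 'g perm" where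
  "translation G x = Perm (\<lambda>y. if y \<in> carrier G then x \<otimes>\<^bsub>G\<^esub> y else y)"

context group
begin

lemma perm_apply_translation:
  assumes "x \<in> carrier G"
  shows "perm_apply (translation G x) y = (if y \<in> carrier G then x \<otimes> y else y)"
proof -
  have "bij (\<lambda>y. if y \<in> carrier G then x \<otimes> y else y)"
    by (rule bij_if_inverse[where g =
        "\<lambda>y. inv x \<otimes> y"]) (use assms in \<open>auto simp: m_assoc[symmetric]\<close>)
  then show ?thesis by (simp add: translation_def)
qed

lemma translation_mult:
  assumes "x \<in> carrier G" "y \<in> carrier G"
  shows "translation G (x \<otimes> y) = translation G x * translation G y"
  by (rule perm_eqI) (use assms in \<open>auto simp: perm_apply_translation m_assoc\<close>)

lemma inj_on_translation: "inj_on (translation G) (carrier G)"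
proof (rule inj_onI)
  fix x y assume "x \<in> carrier G" "y \<in> carrier G" "translation G x = translation G y"
  then show "x = y"
    by (metis one_closed perm_apply_translation r_one)
qed

lemma translation_one: "translation G \<one> = 1"
  by (rule perm_eqI) (auto simp: perm_apply_translation)

lemma translation_inv: "x \<in> carrier G \<Longrightarrow> translation G (inv x) = ginv (translation G x)"
  by (rule ginv_unique[symmetric]) (simp add: translation_mult[symmetric] translation_one)

end

definition regular_gen :: "'a set \<Rightarrow> ('a word \<times> 'a word) set \<Rightarrow> 'a \<Rightarrow> 'a word set perm" where
  "regular_gen S R s = translation (presented_group S R) (pres_gen S R s)"

lemma pres_class_carrier [simp]:
  "w \<in> words S \<Longrightarrow> pres_rel S R `` {w} \<in> carrier (presented_group S R)"
  by (auto simp: presented_group_def quotient_def)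

lemma carrier_presented_group:
  "carrier (presented_group S R) = (\<lambda>w. pres_rel S R `` {w}) ` words S"
  by (auto simp: presented_group_def quotient_def)

lemma pres_class_eq_iff:
  "u \<in> words S \<Longrightarrow> v \<in> words S \<Longrightarrow> pres_rel S R `` {u} = pres_rel S R `` {v} \<longleftrightarrow> pres_eq S R u v"
  using eq_equiv_class_iff[OF equiv_pres_rel, of u S v R] by (simp add: pres_rel_def)

lemma one_presented_group: "\<one>\<^bsub>presented_group S R\<^esub> = pres_rel S R `` {[]}"
  by (simp add: presented_group_def)

lemma inv_pres_gen:
  assumes "s \<in> S"
  shows "inv\<^bsub>presented_group S R\<^esub> (pres_gen S R s) = pres_rel S R `` {[(s, False)]}"
proof (rule group.inv_equality[OF group_presented_group])
  show "pres_rel S R `` {[(s, False)]} \<otimes>\<^bsub>presented_group S R\<^esub> pres_gen S R s =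
      \<one>\<^bsub>presented_group S R\<^esub>"
    unfolding one_presented_group pres_gen_def
    using assms pres_eq.cancel[OF assms, of R False]
      by (simp add: mult_pres_class pres_class_eq_iff)
qed (use assms in \<open>auto simp: pres_gen_def\<close>)

lemma translation_pres_class_letter:
  assumes "fst l \<in> S"
  shows "letter_val (regular_gen S R) l = translation (presented_group S R) (pres_rel S R `` {[l]})"
proof -
  interpret group "presented_group S R" by (rule group_presented_group)
  obtain s b where l: "l = (s, b)" and s: "s \<in> S" using assms by (cases l) auto
  have "pres_gen S R s \<in> carrier (presented_group S R)"
    using s by (simp add: pres_gen_def)
  then have "translation (presented_group S R) (pres_rel S R `` {[(s, False)]}) =
      ginv (regular_gen S R s)"
    using translation_inv[of "pres_gen S R s"] by (simp only: regular_gen_def inv_pres_gen[OF s])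
  then show ?thesis
    unfolding l by (cases b) (simp_all only: letter_val_simps, simp only: regular_gen_def
        pres_gen_def)
qed

lemma word_val_regular_gen:
  assumes "w \<in> words S"
  shows "word_val (regular_gen S R) w = translation (presented_group S R) (pres_rel S R `` {w})"
proof -
  interpret group "presented_group S R" by (rule group_presented_group)
  show ?thesis using assms
  proof (induction w)
    case Nil
    show ?case using translation_one by (simp add: one_presented_group)
  next
    case (Cons l w)
    then have s: "fst l \<in> S" and w: "w \<in> words S" by auto
    have "pres_rel S R `` {l # w} =
        pres_rel S R `` {[l]} \<otimes>\<^bsub>presented_group S R\<^esub> pres_rel S R `` {w}"
      using s w mult_pres_class[of "[l]" S w R] by simp
    then show ?case
      using Cons.IH[OF w] s w translation_pres_class_letter[OF s] by (simp add: translation_mult)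
  qed
qed

lemma presentation_regular_gen: "presentation S R (regular_gen S R)"
proof
  fix u v assume "u \<in> words S" "v \<in> words S"
  then show "word_val (regular_gen S R) u = word_val (regular_gen S R) v \<longleftrightarrow> pres_eq S R u v"
    using group.inj_on_translation[OF group_presented_group, of S R]
    by (simp add: word_val_regular_gen inj_on_eq_iff pres_class_eq_iff)
qed

section \<open>Amalgamated products\<close>

definition is_subgroup :: "'g :: mult_group set \<Rightarrow> bool" where
  "is_subgroup H \<longleftrightarrow> 1 \<in> H \<and> (\<forall>x \<in> H. \<forall>y \<in> H. x * y \<in> H) \<and> (\<forall>x \<in> H. ginv x \<in> H)"

lemma is_subgroup_generated_by [simp]: "is_subgroup (generated_by f K)"
  by (simp add: is_subgroup_def)

text \<open>\<open>Syllable i r f\<close> is a normal form starting with the nontrivial coset representative \<open>r\<close>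
  of the factor with index \<open>i\<close>.\<close>

datatype 'g normal_form = Base 'g | Syllable bool 'g "'g normal_form"

locale factors =
  fixes P :: "bool \<Rightarrow> 'g :: mult_group set" and D :: "'g set"
  assumes subgroup_P: "is_subgroup (P i)" and subgroup_D: "is_subgroup D" and D_subset: "D \<subseteq> P i"
begin

lemma P_closed [simp]:
  "1 \<in> P i" "x \<in> P i \<Longrightarrow> y \<in> P i \<Longrightarrow> x * y \<in> P i" "x \<in> P i \<Longrightarrow> ginv x \<in> P i"
  using subgroup_P by (auto simp: is_subgroup_def)

lemma D_closed [simp]:
  "1 \<in> D" "x \<in> D \<Longrightarrow> y \<in> D \<Longrightarrow> x * y \<in> D" "x \<in> D \<Longrightarrow> ginv x \<in> D"
  using subgroup_D by (auto simp: is_subgroup_def)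

lemma D_P [simp]: "x \<in> D \<Longrightarrow> x \<in> P i"
  using D_subset by blast

lemma ginv_D_iff [simp]: "ginv x \<in> D \<longleftrightarrow> x \<in> D"
  by (metis D_closed(3) ginv_ginv)

lemma mult_D_iff [simp]: "d \<in> D \<Longrightarrow> d * x \<in> D \<longleftrightarrow> x \<in> D" "d \<in> D \<Longrightarrow> x * d \<in> D \<longleftrightarrow> x \<in> D"
   apply (metis D_closed(2,3) ginv_mult_cancel)
  by (metis D_closed(2,3) mult.assoc mult.right_neutral right_ginv)

text \<open>The predicate under \<open>SOME\<close> depends only on the left coset of
  \<open>x\<close>, so the choice is constant on cosets. The coset \<open>D\<close> must get the
  representative 1, since 1 marks an absent syllable in normal forms.\<close>

definition coset_rep :: "'g \<Rightarrow> 'g" where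
  "coset_rep x = (if x \<in> D then 1 else SOME y. \<exists>d \<in> D. y = x * d)"

definition coset_rest :: "'g \<Rightarrow> 'g" where
  "coset_rest x = ginv (coset_rep x) * x"

lemma coset_rep_ex: "\<exists>d \<in> D. coset_rep x = x * d"
proof (cases "x \<in> D")
  case True
  then show ?thesis by (intro bexI[of _ "ginv x"]) (auto simp: coset_rep_def)
next
  case False
  have "\<exists>y. \<exists>d \<in> D. y = x * d" by (metis D_closed(1))
  then show ?thesis using False by (simp add: coset_rep_def) (rule someI_ex)
qed

lemma coset_rest_D [simp]: "coset_rest x \<in> D"
  using coset_rep_ex[of x] by (auto simp: coset_rest_def mult.assoc)

lemma coset_rep_rest [simp]: "coset_rep x * coset_rest x = x"
  by (simp add: coset_rest_def)

lemma coset_rep_mult_D [simp]: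
  assumes "d \<in> D"
  shows "coset_rep (x * d) = coset_rep x"
proof -
  have "(\<exists>e \<in> D. y = x * d * e) \<longleftrightarrow> (\<exists>e \<in> D. y = x * e)" for y
  proof
    assume "\<exists>e \<in> D. y = x * e"
    then obtain e where e: "e \<in> D" "y = x * e" by blast
    then show "\<exists>e \<in> D. y = x * d * e"
      by (intro bexI[of _ "ginv d * e"]) (auto simp: assms mult.assoc)
  qed (use assms in \<open>auto simp: mult.assoc intro: bexI[of _ "d * _"]\<close>)
  then show ?thesis using assms by (simp add: coset_rep_def)
qed

lemma coset_rep_P [simp]: "x \<in> P i \<Longrightarrow> coset_rep x \<in> P i"
  using coset_rep_ex[of x] by auto

lemma coset_rep_D_iff [simp]: "coset_rep x \<in> D \<longleftrightarrow> x \<in> D"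
  using coset_rep_ex[of x] by auto

lemma coset_rep_eq_1_iff: "coset_rep x = 1 \<longleftrightarrow> x \<in> D"
  by (metis D_closed(1) coset_rep_D_iff coset_rep_def)

lemma coset_rep_mult: "coset_rep (y * coset_rep x) = coset_rep (y * x)"
proof -
  have "y * x = y * coset_rep x * coset_rest x" by (simp add: mult.assoc)
  then show ?thesis by (metis coset_rep_mult_D coset_rest_D)
qed

lemma coset_rep_idem [simp]: "coset_rep (coset_rep x) = coset_rep x"
  using coset_rep_mult[of 1 x] by simp

lemma coset_rest_mult: "coset_rest (y * coset_rep x) * coset_rest x = coset_rest (y * x)"
  unfolding coset_rest_def[of "y * coset_rep x"] coset_rep_mult
  by (simp add: coset_rest_def[of "y * x"] mult.assoc)

lemma coset_rest_rep: "coset_rep r = r \<Longrightarrow> coset_rest r = 1"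
  by (simp add: coset_rest_def)

text \<open>Left multiplication by an element of \<open>D\<close>: it changes the leading
  representative, and what is left over in \<open>D\<close> travels on to the right until the base
  absorbs it.\<close>

fun push :: "'g \<Rightarrow> 'g normal_form \<Rightarrow> 'g normal_form" where
  "push d (Base e) = Base (d * e)"
| "push d (Syllable i r f) = Syllable i (coset_rep (d * r)) (push (coset_rest (d * r)) f)"

fun starts_with :: "bool \<Rightarrow> 'g normal_form \<Rightarrow> bool" where
  "starts_with i (Base e) = False"
| "starts_with i (Syllable j r f) = (i = j)"

fun normal :: "'g normal_form \<Rightarrow> bool" where
  "normal (Base e) = (e \<in> D)"
| "normal (Syllable i r f) =
     (r \<in> P i \<and> r \<notin> D \<and> coset_rep r = r \<and> normal f \<and> \<not> starts_with i f)"

lemma starts_with_push [simp]: "starts_with i (push d f) = starts_with i f"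
  by (cases f) auto

lemma normal_push [simp]: "d \<in> D \<Longrightarrow> normal f \<Longrightarrow> normal (push d f)"
  by (induction f arbitrary: d) auto

lemma push_push: "push d (push e f) = push (d * e) f"
  by (induction f arbitrary: d e) (auto simp: mult.assoc coset_rep_mult coset_rest_mult)

lemma push_one: "normal f \<Longrightarrow> push 1 f = f"
  by (induction f) (auto simp: coset_rest_rep)

fun split_form :: "bool \<Rightarrow> 'g normal_form \<Rightarrow> 'g \<times> 'g normal_form" where
  "split_form i (Syllable j r f) = (if i = j then (r, f) else (1, Syllable j r f))"
| "split_form i (Base e) = (1, Base e)"

definition join_form :: "bool \<Rightarrow> 'g \<Rightarrow> 'g normal_form \<Rightarrow> 'g normal_form" where
  "join_form i r f = (if r = 1 then f else Syllable i r f)"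

lemma split_form_normal:
  assumes "normal f"
  obtains r g where "split_form i f = (r, g)" "r \<in> P i" "coset_rep r = r" "normal g"
    "\<not> starts_with i g" "join_form i r g = f"
proof (cases "starts_with i f")
  case True
  then obtain r g where "f = Syllable i r g" by (cases f) auto
  moreover have "r \<noteq> 1" using assms calculation D_closed(1) by fastforce
  ultimately show ?thesis using assms that[of r g] by (simp add: join_form_def)
next
  case False
  then have "split_form i f = (1, f)" by (cases f) auto
  then show ?thesis
    using assms that[of 1 f] False by (auto simp: join_form_def coset_rep_eq_1_iff)
qed

lemma split_join_form:
  "\<not> starts_with i g \<Longrightarrow> split_form i (join_form i r g) = (r, g)"
  by (cases g) (auto simp: join_form_def)

text \<open>Van der Waerden's action: an element of factor \<open>i\<close> merges with a leading
  syllable of that factor, and the product is split again into representative and rest. An absent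
  syllable counts as the representative 1.\<close>

definition form_act :: "bool \<Rightarrow> 'g \<Rightarrow> 'g normal_form \<Rightarrow> 'g normal_form" where
  "form_act i x f = (case split_form i f of (r, g) \<Rightarrow>
     join_form i (coset_rep (x * r)) (push (coset_rest (x * r)) g))"

lemma normal_join_form:
  "normal g \<Longrightarrow> \<not> starts_with i g \<Longrightarrow> r \<in> P i \<Longrightarrow> coset_rep r = r \<Longrightarrow> normal (join_form i r g)"
  by (auto simp: join_form_def coset_rep_eq_1_iff dest: coset_rep_eq_1_iff[THEN iffD2])

lemma normal_form_act:
  assumes "normal f" "x \<in> P i"
  shows "normal (form_act i x f)"
proof -
  obtain r g where rg: "split_form i f = (r, g)" "r \<in> P i" "normal g" "\<not> starts_with i g"
    using split_form_normal[OF assms(1)] by metis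
  then show ?thesis using assms(2) by (auto simp: form_act_def intro!: normal_join_form)
qed

lemma form_act_mult:
  assumes "normal f"
  shows "form_act i x (form_act i y f) = form_act i (x * y) f"
proof -
  obtain r g where rg: "split_form i f = (r, g)" "normal g" "\<not> starts_with i g"
    using split_form_normal[OF assms] by metis
  then show ?thesis
    by (simp add: form_act_def split_join_form coset_rep_mult push_push coset_rest_mult mult.assoc)
qed

lemma form_act_D:
  assumes "normal f" "d \<in> D"
  shows "form_act i d f = push d f"
proof (cases "starts_with i f")
  case True
  then obtain r g where "f = Syllable i r g" by (cases f) auto
  then show ?thesis
    using assms by (auto simp: form_act_def join_form_def coset_rep_eq_1_iff)
next
  case False
  then have "split_form i f = (1, f)" by (cases f) auto
  moreover have "coset_rep d = 1" using assms by (simp add: coset_rep_eq_1_iff)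
  ultimately show ?thesis by (simp add: form_act_def join_form_def coset_rest_def)
qed

definition form_perm :: "bool \<Rightarrow> 'g \<Rightarrow> 'g normal_form perm" where
  "form_perm i x = Perm (\<lambda>f. if f \<in> Collect normal then form_act i x f else f)"

lemma perm_apply_form_perm:
  assumes "x \<in> P i"
  shows "perm_apply (form_perm i x) f = (if normal f then form_act i x f else f)"
proof -
  have "bij (\<lambda>f. if f \<in> Collect normal then form_act i x f else f)"
    by (rule bij_if_inverse[where g = "form_act i (ginv x)"])
      (use assms in \<open>auto simp: normal_form_act form_act_mult form_act_D push_one\<close>)
  then show ?thesis by (simp add: form_perm_def)
qed

lemma form_perm_mult:
  "x \<in> P i \<Longrightarrow> y \<in> P i \<Longrightarrow> form_perm i (x * y) = form_perm i x * form_perm i y"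
  by (rule perm_eqI) (auto simp: perm_apply_form_perm form_act_mult normal_form_act)

lemma form_perm_one: "form_perm i 1 = 1"
  by (rule perm_eqI) (auto simp: perm_apply_form_perm form_act_D push_one)

lemma form_perm_ginv: "x \<in> P i \<Longrightarrow> form_perm i (ginv x) = ginv (form_perm i x)"
  by (rule ginv_unique[symmetric]) (simp add: form_perm_mult[symmetric] form_perm_one)

text \<open>The compatibility that lets the actions of the two factors glue: on \<open>D\<close>
  both are \<open>push\<close>.\<close>

lemma form_perm_D: "d \<in> D \<Longrightarrow> form_perm i d = form_perm j d"
  by (rule perm_eqI) (auto simp: perm_apply_form_perm form_act_D)

definition reduced :: "(bool \<times> 'g) list \<Rightarrow> bool" where
  "reduced xs \<longleftrightarrow> (\<forall>(i, x) \<in> set xs. x \<in> P i - D) \<and> successively (\<lambda>a b. fst a \<noteq> fst b) xs"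

lemma reduced_Nil [simp]: "reduced []"
  by (simp add: reduced_def)

lemma reduced_Cons:
  "reduced ((i, x) # xs) \<longleftrightarrow> x \<in> P i \<and> x \<notin> D \<and> reduced xs \<and> (xs \<noteq> [] \<longrightarrow> fst (hd xs) = (\<not> i))"
  by (cases xs) (auto simp: reduced_def)

lemma reduced_append:
  "reduced (xs @ ys) \<longleftrightarrow> reduced xs \<and> reduced ys \<and>
     (xs \<noteq> [] \<longrightarrow> ys \<noteq> [] \<longrightarrow> fst (last xs) \<noteq> fst (hd ys))"
  by (auto simp: reduced_def successively_append_iff)

definition inverse_syllables :: "(bool \<times> 'g) list \<Rightarrow> (bool \<times> 'g) list" where
  "inverse_syllables xs = rev (map (apsnd ginv) xs)"

definition syllable_prod :: "(bool \<times> 'g) list \<Rightarrow> 'g" where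
  "syllable_prod xs = prod_list (map snd xs)"

lemma syllable_prod_simps [simp]:
  "syllable_prod [] = 1" "syllable_prod (a # xs) = snd a * syllable_prod xs"
  "syllable_prod (xs @ ys) = syllable_prod xs * syllable_prod ys"
  "syllable_prod (inverse_syllables xs) = ginv (syllable_prod xs)"
     apply (simp_all add: syllable_prod_def inverse_syllables_def)
  by (induction xs) auto

lemma inverse_syllables_ends [simp]:
  "inverse_syllables xs = [] \<longleftrightarrow> xs = []"
  "xs \<noteq> [] \<Longrightarrow> fst (hd (inverse_syllables xs)) = fst (last xs)"
  "xs \<noteq> [] \<Longrightarrow> fst (last (inverse_syllables xs)) = fst (hd xs)"
  by (auto simp: inverse_syllables_def hd_rev last_rev last_map hd_map)

lemma reduced_inverse_syllables: "reduced xs \<Longrightarrow> reduced (inverse_syllables xs)"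
proof (induction xs)
  case (Cons a xs)
  obtain i x where a: "a = (i, x)" by fastforce
  have "inverse_syllables (a # xs) = inverse_syllables xs @ [(i, ginv x)]"
    by (simp add: a inverse_syllables_def)
  then show ?case
    using Cons a by (cases "xs = []") (auto simp: reduced_append reduced_Cons)
qed (simp add: inverse_syllables_def)

end

text \<open>The universal property of the amalgam enters through a single homomorphism
  \<open>\<phi>\<close>, the one that extends the actions of both factors on normal forms.\<close>

locale amalgam = factors P D for P :: "bool \<Rightarrow> 'g :: mult_group set" and D +
  fixes G :: "'g set" and \<phi> :: "'g \<Rightarrow> 'g normal_form perm"
  assumes subgroup_G: "is_subgroup G" and P_subset: "P i \<subseteq> G"
    and hom: "x \<in> G \<Longrightarrow> y \<in> G \<Longrightarrow> \<phi> (x * y) = \<phi> x * \<phi> y"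
    and hom_P: "x \<in> P i \<Longrightarrow> \<phi> x = form_perm i x"
begin

text \<open>The syllables act on \<open>Base 1\<close> from the right end, and each one meets a
  normal form that does not start with its own factor. So each adds a syllable in front, and the
  result is never \<open>Base 1\<close>.\<close>

lemma reduced_prod_nontrivial:
  assumes "reduced xs" "xs \<noteq> []"
  shows "syllable_prod xs \<noteq> 1"
proof -
  have "syllable_prod xs \<in> G \<and> (let f = perm_apply (\<phi> (syllable_prod xs)) (Base 1) in
      normal f \<and> (if xs = [] then f = Base 1 else starts_with (fst (hd xs)) f))"
    using assms(1)
  proof (induction xs)
    case Nil
    have "\<phi> 1 = 1" using hom_P[of 1 True] form_perm_one by simp
    then show ?case using subgroup_G by (simp add: is_subgroup_def)
  next
    case (Cons a xs)
    obtain i x where a: "a = (i, x)" by fastforce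
    let ?f = "perm_apply (\<phi> (syllable_prod xs)) (Base 1)"
    have x: "x \<in> P i" "x \<notin> D" "reduced xs" using Cons.prems a by (auto simp: reduced_Cons)
    then have G: "x \<in> G" "syllable_prod xs \<in> G" and f: "normal ?f"
      using Cons.IH P_subset by (auto simp: Let_def)
    have "\<not> starts_with i ?f"
    proof (cases "xs = []")
      case False
      then have "fst (hd xs) = (\<not> i)" "starts_with (fst (hd xs)) ?f"
        using Cons x a by (auto simp: reduced_Cons Let_def)
      then show ?thesis by (cases ?f) auto
    qed (use Cons.IH x in \<open>auto simp: Let_def\<close>)
    then have "split_form i ?f = (1, ?f)" by (cases ?f) auto
    then have "starts_with i (form_act i x ?f)"
      using x by (simp add: form_act_def join_form_def coset_rep_eq_1_iff)
    moreover have "x * syllable_prod xs \<in> G" using G subgroup_G by (auto simp: is_subgroup_def)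
    ultimately show ?case
      using x f a hom[OF G] hom_P[OF x(1)] normal_form_act[OF f x(1)]
      by (simp add: Let_def perm_apply_form_perm)
  qed
  then show ?thesis
    using assms(2) hom_P[of 1 True] form_perm_one by (auto simp: Let_def)
qed

lemma reduced_mult_left:
  assumes "x \<in> P i" "reduced xs"
  shows "x * syllable_prod xs \<in> D \<or> (\<exists>ys. ys \<noteq> [] \<and> reduced ys \<and> syllable_prod ys =
      x * syllable_prod xs)"
proof (cases xs)
  case Nil
  then show ?thesis
    using assms by (cases "x \<in> D") (auto intro!: exI[of _ "[(i, x)]"] simp: reduced_Cons)
next
  case (Cons a ys)
  obtain j y where a: "a = (j, y)" by fastforce
  have y: "y \<in> P j" "y \<notin> D" "reduced ys" "ys \<noteq> [] \<Longrightarrow> fst (hd ys) = (\<not> j)"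
    using assms(2) Cons a by (auto simp: reduced_Cons)
  show ?thesis
  proof (cases "x \<in> D \<or> j = i")
    case False
    then have "reduced ((i, x) # xs)" using assms Cons a by (auto simp: reduced_Cons)
    then show ?thesis by (intro disjI2 exI[of _ "(i, x) # xs"]) simp
  next
    case True
    then have xj: "x \<in> P j" using assms(1) by auto
    show ?thesis
    proof (cases "x * y \<in> D")
      case False
      then have "reduced ((j, x * y) # ys)" using y xj by (auto simp: reduced_Cons)
      then show ?thesis
        using Cons a by (intro disjI2 exI[of _ "(j, x * y) # ys"]) (simp add: mult.assoc)
    next
      case xy: True
      show ?thesis
      proof (cases ys)
        case Nil
        then show ?thesis using xy Cons a by simp
      next
        case (Cons b zs)
        obtain k z where b: "b = (k, z)" by fastforce
        \<comment> \<open>The first syllable has collapsed into \<open>D\<close>; the next one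
          absorbs it, keeps its factor \<open>k\<close> and stays outside \<open>D\<close>.\<close>
        have "reduced ((k, x * y * z) # zs)"
          using y Cons b xy by (auto simp: reduced_Cons simp del: mult.assoc)
        then show ?thesis
          using Cons \<open>xs = a # ys\<close> a b
          by (intro disjI2 exI[of _ "(k, x * y * z) # zs"]) (simp add: mult.assoc)
      qed
    qed
  qed
qed

text \<open>A central element outside \<open>D\<close> would have a reduced expression, and commuting it with its
  first syllable or with an element of the other factor yields a nontrivial reduced expression
  of \<open>1\<close>.\<close>

lemma central_in_D:
  assumes gen: "G = generated_by f K" "\<And>s. s \<in> K \<Longrightarrow> \<exists>i. f s \<in> P i"
    and nontrivial: "\<And>i. \<not> P i \<subseteq> D"
    and z: "z \<in> G" "\<And>x. x \<in> G \<Longrightarrow> z * x = x * z"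
  shows "z \<in> D"
proof (rule ccontr)
  assume "z \<notin> D"
  have "x \<in> D \<or> (\<exists>xs. xs \<noteq> [] \<and> reduced xs \<and> syllable_prod xs = x)" if "x \<in> G" for x
    using that unfolding gen(1)
  proof (induction rule: generated_by_induct)
    case (mult s b x)
    obtain i where "f s \<in> P i" using gen(2) mult by blast
    then have l: "letter_val f (s, b) \<in> P i" by (cases b) auto
    from mult(3) show ?case
    proof
      assume "x \<in> D"
      then have "letter_val f (s, b) * x \<in> P i" using l by simp
      from reduced_mult_left[OF this reduced_Nil] show ?thesis by simp
    qed (use reduced_mult_left[OF l] in blast)
  qed simp
  then obtain xs where xs: "xs \<noteq> []" "reduced xs" "syllable_prod xs = z"
    using z(1) \<open>z \<notin> D\<close> by blast
  show False
  proof (cases "fst (hd xs) = fst (last xs)")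
    case True
    let ?i = "\<not> fst (hd xs)"
    obtain b where b: "b \<in> P ?i" "b \<notin> D" using nontrivial by blast
    then have "reduced (xs @ [(?i, b)] @ inverse_syllables xs @ [(?i, ginv b)])"
      using xs True reduced_inverse_syllables[OF xs(2)] by (auto simp: reduced_append reduced_Cons)
    then have "z * (b * (ginv z * ginv b)) \<noteq> 1"
      using reduced_prod_nontrivial[of "xs @ [(?i, b)] @ inverse_syllables xs @ [(?i, ginv b)]"] xs
      by simp
    moreover have "b * (ginv z * ginv b) = ginv z"
      using z(2)[of b] b P_subset
      by (metis commute_ginv ginv_mult mult.assoc mult.right_neutral right_ginv subset_iff)
    ultimately show False by simp
  next
    case False
    obtain i x ys where ys: "xs = (i, x) # ys" using xs(1) by (cases xs) auto
    then have "ys \<noteq> []" using False by auto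
    \<comment> \<open>Moving the first syllable to the end conjugates \<open>z\<close> by
      \<open>x\<close> and keeps its value. As the two end syllables belong to different factors, no
      junction of this list collapses.\<close>
    then have "reduced (ys @ [(i, x)] @ inverse_syllables xs)"
      using xs False ys reduced_inverse_syllables[OF xs(2)]
        by (simp add: reduced_append) (auto simp: reduced_Cons)
    then have "syllable_prod ys * (x * ginv z) \<noteq> 1"
      using reduced_prod_nontrivial[of "ys @ [(i, x)] @ inverse_syllables xs"] xs(3) by simp
    moreover have "x \<in> G" using xs ys P_subset by (auto simp: reduced_Cons)
    then have "x * (syllable_prod ys * x) = x * z"
      using z(2)[of x] xs(3)[unfolded ys] by (metis mult.assoc snd_conv syllable_prod_simps(2))
    then have "syllable_prod ys * x = z" by simp
    ultimately show False by (metis mult.assoc right_ginv)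
  qed
qed

end

section \<open>Presentations whose relators each omit one of two generators\<close>

lemma (in presentation) transfer_function:
  assumes "satisfies_relations S R f"
  obtains \<phi> where "\<And>w. w \<in> words S \<Longrightarrow> \<phi> (word_val \<gamma> w) = word_val f w"
proof
  let ?\<phi> = "\<lambda>x. word_val f (SOME w. w \<in> words S \<and> word_val \<gamma> w = x)"
  fix w assume w: "w \<in> words S"
  let ?v = "SOME v. v \<in> words S \<and> word_val \<gamma> v = word_val \<gamma> w"
  have "?v \<in> words S \<and> word_val \<gamma> ?v = word_val \<gamma> w" by (rule someI[of _ w]) (simp add: w)
  then show "?\<phi> (word_val \<gamma> w) = word_val f w"
    using word_val_transfer[OF assms] w by blast
qed

text \<open>A relator omitting \<open>s\<close> or \<open>t\<close> can be checked inside one of the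
  two factors, where \<open>f\<close> is the action of that factor on normal forms. Hence the two
  actions fit together to the homomorphism that \<open>amalgam\<close> asks for.\<close>

lemma (in presentation) central_subset_amalgam:
  assumes st: "s \<in> S" "t \<in> S" "s \<noteq> t"
    and R: "\<And>u v. (u, v) \<in> R \<Longrightarrow> u \<in> words S \<Longrightarrow> v \<in> words S \<Longrightarrow>
      u \<in> words (S - {s}) \<and> v \<in> words (S - {s}) \<or> u \<in> words (S - {t}) \<and> v \<in> words (S - {t})"
    and nontrivial: "\<gamma> s \<notin> generated_by \<gamma> (S - {s, t})" "\<gamma> t \<notin> generated_by \<gamma> (S - {s, t})"
    and z: "z \<in> generated_by \<gamma> S" "\<And>x. x \<in> generated_by \<gamma> S \<Longrightarrow> z * x = x * z"
  shows "z \<in> generated_by \<gamma> (S - {s, t})"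
proof -
  define D where "D = generated_by \<gamma> (S - {s, t})"
  define K where "K i = S - {if i then s else t}" for i
  define P where "P i = generated_by \<gamma> (K i)" for i
  have DP: "D \<subseteq> P i" for i
    unfolding D_def P_def K_def by (intro generated_by_mono) auto
  interpret factors P D
    by standard (auto simp: DP, simp_all add: D_def P_def)
  \<comment> \<open>Index \<open>True\<close> is the factor omitting \<open>s\<close>; only
    \<open>s\<close> itself has to act through the other one. Generators in both factors act the
    same way through either by \<open>form_perm_D\<close>.\<close>
  define f where "f u = form_perm (u \<noteq> s) (\<gamma> u)" for u
  have letter: "letter_val f l = form_perm i (letter_val \<gamma> l)" if "fst l \<in> K i" for l i
  proof -
    obtain u b where l: "l = (u, b)" by fastforce
    have u: "\<gamma> u \<in> P i" using that l by (simp add: P_def)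
    have "f u = form_perm i (\<gamma> u)"
    proof (cases "i = (u \<noteq> s)")
      case False
      then have "u \<in> S - {s, t}" using that l st by (auto simp: K_def split: if_splits)
      then have "\<gamma> u \<in> D" by (simp add: D_def)
      then show ?thesis unfolding f_def by (rule form_perm_D)
    qed (simp add: f_def)
    then show ?thesis using l u by (cases b) (simp_all add: form_perm_ginv)
  qed
  have f_val: "word_val f w = form_perm i (word_val \<gamma> w)" if "w \<in> words (K i)" for w i
    using that
  proof (induction w)
    case (Cons l w)
    have "letter_val \<gamma> l \<in> P i"
      using Cons.prems letter_val_generated_by[of "fst l" "K i" \<gamma> "snd l"] by (simp add: P_def)
    moreover have "word_val \<gamma> w \<in> P i"
      using Cons.prems by (simp add: P_def generated_by_def)
    ultimately show ?case using Cons letter[of l i] by (simp add: form_perm_mult)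
  qed (simp add: form_perm_one)
  have "satisfies_relations S R f"
    unfolding satisfies_relations_def
  proof (intro allI impI)
    fix u v assume uv: "(u, v) \<in> R" "u \<in> words S" "v \<in> words S"
    then have "word_val \<gamma> u = word_val \<gamma> v" using satisfies by (simp add: satisfies_relations_def)
    moreover obtain i where "u \<in> words (K i)" "v \<in> words (K i)"
      using R[OF uv] that[of True] that[of False] by (auto simp: K_def)
    ultimately show "word_val f u = word_val f v" using f_val by metis
  qed
  then obtain \<phi> where \<phi>: "\<And>w. w \<in> words S \<Longrightarrow> \<phi> (word_val \<gamma> w) = word_val f w"
    using transfer_function by blast
  have KS: "words (K i) \<subseteq> words S" for i by (rule words_mono) (auto simp: K_def)
  interpret amalgam P D "generated_by \<gamma> S" \<phi>
  proof
    show "P i \<subseteq> generated_by \<gamma> S" for i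
      unfolding P_def K_def by (rule generated_by_mono) auto
  next
    fix x y assume "x \<in> generated_by \<gamma> S" "y \<in> generated_by \<gamma> S"
    then obtain u v where "u \<in> words S" "v \<in> words S" "x = word_val \<gamma> u" "y = word_val \<gamma> v"
      by (auto simp: generated_by_def)
    then show "\<phi> (x * y) = \<phi> x * \<phi> y" using \<phi>[of "u @ v"] \<phi> by simp
  next
    fix x i assume "x \<in> P i"
    then obtain w where w: "w \<in> words (K i)" "x = word_val \<gamma> w"
      by (auto simp: P_def generated_by_def)
    then show "\<phi> x = form_perm i x" using \<phi>[of w] f_val[of w i] subsetD[OF KS w(1)] by simp
  qed simp
  show ?thesis unfolding D_def[symmetric]
  proof (rule central_in_D[OF HOL.refl _ _ z])
    show "\<exists>i. \<gamma> u \<in> P i" if "u \<in> S" for u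
      using that st by (intro exI[of _ "u \<noteq> s"]) (simp add: P_def K_def)
    show "\<not> P i \<subseteq> D" for i
      using nontrivial st generated_by_gen[of t "S - {s}" \<gamma>] generated_by_gen[of s "S - {t}" \<gamma>]
      by (cases i) (auto simp: P_def D_def K_def simp del: generated_by_gen)
  qed auto
qed

section \<open>The Burau representation\<close>

text \<open>With \<open>q = r^2\<close>, the operator \<open>burau\<close> is multiplication by
  \<open>-q\<close> on the basis vector of \<open>s\<close> and the identity on the kernel of this
  functional, as for the Hecke algebra. Writing \<open>q\<close> as a square keeps the off-diagonal
  entries \<open>2 * r * c s u\<close> symmetric along with \<open>c\<close>. For
  \<open>r = 1\<close> and cosines of \<open>pi / m\<close> these are the reflections of the
  geometric representation of the Coxeter group.\<close>

definition burau_coord :: "('a \<Rightarrow> 'a \<Rightarrow> real) \<Rightarrow> 'a set \<Rightarrow> real \<Rightarrow> 'a \<Rightarrow> ('a \<Rightarrow> real) \<Rightarrow> real" where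
  "burau_coord c V r s v = (1 + r\<^sup>2) * v s - 2 * r * (\<Sum>u \<in> V - {s}. c s u * v u)"

definition burau :: "('a \<Rightarrow> 'a \<Rightarrow> real) \<Rightarrow> 'a set \<Rightarrow> real \<Rightarrow> 'a \<Rightarrow> ('a \<Rightarrow> real) \<Rightarrow> 'a \<Rightarrow> real" where
  "burau c V r s v = v(s := v s - burau_coord c V r s v)"

lemma burau_coord_same: "burau_coord c V r s (v(s := v s - a)) =
    burau_coord c V r s v - (1 + r\<^sup>2) * a"
proof -
  have "(\<Sum>u \<in> V - {s}. c s u * (v(s := v s - a)) u) = (\<Sum>u \<in> V - {s}. c s u * v u)"
    by (rule sum.cong) auto
  then show ?thesis by (simp add: burau_coord_def algebra_simps)
qed

lemma burau_coord_other:
  assumes "finite V" "s \<in> V" "s \<noteq> t"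
  shows "burau_coord c V r t (v(s := v s - a)) = burau_coord c V r t v + 2 * r * c t s * a"
proof -
  have s: "s \<in> V - {t}" using assms by auto
  have "(\<Sum>u \<in> V - {t} - {s}. c t u * (v(s := v s - a)) u) = (\<Sum>u \<in> V - {t} - {s}. c t u * v u)"
    by (rule sum.cong) auto
  then have *: "(\<Sum>u \<in> V - {t}. c t u * (v(s := v s - a)) u) =
      (\<Sum>u \<in> V - {t}. c t u * v u) - c t s * a"
    using assms(1) s by (simp add: sum.remove[of "V - {t}" s] algebra_simps)
  show ?thesis unfolding burau_coord_def * using assms(3) by (simp add: algebra_simps)
qed

lemma bij_burau:
  assumes "r \<noteq> 0"
  shows "bij (burau c V r s)"
proof (rule o_bij)
  let ?S = "\<lambda>v. \<Sum>u \<in> V - {s}. c s u * v u"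
  let ?g = "\<lambda>v. v(s := (2 * r * ?S v - v s) / r\<^sup>2)"
  have S: "?S (v(s := a)) = ?S v" for v a by (rule sum.cong) auto
  have b: "burau c V r s v = v(s := 2 * r * ?S v - r\<^sup>2 * v s)" for v
    by (simp add: burau_def burau_coord_def algebra_simps)
  show "?g \<circ> burau c V r s = id" using assms
    by (auto simp: fun_eq_iff b S simp del: fun_upd_apply) simp
  show "burau c V r s \<circ> ?g = id" using assms
    by (auto simp: fun_eq_iff b S simp del: fun_upd_apply) simp
qed

definition burau_perm :: "('a \<Rightarrow> 'a \<Rightarrow> real) \<Rightarrow> 'a set \<Rightarrow> real \<Rightarrow> 'a \<Rightarrow> ('a \<Rightarrow> real) perm" where
  "burau_perm c V r s = Perm (burau c V r s)"

lemma perm_apply_burau_perm [simp]: "r \<noteq> 0 \<Longrightarrow> perm_apply (burau_perm c V r s) = burau c V r s"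
  by (simp add: burau_perm_def bij_burau)

section \<open>Alternating products of two deformed reflections\<close>

fun chebyshev :: "real \<Rightarrow> real \<Rightarrow> nat \<Rightarrow> real" where
  "chebyshev r x 0 = 0"
| "chebyshev r x (Suc 0) = 1"
| "chebyshev r x (Suc (Suc k)) = 2 * r * x * chebyshev r x (Suc k) - r\<^sup>2 * chebyshev r x k"

text \<open>For positive \<open>n\<close>, \<open>chebyshev r x n\<close> is
  \<open>r ^ (n - 1)\<close> times the Chebyshev polynomial of the second kind of degree
  \<open>n - 1\<close>; hence the shifted index and the powers of \<open>r\<close>. The factors on
  the left avoid a division by the sine.\<close>

lemma chebyshev_cos: "r * sin \<theta> * chebyshev r (cos \<theta>) n = r ^ n * sin (n * \<theta>)"
proof (induction r "cos \<theta>" n rule: chebyshev.induct)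
  case (3 r k)
  have *: "sin (real (Suc (Suc k)) * \<theta>) = 2 * cos \<theta> * sin (real (Suc k) * \<theta>) - sin (real k * \<theta>)"
  proof -
    have "sin (real (Suc k) * \<theta> + \<theta>) + sin (real (Suc k) * \<theta> - \<theta>) =
        2 * cos \<theta> * sin (real (Suc k) * \<theta>)"
      by (simp add: sin_add sin_diff)
    moreover have "real (Suc k) * \<theta> + \<theta> = real (Suc (Suc k)) * \<theta>"
        "real (Suc k) * \<theta> - \<theta> = real k * \<theta>"
      by (auto simp: algebra_simps)
    ultimately show ?thesis by simp
  qed
  have "r * sin \<theta> * chebyshev r (cos \<theta>) (Suc (Suc k)) =
      2 * r * cos \<theta> * (r * sin \<theta> * chebyshev r (cos \<theta>) (Suc k)) - r\<^sup>2 * (r * sin \<theta> * chebyshev r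
          (cos \<theta>) k)"
    by (simp add: algebra_simps)
  also have "\<dots> = r ^ Suc (Suc k) * sin (real (Suc (Suc k)) * \<theta>)"
    unfolding 3 * by (simp add: algebra_simps power2_eq_square)
  finally show ?case .
qed auto

lemma chebyshev_one: "chebyshev 1 1 n = n"
  by (induction "1::real" "1::real" n rule: chebyshev.induct) auto

fun alt_apply :: "('b \<Rightarrow> 'v \<Rightarrow> 'v) \<Rightarrow> 'b \<Rightarrow> 'b \<Rightarrow> nat \<Rightarrow> 'v \<Rightarrow> 'v" where
  "alt_apply f s t 0 v = v"
| "alt_apply f s t (Suc k) v = alt_apply f t s k (f s v)"

definition alt_even :: "(nat \<Rightarrow> real) \<Rightarrow> nat \<Rightarrow> real" where
  "alt_even F k = (\<Sum>j<k. if even j then F j else 0)"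

definition alt_odd :: "(nat \<Rightarrow> real) \<Rightarrow> nat \<Rightarrow> real" where
  "alt_odd F k = (\<Sum>j<k. if odd j then F j else 0)"

text \<open>The amount subtracted in step \<open>j\<close> when two letters act alternately,
  starting from the functional values \<open>a\<close> of the first and \<open>b\<close> of the
  second: one step replaces (a, b) by (b + 2rxa, -r^2 a), which is the Chebyshev recursion.
  \<open>alt_even\<close> collects the steps of the first letter, \<open>alt_odd\<close> those of
  the second.\<close>

definition cheb_comb :: "real \<Rightarrow> real \<Rightarrow> real \<Rightarrow> real \<Rightarrow> nat \<Rightarrow> real" where
  "cheb_comb r x a b j = a * chebyshev r x (Suc j) + b * chebyshev r x j"

lemma alt_apply_burau:
  assumes "finite V" "s \<in> V" "t \<in> V" "s \<noteq> t" "c s t = x" "c t s = x"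
  shows "alt_apply (burau c V r) s t k v =
    v(s := v s - alt_even (cheb_comb r x (burau_coord c V r s v) (burau_coord c V r t v)) k,
      t := v t - alt_odd (cheb_comb r x (burau_coord c V r s v) (burau_coord c V r t v)) k)"
  using assms
proof (induction k arbitrary: s t v)
  case 0
  then show ?case by (simp add: alt_even_def alt_odd_def)
next
  case (Suc k)
  let ?a = "burau_coord c V r s v" and ?b = "burau_coord c V r t v"
  define w where "w = burau c V r s v"
  have ws: "burau_coord c V r s w = - r\<^sup>2 * ?a"
    unfolding w_def burau_def burau_coord_same by (simp add: algebra_simps)
  have wt: "burau_coord c V r t w = ?b + 2 * r * x * ?a"
    unfolding w_def burau_def using burau_coord_other[OF Suc.prems(1,2,4)] Suc.prems by simp
  have F: "cheb_comb r x (?b + 2 * r * x * ?a) (- r\<^sup>2 * ?a) j = cheb_comb r x ?a ?b (Suc j)" for j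
    by (simp add: cheb_comb_def algebra_simps)
  have "alt_even (cheb_comb r x ?a ?b) (Suc k) =
      ?a + alt_odd (cheb_comb r x (?b + 2 * r * x * ?a) (- r\<^sup>2 * ?a)) k"
    unfolding alt_even_def alt_odd_def sum.lessThan_Suc_shift F by (simp add: cheb_comb_def)
  moreover have "alt_odd (cheb_comb r x ?a ?b) (Suc k) =
      alt_even (cheb_comb r x (?b + 2 * r * x * ?a) (- r\<^sup>2 * ?a)) k"
    unfolding alt_even_def alt_odd_def sum.lessThan_Suc_shift F by simp
  moreover have "alt_apply (burau c V r) s t (Suc k) v = alt_apply (burau c V r) t s k w"
    by (simp add: w_def)
  moreover have "w s = v s - ?a" "\<And>u. u \<noteq> s \<Longrightarrow> w u = v u"
    by (auto simp: w_def burau_def)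
  ultimately show ?case
    using Suc.IH[of t s w] Suc.prems by (auto simp: ws wt fun_eq_iff)
qed

text \<open>The two sums are the losses of one coordinate under the two orders of the letters. Their
  difference has the factor \<open>chebyshev r x k\<close>, whose vanishing gives the braid relation
  and, conversely, is forced by it.\<close>

lemma alt_even_odd_diff:
  "alt_even (cheb_comb r x a b) k - alt_odd (cheb_comb r x b a) k =
     (if odd k then a else - b) * chebyshev r x k"
  by (induction k) (auto simp: alt_even_def alt_odd_def cheb_comb_def algebra_simps)

lemma alt_apply_burau_commute:
  assumes "finite V" "s \<in> V" "t \<in> V" "s \<noteq> t" "c s t = x" "c t s = x" "chebyshev r x k = 0"
  shows "alt_apply (burau c V r) s t k = alt_apply (burau c V r) t s k"
proof
  fix v
  have "alt_even (cheb_comb r x a b) k = alt_odd (cheb_comb r x b a) k" for a b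
    using alt_even_odd_diff[of r x a b k] assms(7) by simp
  then show "alt_apply (burau c V r) s t k v = alt_apply (burau c V r) t s k v"
    using alt_apply_burau[OF assms(1-6)] alt_apply_burau[OF assms(1,3,2) not_sym[OF assms(4)]
        assms(6,5)] assms(4)
    by (simp add: fun_upd_twist)
qed

text \<open>On the basis vector of a letter the functional of that letter is \<open>1 + r^2\<close>,
  never 0, so the Chebyshev factor has to vanish. The parity of \<open>k\<close> decides which of
  the two basis vectors is tested.\<close>

lemma alt_apply_burau_order:
  assumes "finite V" "s \<in> V" "t \<in> V" "s \<noteq> t" "c s t = x" "c t s = x"
    "alt_apply (burau c V r) s t k = alt_apply (burau c V r) t s k"
  shows "chebyshev r x k = 0"
proof -
  have 0: "(if odd k then burau_coord c V r s v else - burau_coord c V r t v) * chebyshev r x k = 0"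
      for v
  proof -
    have "alt_apply (burau c V r) s t k v s = alt_apply (burau c V r) t s k v s" using assms(7)
      by simp
    then show ?thesis
      using alt_apply_burau[OF assms(1-6)] alt_apply_burau[OF assms(1,3,2) not_sym[OF assms(4)]
          assms(6,5)] assms(4)
        alt_even_odd_diff[of r x "burau_coord c V r s v" "burau_coord c V r t v" k]
      by simp
  qed
  have "burau_coord c V r u (\<lambda>w. if w = u then 1 else 0) \<noteq> 0" for u
  proof -
    have "(\<Sum>w \<in> V - {u}. c u w * (if w = u then 1 else 0)) = 0" by (rule sum.neutral) auto
    then have "burau_coord c V r u (\<lambda>w. if w = u then 1 else 0) = 1 + r\<^sup>2"
      by (simp add: burau_coord_def)
    then show ?thesis using zero_le_power2[of r] by linarith
  qed
  then show ?thesis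
    using 0[of "\<lambda>w. if w = s then 1 else 0"] 0[of "\<lambda>w. if w = t then 1 else 0"]
    by (cases "odd k") auto
qed

section \<open>The Artin relations for the Burau operators\<close>

lemma alternating_snoc:
  "alternating s t (Suc k) = alternating s t k @ [(if even k then s else t, True)]"
  by (induction k arbitrary: s t) auto

text \<open>A product of permutations applies its last letter first, whereas
  \<open>alt_apply\<close> names the letter that acts first; which letter comes last depends on the
  parity of \<open>k\<close>.\<close>

lemma perm_apply_alternating:
  assumes "\<And>s. perm_apply (f s) = g s"
  shows "perm_apply (word_val f (alternating s t k)) v =
    (if odd k then alt_apply g s t k v else alt_apply g t s k v)"
proof (induction k arbitrary: v)
  case (Suc k)
  then show ?case by (simp add: alternating_snoc assms del: alternating.simps)
qed simp

lemma alternating_words [simp]: "s \<in> S \<Longrightarrow> t \<in> S \<Longrightarrow> alternating s t k \<in> words S"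
  by (induction k arbitrary: s t) auto

text \<open>A missing edge stands for \<open>m = \<infinity>\<close>, where
  \<open>cos (pi / m)\<close> is read as its limit 1.\<close>

definition cosine :: "'a labelled_graph \<Rightarrow> 'a \<Rightarrow> 'a \<Rightarrow> real" where
  "cosine \<Gamma> s t = (case label \<Gamma> {s, t} of None \<Rightarrow> 1 | Some m \<Rightarrow> cos (pi / m))"

lemma cosine_commute: "cosine \<Gamma> s t = cosine \<Gamma> t s"
  by (simp add: cosine_def insert_commute)

definition artin_burau :: "'a labelled_graph \<Rightarrow> real \<Rightarrow> 'a \<Rightarrow> ('a \<Rightarrow> real) perm" where
  "artin_burau \<Gamma> r = burau_perm (cosine \<Gamma>) (vertices \<Gamma>) r"

lemma perm_apply_artin_burau [simp]:
  "r \<noteq> 0 \<Longrightarrow> perm_apply (artin_burau \<Gamma> r s) = burau (cosine \<Gamma>) (vertices \<Gamma>) r s"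
  by (simp add: artin_burau_def)

lemma defining_graph_label:
  "defining_graph \<Gamma> \<Longrightarrow> label \<Gamma> {s, t} = Some m \<Longrightarrow>
     s \<in> vertices \<Gamma> \<and> t \<in> vertices \<Gamma> \<and> s \<noteq> t \<and> m \<ge> 2"
  using defining_graph_dom[of \<Gamma> "{s, t}" m] defining_graph_ge2[of \<Gamma> "{s, t}" m]
  by (auto simp: doubleton_eq_iff)

lemma sin_pi_div_pos: "m \<ge> 2 \<Longrightarrow> sin (pi / real m) > 0"
  by (rule sin_gt_zero) (auto simp: field_simps)

lemma artin_burau_relations:
  assumes "defining_graph \<Gamma>" "r \<noteq> 0"
  shows "satisfies_relations (vertices \<Gamma>) (artin_relations \<Gamma>) (artin_burau \<Gamma> r)"
  unfolding satisfies_relations_def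
proof (intro allI impI)
  fix u v assume "(u, v) \<in> artin_relations \<Gamma>"
  then obtain s t m where uv: "u = alternating s t m" "v = alternating t s m"
      "label \<Gamma> {s, t} = Some m"
    by (auto simp: artin_relations_def)
  note l = defining_graph_label[OF assms(1) uv(3)]
  have "r * sin (pi / m) * chebyshev r (cos (pi / m)) m = 0"
    using l by (simp add: chebyshev_cos)
  then have "chebyshev r (cosine \<Gamma> s t) m = 0"
    using assms(2) sin_pi_div_pos[of m] l by (simp add: cosine_def uv(3))
  then have "alt_apply (burau (cosine \<Gamma>) (vertices \<Gamma>) r) s t m =
      alt_apply (burau (cosine \<Gamma>) (vertices \<Gamma>) r) t s m"
    using l assms(1) by (intro alt_apply_burau_commute) (auto simp: defining_graph_def
        cosine_commute)
  then show "word_val (artin_burau \<Gamma> r) u = word_val (artin_burau \<Gamma> r) v"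
    unfolding uv
    by (intro perm_eqI) (simp add: perm_apply_alternating[OF perm_apply_artin_burau[OF assms(2)]])
qed

lemma burau_fixes_coordinate:
  assumes "g \<in> generated_by (artin_burau \<Gamma> r) K" "r \<noteq> 0" "t \<notin> K"
  shows "perm_apply g v t = v t"
  using assms(1)
proof (induction arbitrary: v rule: generated_by_induct)
  case (mult s b x)
  have "perm_apply (artin_burau \<Gamma> r s) v t = v t" for v
    using assms(2,3) mult(1) by (auto simp: burau_def)
  then have "perm_apply (letter_val (artin_burau \<Gamma> r) (s, b)) v t = v t" for v
    by (cases b) (auto, metis perm_apply_mult perm_apply_one right_ginv)
  then show ?case using mult.IH by simp
qed simp

lemma burau_moves_coordinate: "burau c V r t (\<lambda>u. if u = t then 1 else 0) t = - r\<^sup>2"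
proof -
  have "(\<Sum>u \<in> V - {t}. c t u * (if u = t then 1 else 0)) = 0" by (rule sum.neutral) auto
  then show ?thesis by (simp add: burau_def burau_coord_def)
qed

text \<open>Generators in \<open>K\<close> leave the coordinate of \<open>t\<close> alone, while
  \<open>t\<close> sends it from 1 to -1 on its basis vector. Parameter 1 makes the lemma serve
  Artin and Coxeter groups alike, as the operators are then involutions.\<close>

lemma burau_not_generated:
  assumes "presentation S R \<gamma>" "satisfies_relations S R (artin_burau \<Gamma> 1)" "K \<subseteq> S" "t \<in> S" "t \<notin> K"
  shows "\<gamma> t \<notin> generated_by \<gamma> K"
proof
  assume "\<gamma> t \<in> generated_by \<gamma> K"
  then obtain w where w: "w \<in> words K" "word_val \<gamma> [(t, True)] = word_val \<gamma> w"
    by (auto simp: generated_by_def)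
  then have "artin_burau \<Gamma> 1 t = word_val (artin_burau \<Gamma> 1) w"
    using presentation.word_val_transfer[OF assms(1,2) _ _ w(2)] words_mono[OF assms(3)] assms(4)
    by auto
  then have "artin_burau \<Gamma> 1 t \<in> generated_by (artin_burau \<Gamma> 1) K"
    using w(1) by (simp add: generated_by_def)
  from burau_fixes_coordinate[OF this, of t "\<lambda>u. if u = t then 1 else 0"] show False
    using assms(5) by (simp add: burau_moves_coordinate)
qed

section \<open>Coxeter groups\<close>

lemma conj_eq_iff:
  fixes g :: "'g :: mult_group"
  shows "g * x * ginv g = y \<longleftrightarrow> x = ginv g * y * g"
  by (auto simp: mult.assoc)

fun alt_prod :: "'g :: monoid_mult \<Rightarrow> 'g \<Rightarrow> nat \<Rightarrow> 'g" where
  "alt_prod x y 0 = 1"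
| "alt_prod x y (Suc k) = x * alt_prod y x k"

fun alt_list :: "'b \<Rightarrow> 'b \<Rightarrow> nat \<Rightarrow> 'b list" where
  "alt_list s t 0 = []"
| "alt_list s t (Suc k) = s # alt_list t s k"

lemma positive_word_alt_list [simp]: "positive_word (alt_list s t k) = alternating s t k"
  by (induction k arbitrary: s t) auto

lemma length_alt_list [simp]: "length (alt_list s t k) = k"
  by (induction k arbitrary: s t) auto

lemma set_alt_list: "set (alt_list s t k) \<subseteq> {s, t}"
  by (induction k arbitrary: s t) auto

lemma prod_list_alt_list [simp]: "prod_list (map f (alt_list s t k)) = alt_prod (f s) (f t) k"
  by (induction k arbitrary: s t) auto

lemma word_val_alternating [simp]: "word_val f (alternating s t k) = alt_prod (f s) (f t) k"
  by (induction k arbitrary: s t) auto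

lemma rev_alt_list: "rev (alt_list s t k) = (if even k then alt_list t s k else alt_list s t k)"
proof (induction k arbitrary: s t)
  case (Suc k)
  have snoc: "alt_list s t (Suc k) = alt_list s t k @ [if even k then s else t]" for s t :: 'b
    by (induction k arbitrary: s t) auto
  have "rev (alt_list s t (Suc k)) = rev (alt_list t s k) @ [s]" by simp
  then show ?case unfolding Suc snoc by simp
qed simp

lemma alt_prod_add: "alt_prod x y (i + j) =
    alt_prod x y i * (if even i then alt_prod x y j else alt_prod y x j)"
  by (induction i arbitrary: x y) (auto simp: mult.assoc)

lemma ginv_alt_prod:
  fixes x y :: "'g :: mult_group"
  assumes "ginv x = x" "ginv y = y"
  shows "ginv (alt_prod x y k) = (if even k then alt_prod y x k else alt_prod x y k)"
  using assms
proof (induction k arbitrary: x y)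
  case (Suc k)
  have "alt_prod a b (Suc k) = alt_prod a b k * (if even k then a else b)" for a b :: 'g
    using alt_prod_add[of a b k 1] by simp
  then show ?case using Suc by auto
qed simp

lemma alt_prod_double_eq_1_iff:
  fixes x y :: "'g :: mult_group"
  assumes "ginv x = x" "ginv y = y"
  shows "alt_prod x y (2 * k) = 1 \<longleftrightarrow> alt_prod x y k = alt_prod y x k"
proof -
  have "alt_prod x y (2 * k) = alt_prod x y k * ginv (alt_prod y x k)"
    using alt_prod_add[of x y k k] assms by (simp add: ginv_alt_prod mult_2)
  then show ?thesis
    by (metis ginv_ginv ginv_unique right_ginv)
qed

definition coxeter_relations :: "'a labelled_graph \<Rightarrow> ('a word \<times> 'a word) set" where
  "coxeter_relations \<Gamma> =
     artin_relations \<Gamma> \<union> {([(s, True), (s, True)], []) | s. s \<in> vertices \<Gamma>}"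

locale coxeter = presentation "vertices \<Gamma>" "coxeter_relations \<Gamma>" \<sigma>
  for \<Gamma> :: "'a labelled_graph" and \<sigma> :: "'a \<Rightarrow> 'w :: mult_group" +
  assumes graph: "defining_graph \<Gamma>"
begin

abbreviation V :: "'a set" where "V \<equiv> vertices \<Gamma>"
abbreviation W :: "'w set" where "W \<equiv> generated_by \<sigma> V"
abbreviation val :: "'a list \<Rightarrow> 'w" where "val u \<equiv> prod_list (map \<sigma> u)"

lemma satisfies_relationsI:
  assumes "\<And>s. s \<in> V \<Longrightarrow> f s * f s = 1"
    and "\<And>s t m. label \<Gamma> {s, t} = Some m \<Longrightarrow> alt_prod (f s) (f t) m = alt_prod (f t) (f s) m"
  shows "satisfies_relations V (coxeter_relations \<Gamma>) f"
  unfolding satisfies_relations_def coxeter_relations_def artin_relations_def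
  using assms by auto

lemma generator_square [simp]: "s \<in> V \<Longrightarrow> \<sigma> s * \<sigma> s = 1"
  using satisfies[unfolded satisfies_relations_def, rule_format, of "[(s, True), (s, True)]" "[]"]
  by (simp add: coxeter_relations_def)

lemma ginv_generator [simp]: "s \<in> V \<Longrightarrow> ginv (\<sigma> s) = \<sigma> s"
  by (rule ginv_unique) simp

lemma generator_cancel [simp]: "s \<in> V \<Longrightarrow> \<sigma> s * (\<sigma> s * x) = x"
  by (simp add: mult.assoc[symmetric])

lemma braid_relation: "label \<Gamma> {s, t} = Some m \<Longrightarrow> alt_prod (\<sigma> s) (\<sigma> t) m = alt_prod (\<sigma> t) (\<sigma> s) m"
  using satisfies[unfolded satisfies_relations_def, rule_format, of "alternating s t m"
      "alternating t s m"]
    defining_graph_label[OF graph, of s t m]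
  by (auto simp: coxeter_relations_def artin_relations_def)

lemma generated_by_iff_list:
  assumes "K \<subseteq> V"
  shows "w \<in> generated_by \<sigma> K \<longleftrightarrow> (\<exists>u. set u \<subseteq> K \<and> val u = w)"
proof
  assume "w \<in> generated_by \<sigma> K"
  then show "\<exists>u. set u \<subseteq> K \<and> val u = w"
  proof (induction rule: generated_by_induct)
    case (mult s b x)
    then obtain u where u: "set u \<subseteq> K" "val u = x" by blast
    have "letter_val \<sigma> (s, b) = \<sigma> s" using mult(1) assms by (cases b) auto
    then show ?case using mult(1) u by (intro exI[of _ "s # u"]) auto
  qed (auto intro: exI[of _ "[]"])
next
  assume "\<exists>u. set u \<subseteq> K \<and> val u = w"
  then obtain u where "set u \<subseteq> K" "val u = w" by blast
  then show "w \<in> generated_by \<sigma> K"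
    unfolding generated_by_def
      by (intro image_eqI[of _ _ "positive_word u"]) (auto simp: word_val_positive_word)
qed

lemma val_W: "set u \<subseteq> V \<Longrightarrow> val u \<in> W"
  using generated_by_iff_list by blast

lemma W_list: "w \<in> W \<Longrightarrow> \<exists>u. set u \<subseteq> V \<and> val u = w"
  using generated_by_iff_list by blast

lemma ginv_val: "set u \<subseteq> V \<Longrightarrow> ginv (val u) = val (rev u)"
  by (induction u) auto

lemma burau_satisfies: "satisfies_relations V (coxeter_relations \<Gamma>) (artin_burau \<Gamma> 1)"
proof (rule satisfies_relationsI)
  fix s assume "s \<in> V"
  have "burau c A 1 s (burau c A 1 s v) = v" for c A v
  proof -
    have "burau_coord c A 1 s (burau c A 1 s v) = - burau_coord c A 1 s v"
      unfolding burau_def burau_coord_same by simp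
    then show ?thesis by (simp add: burau_def)
  qed
  then show "artin_burau \<Gamma> 1 s * artin_burau \<Gamma> 1 s = 1" by (intro perm_eqI) simp
next
  fix s t m assume l: "label \<Gamma> {s, t} = Some m"
  then have "(alternating s t m, alternating t s m) \<in> artin_relations \<Gamma>"
    by (auto simp: artin_relations_def)
  then have "word_val (artin_burau \<Gamma> 1) (alternating s t m) =
      word_val (artin_burau \<Gamma> 1) (alternating t s m)"
    using artin_burau_relations[OF graph, of 1] defining_graph_label[OF graph l]
    by (simp add: satisfies_relations_def del: word_val_alternating)
  then show "alt_prod (artin_burau \<Gamma> 1 s) (artin_burau \<Gamma> 1 t) m =
      alt_prod (artin_burau \<Gamma> 1 t) (artin_burau \<Gamma> 1 s) m"
    by simp
qed

text \<open>In the geometric representation a braid equality of length \<open>k\<close> makes a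
  Chebyshev value vanish. For a label \<open>m\<close> this means
  \<open>sin (k * (pi / m)) = 0\<close>, so \<open>m\<close> divides \<open>k\<close>; for a missing
  edge the value is \<open>k\<close> itself, which is positive.\<close>

lemma order_dvd:
  assumes st: "s \<in> V" "t \<in> V" "s \<noteq> t"
      and k: "k > 0" "alt_prod (\<sigma> s) (\<sigma> t) k = alt_prod (\<sigma> t) (\<sigma> s) k"
  obtains m where "label \<Gamma> {s, t} = Some m" "m dvd k"
proof -
  let ?b = "burau (cosine \<Gamma>) V 1"
  have "word_val \<sigma> (alternating s t k) = word_val \<sigma> (alternating t s k)" using k by simp
  then have "word_val (artin_burau \<Gamma> 1) (alternating s t k) =
      word_val (artin_burau \<Gamma> 1) (alternating t s k)"
    by (rule word_val_transfer[OF burau_satisfies, rotated 2]) (use st in auto)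
  then have "alt_apply ?b s t k v = alt_apply ?b t s k v" for v
    using perm_apply_alternating[where f = "artin_burau \<Gamma> 1" and g = ?b and v = v and k = k]
    by (metis perm_apply_artin_burau zero_neq_one)
  then have "alt_apply ?b s t k = alt_apply ?b t s k" by blast
  then have 0: "chebyshev 1 (cosine \<Gamma> s t) k = 0"
    using st graph cosine_commute[of \<Gamma> t s]
    by (intro alt_apply_burau_order[of V s t "cosine \<Gamma>"
        "cosine \<Gamma> s t"]) (auto simp: defining_graph_def)
  show ?thesis
  proof (cases "label \<Gamma> {s, t}")
    case None
    then show ?thesis using 0 k by (simp add: cosine_def chebyshev_one)
  next
    case (Some m)
    then have m: "m \<ge> 2" using defining_graph_label[OF graph] by blast
    have "sin (k * (pi / m)) = 0"
      using 0 chebyshev_cos[of 1 "pi / m" k] Some by (simp add: cosine_def)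
    then obtain i :: int where "k * (pi / m) = i * pi" by (auto simp: sin_zero_iff_int2)
    then have "real k = real_of_int i * real m" using m by (simp add: field_simps)
    then have "int k = i * int m" by (metis of_int_eq_iff of_int_mult of_int_of_nat_eq)
    then have "m dvd k" by (metis dvd_triv_right int_dvd_int_iff)
    then show ?thesis using that Some by blast
  qed
qed

lemma generator_inj: "s \<in> V \<Longrightarrow> t \<in> V \<Longrightarrow> \<sigma> s = \<sigma> t \<Longrightarrow> s = t"
proof (rule ccontr)
  assume st: "s \<in> V" "t \<in> V" "\<sigma> s = \<sigma> t" "s \<noteq> t"
  have "alt_prod (\<sigma> s) (\<sigma> t) 1 = alt_prod (\<sigma> t) (\<sigma> s) 1" by (simp only: st(3))
  from order_dvd[OF st(1,2,4) zero_less_one this] obtain m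
      where "label \<Gamma> {s, t} = Some m" "m dvd 1" .
  then show False using defining_graph_label[OF graph] by force
qed

lemma generator_in_parabolic:
  assumes "K \<subseteq> V" "t \<in> V" "\<sigma> t \<in> generated_by \<sigma> K"
  shows "t \<in> K"
  using burau_not_generated[OF presentation_axioms burau_satisfies] assms by blast

section \<open>Reflections of a word and inversion sets\<close>

fun refl_list :: "'a list \<Rightarrow> 'w list" where
  "refl_list [] = []"
| "refl_list (s # u) = \<sigma> s # map (\<lambda>t. \<sigma> s * t * ginv (\<sigma> s)) (refl_list u)"

lemma refl_list_append:
  "refl_list (u @ v) = refl_list u @ map (\<lambda>t. val u * t * ginv (val u)) (refl_list v)"
  by (induction u) (auto simp: mult.assoc)

lemma length_refl_list [simp]: "length (refl_list u) = length u"
  by (induction u) auto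

lemma refl_list_alt_list:
  "s \<in> V \<Longrightarrow> t \<in> V \<Longrightarrow>
     refl_list (alt_list s t k) = map (\<lambda>j. alt_prod (\<sigma> s) (\<sigma> t) (Suc (2 * j))) [0..<k]"
proof (induction k arbitrary: s t)
  case (Suc k)
  have "\<sigma> s * alt_prod (\<sigma> t) (\<sigma> s) (Suc (2 * j)) * ginv (\<sigma> s) =
      alt_prod (\<sigma> s) (\<sigma> t) (Suc (2 * Suc j))" for j
    using alt_prod_add[of "\<sigma> s" "\<sigma> t" "Suc (Suc (2 * j))" 1] Suc.prems by simp
  then have "map ((\<lambda>t. \<sigma> s * t * ginv (\<sigma> s)) \<circ> (\<lambda>j. alt_prod (\<sigma> t) (\<sigma> s) (Suc (2 * j)))) [0..<k] =
      map (\<lambda>j. alt_prod (\<sigma> s) (\<sigma> t) (Suc (2 * j))) [Suc 0..<Suc k]"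
    unfolding map_Suc_upt[symmetric] by (simp only: map_map comp_def)
  moreover have "[0..<Suc k] = 0 # [Suc 0..<Suc k]" by (simp add: upt_conv_Cons)
  ultimately show ?case
    using Suc by (simp only: alt_list.simps refl_list.simps map_map list.map) simp
qed simp

text \<open>Bourbaki's signed permutations of the reflections: they show that the parity of the number
  of occurrences of \<open>t\<close> in \<open>refl_list u\<close> depends only on \<open>t\<close> and on the value of \<open>u\<close>.\<close>

definition signed :: "'a \<Rightarrow> ('w \<times> bool) perm" where
  "signed s = Perm (\<lambda>(t, b). (\<sigma> s * t * ginv (\<sigma> s), b \<noteq> (t = \<sigma> s)))"

lemma perm_apply_signed:
  assumes "s \<in> V"
  shows "perm_apply (signed s) (t, b) = (\<sigma> s * t * ginv (\<sigma> s), b \<noteq> (t = \<sigma> s))"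
proof -
  have "\<sigma> s * (t * \<sigma> s) = \<sigma> s \<longleftrightarrow> t = \<sigma> s" for t
    using conj_eq_iff[of "\<sigma> s" t "\<sigma> s"] assms by (simp add: mult.assoc)
  then have "bij (\<lambda>(t, b). (\<sigma> s * t * ginv (\<sigma> s), b \<noteq> (t = \<sigma> s)))"
    using assms by (intro o_bij[where g = "\<lambda>(t, b). (\<sigma> s * t * ginv (\<sigma> s), b \<noteq> (t = \<sigma> s))"])
      (auto simp: fun_eq_iff mult.assoc)
  then show ?thesis by (simp add: signed_def)
qed

text \<open>The last letter of \<open>u\<close> acts first, so the sign changes come from the
  reflections of the reversed word.\<close>

lemma perm_apply_signed_prod:
  "set u \<subseteq> V \<Longrightarrow> perm_apply (prod_list (map signed u)) (t, b) =
     (val u * t * ginv (val u), b \<noteq> odd (count_list (refl_list (rev u)) t))"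
proof (induction u)
  case (Cons s u)
  then have IH: "perm_apply (prod_list (map signed u)) (t, b) =
      (val u * t * ginv (val u), b \<noteq> odd (count_list (refl_list (rev u)) t))" and s: "s \<in> V" by auto
  have "ginv (val u) * (\<sigma> s * val u) = t \<longleftrightarrow> \<sigma> s = val u * t * ginv (val u)"
    using conj_eq_iff[of "val u" t "\<sigma> s"] by (auto simp: mult.assoc)
  then show ?case
    using IH s Cons.prems
    by (auto simp: perm_apply_signed refl_list_append ginv_val[symmetric] mult.assoc)
qed simp

lemma signed_square:
  assumes "s \<in> V"
  shows "signed s * signed s = 1"
proof (rule perm_eqI)
  fix x :: "'w \<times> bool"
  have "perm_apply (prod_list (map signed [s, s])) x = x"
    using assms perm_apply_signed_prod[of "[s, s]" "fst x" "snd x"]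
      by (cases x) (simp add: mult.assoc)
  then show "perm_apply (signed s * signed s) x = perm_apply 1 x" by simp
qed

text \<open>The alternating word of length \<open>2 * m\<close> has value 1, so its list of
  reflections consists of two equal halves. Every reflection occurs an even number of times and no
  sign changes.\<close>

lemma signed_satisfies: "satisfies_relations V (coxeter_relations \<Gamma>) signed"
proof (rule satisfies_relationsI[OF signed_square])
  fix s t m assume l: "label \<Gamma> {s, t} = Some m"
  then have st: "s \<in> V" "t \<in> V" using defining_graph_label[OF graph] by auto
  have one: "alt_prod (\<sigma> s) (\<sigma> t) (2 * m) = 1" if "label \<Gamma> {s, t} = Some m" "s \<in> V" "t \<in> V" for s t
    using braid_relation that by (simp add: alt_prod_double_eq_1_iff)
  have "alt_prod (signed s) (signed t) (2 * m) = 1"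
  proof (rule perm_eqI)
    fix x :: "'w \<times> bool"
    have "map (\<lambda>j. alt_prod (\<sigma> t) (\<sigma> s) (Suc (2 * j))) [m..<m + m] =
        map (\<lambda>j. alt_prod (\<sigma> t) (\<sigma> s) (Suc (2 * j))) [0..<m]"
    proof -
      have "alt_prod (\<sigma> t) (\<sigma> s) (Suc (2 * (j + m))) = alt_prod (\<sigma> t) (\<sigma> s) (Suc (2 * j))" for j
        using alt_prod_add[of "\<sigma> t" "\<sigma> s" "2 * m" "Suc (2 * j)"] one[of t s] l st
        by (simp add: insert_commute algebra_simps)
      then show ?thesis
        by (simp add: map_add_upt[symmetric] comp_def add.commute del: alt_prod.simps)
    qed
    moreover have "[0..<2 * m] = [0..<m] @ [m..<m + m]" using upt_add_eq_append[of 0 m m]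
      by (simp only: mult_2)
    ultimately have "refl_list (alt_list t s (2 * m)) =
        refl_list (alt_list t s m) @ refl_list (alt_list t s m)"
      by (simp only: refl_list_alt_list[OF st(2,1)] map_append)
    then have "even (count_list (refl_list (rev (alt_list s t (2 * m)))) y)" for y
      by (simp add: rev_alt_list)
    moreover have "set (alt_list s t (2 * m)) \<subseteq> V" using set_alt_list[of s t "2 * m"] st by auto
    ultimately show "perm_apply (alt_prod (signed s) (signed t) (2 * m)) x = perm_apply 1 x"
      using perm_apply_signed_prod[of "alt_list s t (2 * m)" "fst x" "snd x"] one[OF l st]
      by (cases x) simp
  qed
  then show "alt_prod (signed s) (signed t) m = alt_prod (signed t) (signed s) m"
    using ginv_unique[OF signed_square] st by (simp add: alt_prod_double_eq_1_iff)
qed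

definition inversions :: "'w \<Rightarrow> 'w set" where
  "inversions w = {t. \<exists>u. set u \<subseteq> V \<and> val u = w \<and> odd (count_list (refl_list u) t)}"

lemma inversions_val:
  assumes "set u \<subseteq> V"
  shows "inversions (val u) = {t. odd (count_list (refl_list u) t)}"
proof -
  have "odd (count_list (refl_list v) t) \<longleftrightarrow> odd (count_list (refl_list u) t)"
    if v: "set v \<subseteq> V" "val v = val u" for v t
  proof -
    have "val (rev v) = val (rev u)" using v assms by (simp flip: ginv_val)
    then have "word_val \<sigma> (positive_word (rev v)) = word_val \<sigma> (positive_word (rev u))"
      by (simp add: word_val_positive_word)
    then have "word_val signed (positive_word (rev v)) = word_val signed (positive_word (rev u))"
      by (rule word_val_transfer[OF signed_satisfies, rotated 2]) (use assms v in auto)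
    then have "perm_apply (prod_list (map signed (rev v))) (t, False) =
        perm_apply (prod_list (map signed (rev u))) (t, False)"
      by (simp add: word_val_positive_word)
    then show ?thesis
      using perm_apply_signed_prod[of "rev v" t False] perm_apply_signed_prod[of
          "rev u" t False] v assms by simp
  qed
  then show ?thesis unfolding inversions_def using assms by blast
qed

lemma inversions_subset:
  assumes "set u \<subseteq> V"
  shows "inversions (val u) \<subseteq> set (refl_list u)"
proof
  fix t assume "t \<in> inversions (val u)"
  then have "odd (count_list (refl_list u) t)" by (simp add: inversions_val[OF assms])
  then have "count_list (refl_list u) t \<noteq> 0" by (metis even_zero)
  then show "t \<in> set (refl_list u)" by (simp add: count_list_0_iff)
qed

lemma finite_inversions: "w \<in> W \<Longrightarrow> finite (inversions w)"
  using W_list inversions_subset by (metis List.finite_set finite_subset)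

lemma count_list_conj:
  fixes g :: "'g :: mult_group"
  shows "count_list (map (\<lambda>x. g * x * ginv g) xs) t = count_list xs (ginv g * t * g)"
proof (induction xs)
  case (Cons x xs)
  have "g * x * ginv g = t \<longleftrightarrow> x = ginv g * t * g"
    by (rule conj_eq_iff)
  then show ?case using Cons by auto
qed simp

text \<open>The cocycle rule for inversion sets: parity turns the concatenation in
  \<open>refl_list_append\<close> into a symmetric difference.\<close>

lemma inversions_mult:
  assumes "w \<in> W" "w' \<in> W"
  shows "t \<in> inversions (w * w') \<longleftrightarrow> (t \<in> inversions w) \<noteq> (ginv w * t * w \<in> inversions w')"
proof -
  obtain u v where uv: "set u \<subseteq> V" "val u = w" "set v \<subseteq> V" "val v = w'" using W_list assms by blast
  have "inversions (w * w') = {t. odd (count_list (refl_list (u @ v)) t)}"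
    using inversions_val[of "u @ v"] uv by simp
  then show ?thesis
    using inversions_val[of u] inversions_val[of v] uv
      by (auto simp: refl_list_append count_list_conj)
qed

lemma inversions_one [simp]: "inversions 1 = {}"
  using inversions_val[of "[]"] by simp

lemma inversions_generator [simp]: "s \<in> V \<Longrightarrow> inversions (\<sigma> s) = {\<sigma> s}"
  using inversions_val[of "[s]"] by auto

text \<open>For a word s_1 ... s_n the i-th entry of \<open>refl_list\<close> is p s_i p^-1 with p =
  s_1 ... s_(i-1); multiplying the word by it from the left deletes s_i.\<close>

lemma delete_reflection:
  "set u \<subseteq> V \<Longrightarrow> t \<in> set (refl_list u) \<Longrightarrow>
     \<exists>v. set v \<subseteq> set u \<and> Suc (length v) = length u \<and> val v = t * val u"
proof (induction u arbitrary: t)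
  case (Cons s u)
  show ?case
  proof (cases "t = \<sigma> s")
    case True
    then show ?thesis using Cons.prems by (intro exI[of _ u]) auto
  next
    case False
    then obtain t' where t': "t' \<in> set (refl_list u)" "t = \<sigma> s * t' * ginv (\<sigma> s)"
      using Cons.prems by auto
    moreover have "set u \<subseteq> V" using Cons.prems by simp
    ultimately obtain v where v: "set v \<subseteq> set u" "Suc (length v) = length u" "val v = t' * val u"
      using Cons.IH by blast
    then show ?thesis using t'(2) Cons.prems by (intro exI[of _ "s # v"]) (auto simp: mult.assoc)
  qed
qed simp

text \<open>A reflection that occurs twice allows two letters to be deleted, since the two
  multiplications by it cancel. In the decisive case one of the two letters is the first
  one.\<close>

lemma shorten_if_not_distinct:
  "set u \<subseteq> V \<Longrightarrow> \<not> distinct (refl_list u) \<Longrightarrow> \<exists>v. set v \<subseteq> V \<and> length v < length u \<and> val v = val u"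
proof (induction u)
  case (Cons s u)
  have s: "s \<in> V" "set u \<subseteq> V" using Cons.prems by auto
  have inj: "inj (\<lambda>t. \<sigma> s * t * ginv (\<sigma> s))" by (rule injI) simp
  consider "\<not> distinct (refl_list u)" | "\<sigma> s \<in> (\<lambda>t. \<sigma> s * t * ginv (\<sigma> s)) ` set (refl_list u)"
    using Cons.prems inj_on_subset[OF inj] by (auto simp: distinct_map)
  then show ?case
  proof cases
    case 1
    then obtain v where "set v \<subseteq> V" "length v < length u" "val v = val u" using Cons s by blast
    then show ?thesis using s by (intro exI[of _ "s # v"]) auto
  next
    case 2
    then obtain t where t: "t \<in> set (refl_list u)" "\<sigma> s = \<sigma> s * t * ginv (\<sigma> s)" by auto
    then have "t = \<sigma> s"
      using conj_eq_iff[of "\<sigma> s" t "\<sigma> s"] s(1) by simp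
    then obtain v where "set v \<subseteq> set u" "Suc (length v) = length u" "val v = \<sigma> s * val u"
      using delete_reflection[OF s(2) t(1)] by blast
    then show ?thesis using s by (intro exI[of _ v]) auto
  qed
qed simp

text \<open>Counting inversions needs no choice of a word; \<open>reduced_word_len\<close> and
  \<open>len_le_length\<close> identify the count with the least length of a word.\<close>

definition len :: "'w \<Rightarrow> nat" where
  "len w = card (inversions w)"

definition reduced_word :: "'a list \<Rightarrow> bool" where
  "reduced_word u \<longleftrightarrow> set u \<subseteq> V \<and> distinct (refl_list u)"

lemma reduced_word_len: "reduced_word u \<Longrightarrow> len (val u) = length u"
proof -
  assume u: "reduced_word u"
  have "distinct xs \<Longrightarrow> count_list xs t = (if t \<in> set xs then 1 else 0)" for xs :: "'w list" and t
    by (induction xs) auto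
  then have "inversions (val u) = set (refl_list u)"
    using u inversions_val[of u] by (auto simp: reduced_word_def)
  then show ?thesis using u by (simp add: len_def reduced_word_def distinct_card)
qed

lemma reduced_word_exists:
  assumes "w \<in> W"
  obtains u where "reduced_word u" "val u = w"
proof -
  define u where "u = arg_min length (\<lambda>u. set u \<subseteq> V \<and> val u = w)"
  obtain u0 where "set u0 \<subseteq> V \<and> val u0 = w" using W_list[OF assms] by blast
  from arg_min_nat_lemma[of "\<lambda>u. set u \<subseteq> V \<and> val u = w", OF this, of length]
  have u: "set u \<subseteq> V" "val u = w" "\<And>v. set v \<subseteq> V \<Longrightarrow> val v = w \<Longrightarrow> length u \<le> length v"
    by (auto simp: u_def)
  have "distinct (refl_list u)"
    using shorten_if_not_distinct[OF u(1)] u by (metis leD)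
  then show ?thesis using that u by (auto simp: reduced_word_def)
qed

lemma len_le_length:
  assumes "set u \<subseteq> V"
  shows "len (val u) \<le> length u"
proof -
  have "len (val u) \<le> card (set (refl_list u))" 
    unfolding len_def by (rule card_mono[OF _ inversions_subset[OF assms]]) simp
  also have "\<dots> \<le> length (refl_list u)" by (rule card_length)
  finally show ?thesis by simp
qed

lemma reduced_word_iff: "reduced_word u \<longleftrightarrow> set u \<subseteq> V \<and> length u = len (val u)"
proof
  assume u: "set u \<subseteq> V \<and> length u = len (val u)"
  have "distinct (refl_list u)"
    using shorten_if_not_distinct[of u] len_le_length u by (metis leD)
  then show "reduced_word u" using u by (simp add: reduced_word_def)
qed (auto simp: reduced_word_len, auto simp: reduced_word_def)

lemma len_reflection_less:
  assumes "w \<in> W" "t \<in> inversions w"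
  shows "len (t * w) < len w"
proof -
  obtain u where u: "reduced_word u" "val u = w" using reduced_word_exists[OF assms(1)] .
  have "t \<in> set (refl_list u)"
    using assms(2) u inversions_subset[of u] by (auto simp: reduced_word_def)
  then obtain v where "set v \<subseteq> V" "Suc (length v) = length u" "val v = t * val u"
    using delete_reflection[of u t] u(1)[unfolded reduced_word_def] by blast
  then show ?thesis
    using len_le_length[of v] reduced_word_len[OF u(1)] u(2) by simp
qed

lemma len_one [simp]: "len 1 = 0"
  by (simp add: len_def)

lemma len_0_iff: "w \<in> W \<Longrightarrow> len w = 0 \<longleftrightarrow> w = 1"
proof
  assume "w \<in> W" "len w = 0"
  then obtain u where "reduced_word u" "val u = w" "length u = 0"
    using reduced_word_exists reduced_word_len by metis
  then show "w = 1" by simp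
qed simp

lemma len_mult_le:
  assumes "x \<in> W" "y \<in> W"
  shows "len (x * y) \<le> len x + len y"
proof -
  obtain u v where uv: "reduced_word u" "val u = x" "reduced_word v" "val v = y"
    using reduced_word_exists assms by metis
  then show ?thesis
    using len_le_length[of "u @ v"] reduced_word_len by (fastforce simp: reduced_word_def)
qed

lemma len_ginv: "w \<in> W \<Longrightarrow> len (ginv w) = len w"
proof -
  have "len (ginv w) \<le> len w" if "w \<in> W" for w
  proof -
    obtain u where "reduced_word u" "val u = w" using reduced_word_exists[OF \<open>w \<in> W\<close>] .
    then show ?thesis
      using len_le_length[of "rev u"] reduced_word_len[of u]
        by (auto simp: reduced_word_def ginv_val)
  qed
  then show "w \<in> W \<Longrightarrow> len (ginv w) = len w"
    by (metis antisym generated_by_ginv ginv_ginv)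
qed

lemma len_generator_mult:
  assumes "s \<in> V" "w \<in> W"
  shows "\<sigma> s \<notin> inversions w \<Longrightarrow> len (\<sigma> s * w) = Suc (len w)"
    and "\<sigma> s \<in> inversions w \<Longrightarrow> Suc (len (\<sigma> s * w)) = len w"
proof -
  have up: "len (\<sigma> s * w) = Suc (len w)" if w: "w \<in> W" "\<sigma> s \<notin> inversions w" for w
  proof -
    have "inversions (\<sigma> s * w) = insert (\<sigma> s) ((\<lambda>t. \<sigma> s * t * \<sigma> s) ` inversions w)"
    proof (rule Set.set_eqI)
      fix t
      have t: "t \<in> (\<lambda>t. \<sigma> s * t * \<sigma> s) ` inversions w \<longleftrightarrow> \<sigma> s * t * \<sigma> s \<in> inversions w"
      proof
        assume "\<sigma> s * t * \<sigma> s \<in> inversions w"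
        then show "t \<in> (\<lambda>t. \<sigma> s * t * \<sigma> s) ` inversions w"
          using assms by (intro image_eqI[of _ _ "\<sigma> s * t * \<sigma> s"]) (auto simp: mult.assoc)
      qed (use assms in \<open>auto simp: mult.assoc\<close>)
      have "\<sigma> s * \<sigma> s * \<sigma> s = \<sigma> s" using assms by simp
      then show "t \<in> inversions (\<sigma> s * w) \<longleftrightarrow> t \<in> insert (\<sigma> s) ((\<lambda>t. \<sigma> s * t * \<sigma> s) ` inversions w)"
        using inversions_mult[OF _ w(1), of "\<sigma> s" t] assms w(2) t by auto
    qed
    moreover have "\<sigma> s \<notin> (\<lambda>t. \<sigma> s * t * \<sigma> s) ` inversions w"
    proof
      assume "\<sigma> s \<in> (\<lambda>t. \<sigma> s * t * \<sigma> s) ` inversions w"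
      then obtain t where "t \<in> inversions w" "\<sigma> s = \<sigma> s * t * \<sigma> s" by auto
      then show False
        using w(2) assms conj_eq_iff[of "\<sigma> s" t "\<sigma> s"] by simp
    qed
    moreover have "inj (\<lambda>t. \<sigma> s * t * \<sigma> s)" by (rule injI) simp
    ultimately show ?thesis
      using finite_inversions[OF w(1)] by (simp add: len_def card_image inj_on_subset)
  qed
  then show "\<sigma> s \<notin> inversions w \<Longrightarrow> len (\<sigma> s * w) = Suc (len w)" using assms by blast
  assume "\<sigma> s \<in> inversions w"
  then have "\<sigma> s \<notin> inversions (\<sigma> s * w)"
    using inversions_mult[of "\<sigma> s" w "\<sigma> s"] assms by auto
  then show "Suc (len (\<sigma> s * w)) = len w" using up[of "\<sigma> s * w"] assms by simp
qed

end

subsection \<open>Dihedral subgroups\<close>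

context coxeter
begin

definition within_order :: "'a \<Rightarrow> 'a \<Rightarrow> nat \<Rightarrow> bool" where
  "within_order s t k \<longleftrightarrow> (\<forall>m. label \<Gamma> {s, t} = Some m \<longrightarrow> k \<le> m)"

lemma within_order_commute: "within_order s t k \<longleftrightarrow> within_order t s k"
  by (simp add: within_order_def insert_commute)

abbreviation alt_elt :: "'a \<Rightarrow> 'a \<Rightarrow> nat \<Rightarrow> 'w" where
  "alt_elt s t k \<equiv> alt_prod (\<sigma> s) (\<sigma> t) k"

lemma alt_elt_generated: "alt_elt s t k \<in> generated_by \<sigma> {s, t}"
proof (induction k arbitrary: s t)
  case (Suc k)
  have "{t, s} = {s, t}" by auto
  then show ?case using Suc[of t s] by simp
qed simp

lemma alt_elt_generated': "alt_elt t s k \<in> generated_by \<sigma> {s, t}"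
  using alt_elt_generated[of t s k] by (simp add: insert_commute)

lemma dihedral_subset_W: "s \<in> V \<Longrightarrow> t \<in> V \<Longrightarrow> x \<in> generated_by \<sigma> {s, t} \<Longrightarrow> x \<in> W"
  using generated_by_mono[of "{s, t}" V \<sigma>] by blast

lemma alt_elt_W [simp]: "s \<in> V \<Longrightarrow> t \<in> V \<Longrightarrow> alt_elt s t k \<in> W"
  using dihedral_subset_W alt_elt_generated by blast

lemma alt_elt_order:
  assumes "label \<Gamma> {s, t} = Some m"
  shows "alt_elt s t (Suc m) = alt_elt t s (m - 1)"
proof -
  have st: "s \<in> V" "t \<in> V" "m \<ge> 2" using defining_graph_label[OF graph assms] by auto
  obtain k where k: "m = Suc k" using st(3) by (cases m) auto
  have "alt_elt s t (Suc m) = \<sigma> s * alt_elt t s m" by simp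
  also have "alt_elt t s m = alt_elt s t m" using braid_relation[OF assms] by simp
  finally show ?thesis using st unfolding k by simp
qed

lemma distinct_refl_list_alt_list:
  assumes st: "s \<in> V" "t \<in> V" "s \<noteq> t" and k: "within_order s t k"
  shows "distinct (refl_list (alt_list s t k))"
proof -
  have "alt_elt s t (Suc (2 * i)) \<noteq> alt_elt s t (Suc (2 * j))" if ij: "i < j" "j < k" for i j
  proof
    assume eq: "alt_elt s t (Suc (2 * i)) = alt_elt s t (Suc (2 * j))"
    have "alt_elt s t (Suc (2 * j)) = alt_elt s t (Suc (2 * i)) * alt_elt t s (2 * (j - i))"
      using alt_prod_add[of "\<sigma> s" "\<sigma> t" "Suc (2 * i)" "2 * (j - i)"] ij
      by (simp add: algebra_simps del: alt_prod.simps)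
    then have "alt_elt t s (2 * (j - i)) = 1"
      using eq by (metis gmult_left_cancel mult.right_neutral)
    then have "alt_elt t s (j - i) = alt_elt s t (j - i)"
      using st by (simp add: alt_prod_double_eq_1_iff)
    then obtain m where "label \<Gamma> {t, s} = Some m" "m dvd j - i"
      using order_dvd[OF st(2,1) not_sym[OF st(3)]] ij by (metis zero_less_diff)
    then show False
      using k ij dvd_imp_le[of m "j - i"] by (auto simp: within_order_def insert_commute)
  qed
  then have "inj_on (\<lambda>j. alt_elt s t (Suc (2 * j))) {0..<k}"
    unfolding inj_on_def by (metis atLeastLessThan_iff linorder_neqE_nat)
  then show ?thesis using st by (simp add: refl_list_alt_list distinct_map del: alt_prod.simps)
qed

lemma inversions_alt_elt:
  assumes st: "s \<in> V" "t \<in> V" "s \<noteq> t" and k: "within_order s t k"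
  shows "finite (inversions (alt_elt s t k))" "card (inversions (alt_elt s t k)) = k"
    "inversions (alt_elt s t k) \<subseteq> generated_by \<sigma> {s, t}"
proof -
  have sub: "set (alt_list s t k) \<subseteq> V" using set_alt_list[of s t k] st by auto
  have val: "val (alt_list s t k) = alt_elt s t k" by simp
  show "finite (inversions (alt_elt s t k))" using finite_inversions alt_elt_W st by blast
  have "reduced_word (alt_list s t k)"
    using distinct_refl_list_alt_list[OF assms] sub by (simp add: reduced_word_def)
  then show "card (inversions (alt_elt s t k)) = k"
    using reduced_word_len[of "alt_list s t k"] by (simp add: len_def)
  have "set (refl_list (alt_list s t k)) \<subseteq> generated_by \<sigma> {s, t}"
    using st alt_elt_generated[of s t] by (auto simp: refl_list_alt_list simp del: alt_prod.simps)
  then show "inversions (alt_elt s t k) \<subseteq> generated_by \<sigma> {s, t}"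
    using inversions_subset[OF sub] val by auto
qed

text \<open>Minimality is demanded against the whole dihedral coset and not just against
  \<open>s\<close> and \<open>t\<close>: existence is then a mere choice of a minimum, and
  \<open>len_alt_elt_mult\<close> tests it on arbitrary reflections of the dihedral
  subgroup.\<close>

definition dihedral_minimal :: "'a \<Rightarrow> 'a \<Rightarrow> 'w \<Rightarrow> bool" where
  "dihedral_minimal s t w \<longleftrightarrow> w \<in> W \<and> (\<forall>d \<in> generated_by \<sigma> {s, t}. len w \<le> len (d * w))"

lemma dihedral_minimal_commute: "dihedral_minimal s t w \<longleftrightarrow> dihedral_minimal t s w"
  by (simp add: dihedral_minimal_def insert_commute)

lemma dihedral_minimal_exists:
  assumes "s \<in> V" "t \<in> V" "w \<in> W"
  obtains d w1 where "d \<in> generated_by \<sigma> {s, t}" "w = d * w1" "dihedral_minimal s t w1"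
proof -
  define e where "e = arg_min (\<lambda>e. len (e * w)) (\<lambda>e. e \<in> generated_by \<sigma> {s, t})"
  have e: "e \<in> generated_by \<sigma> {s, t}" "\<And>d. d \<in> generated_by \<sigma> {s, t} \<Longrightarrow> len (e * w) \<le> len (d * w)"
    using arg_min_nat_lemma[of "\<lambda>e. e \<in> generated_by \<sigma> {s, t}" 1 "\<lambda>e. len (e * w)"]
    by (auto simp: e_def)
  have "dihedral_minimal s t (e * w)"
    unfolding dihedral_minimal_def
    using assms dihedral_subset_W[OF assms(1,2) e(1)] e by (auto simp: mult.assoc[symmetric])
  then show ?thesis using that[of "ginv e" "e * w"] e by simp
qed

text \<open>The inversions of the alternating element lie in the dihedral subgroup. If one of them
  were also a conjugate of an inversion of \<open>w\<close>, a dihedral reflection would shorten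
  \<open>w\<close>. So the two sets in the cocycle rule are disjoint and their sizes add.\<close>

lemma len_alt_elt_mult:
  assumes st: "s \<in> V" "t \<in> V" "s \<noteq> t" and k: "within_order s t k" and w: "dihedral_minimal s t w"
  shows "len (alt_elt s t k * w) = k + len w"
proof -
  let ?d = "alt_elt s t k"
  let ?B = "(\<lambda>x. ?d * x * ginv ?d) ` inversions w"
  have wW: "w \<in> W" using w by (simp add: dihedral_minimal_def)
  have B: "x \<in> ?B \<longleftrightarrow> ginv ?d * x * ?d \<in> inversions w" for x
  proof
    assume "ginv ?d * x * ?d \<in> inversions w"
    then show "x \<in> ?B" by (intro image_eqI[of _ _ "ginv ?d * x * ?d"]) (auto simp: mult.assoc)
  qed (auto simp: mult.assoc)
  have disj: "inversions ?d \<inter> ?B = {}"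
  proof (rule ccontr)
    assume "inversions ?d \<inter> ?B \<noteq> {}"
    then obtain x where x: "x \<in> inversions ?d" "ginv ?d * x * ?d \<in> inversions w" using B by blast
    have "x \<in> generated_by \<sigma> {s, t}" using inversions_alt_elt(3)[OF st k] x(1) by blast
    then have "ginv ?d * x * ?d \<in> generated_by \<sigma> {s, t}"
      using alt_elt_generated[of s t k] by simp
    then have "len w \<le> len (ginv ?d * x * ?d * w)" using w unfolding dihedral_minimal_def by blast
    then show False using len_reflection_less[OF wW x(2)] by simp
  qed
  have "inversions (?d * w) = inversions ?d \<union> ?B"
    using inversions_mult[of ?d w] B disj st wW by auto
  moreover have "inj (\<lambda>x. ?d * x * ginv ?d)" by (rule injI) simp
  ultimately show ?thesis
    using disj finite_inversions[OF wW] inversions_alt_elt(1,2)[OF st k]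
    by (simp add: len_def card_Un_disjoint card_image inj_on_subset)
qed

lemma within_order_1: "s \<in> V \<Longrightarrow> t \<in> V \<Longrightarrow> within_order s t 1"
  using defining_graph_label[OF graph, of s t] by (auto simp: within_order_def)

lemma dihedral_elements:
  assumes "d \<in> generated_by \<sigma> {s, t}" and st: "s \<in> V" "t \<in> V"
  shows "\<exists>k. within_order s t k \<and> (d = alt_elt s t k \<or> d = alt_elt t s k)"
proof -
  have step: "\<exists>j. within_order s t j \<and> (\<sigma> s * d = alt_elt s t j \<or> \<sigma> s * d = alt_elt t s j)"
    if st: "s \<in> V" "t \<in> V" and d: "within_order s t k" "d = alt_elt s t k \<or> d = alt_elt t s k"
        for s t d k
    using d(2)
  proof
    assume "d = alt_elt s t k"
    then show ?thesis
    proof (cases k)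
      case 0
      then show ?thesis
        using within_order_1[OF st] \<open>d = _\<close> by (intro exI[of _ 1]) simp
    next
      case (Suc j)
      then have "\<sigma> s * d = alt_elt t s j" using \<open>d = _\<close> st by simp
      moreover have "within_order s t j" using d Suc by (auto simp: within_order_def)
      ultimately show ?thesis by blast
    qed
  next
    assume dk: "d = alt_elt t s k"
    show ?thesis
    proof (cases "within_order s t (Suc k)")
      case True
      moreover have "\<sigma> s * d = alt_elt s t (Suc k)" using dk by simp
      ultimately show ?thesis by blast
    next
      case False
      then obtain m where m: "label \<Gamma> {s, t} = Some m" "k = m"
        using d by (auto simp: within_order_def not_less_eq_eq[symmetric])
      have "\<sigma> s * d = alt_elt t s (m - 1)" using alt_elt_order[OF m(1)] dk m(2) by simp
      moreover have "within_order s t (m - 1)" using m by (auto simp: within_order_def)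
      ultimately show ?thesis by blast
    qed
  qed
  show ?thesis using assms(1)
  proof (induction rule: generated_by_induct)
    case one
    show ?case by (intro exI[of _ 0]) (simp add: within_order_def)
  next
    case (mult u b x)
    then obtain k where k: "within_order s t k" "x = alt_elt s t k \<or> x = alt_elt t s k" by blast
    have l: "letter_val \<sigma> (u, b) = \<sigma> u" using mult(1) st by (cases b) auto
    consider "u = s" | "u = t" using mult(1) by blast
    then show ?case
    proof cases
      case 1
      then show ?thesis using step[OF st k] l by simp
    next
      case 2
      have "within_order t s k" "x = alt_elt t s k \<or> x = alt_elt s t k"
        using k within_order_commute by blast+
      from step[OF st(2,1) this] show ?thesis using 2 l within_order_commute by metis
    qed
  qed
qed

text \<open>Split \<open>w\<close> into a dihedral element and a shortest one. If the dihedral part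
  were not of full length, one of \<open>s\<close> and \<open>t\<close> would lengthen
  \<open>w\<close>; so it is the longest dihedral element, and in particular the label is
  finite.\<close>

lemma two_descents:
  assumes st: "s \<in> V" "t \<in> V" "s \<noteq> t" and w: "w \<in> W" "\<sigma> s \<in> inversions w" "\<sigma> t \<in> inversions w"
  obtains m w1 where "label \<Gamma> {s, t} = Some m" "w = alt_elt s t m * w1" "w1 \<in> W"
      "len w = m + len w1"
proof -
  obtain d w1 where d: "d \<in> generated_by \<sigma> {s, t}" "w = d * w1" "dihedral_minimal s t w1"
    using dihedral_minimal_exists[OF st(1,2) w(1)] .
  obtain k where k: "within_order s t k" "d = alt_elt s t k \<or> d = alt_elt t s k"
    using dihedral_elements[OF d(1) st(1,2)] by blast
  have k': "within_order t s k" and d3': "dihedral_minimal t s w1"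
    using k(1) d(3) within_order_commute dihedral_minimal_commute by blast+
  have lab: "label \<Gamma> {s, t} = Some k"
  proof (rule ccontr)
    assume "label \<Gamma> {s, t} \<noteq> Some k"
    then have Sk: "within_order s t (Suc k)" using k(1)
      by (auto simp: within_order_def le_Suc_eq Suc_le_eq order_le_less)
    then have Sk': "within_order t s (Suc k)" using within_order_commute by blast
    from k(2) show False
    proof
      assume ds: "d = alt_elt s t k"
      have "len (\<sigma> t * w) = Suc k + len w1"
        using len_alt_elt_mult[OF st(2,1) not_sym[OF st(3)] Sk' d3'] ds d(2)
          by (simp add: mult.assoc)
      moreover have "len w = k + len w1" using len_alt_elt_mult[OF st k(1) d(3)] ds d(2) by simp
      ultimately show False using len_generator_mult(2)[OF st(2) w(1,3)] by simp
    next
      assume ds: "d = alt_elt t s k"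
      have "len (\<sigma> s * w) = Suc k + len w1"
        using len_alt_elt_mult[OF st Sk d(3)] ds d(2) by (simp add: mult.assoc)
      moreover have "len w = k + len w1"
        using len_alt_elt_mult[OF st(2,1) not_sym[OF st(3)] k' d3'] ds d(2) by simp
      ultimately show False using len_generator_mult(2)[OF st(1) w(1,2)] by simp
    qed
  qed
  have "d = alt_elt s t k" using k(2) braid_relation[OF lab] by auto
  then show ?thesis
    using that[OF lab, of w1] d len_alt_elt_mult[OF st k(1) d(3)]
      by (simp add: dihedral_minimal_def)
qed

subsection \<open>Matsumoto's theorem and the longest element\<close>

text \<open>Equality in the Artin group, not in the positive monoid; the words are evaluated only in
  groups satisfying the Artin relations.\<close>

definition braid_eq :: "'a list \<Rightarrow> 'a list \<Rightarrow> bool" where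
  "braid_eq u v \<longleftrightarrow> pres_eq V (artin_relations \<Gamma>) (positive_word u) (positive_word v)"

lemma braid_eq_refl: "set u \<subseteq> V \<Longrightarrow> braid_eq u u"
  by (simp add: braid_eq_def pres_eq.refl)

lemma braid_eq_append: "braid_eq u u' \<Longrightarrow> braid_eq v v' \<Longrightarrow> braid_eq (u @ v) (u' @ v')"
  by (simp add: braid_eq_def pres_eq.append)

lemma braid_eq_trans [trans]: "braid_eq u v \<Longrightarrow> braid_eq v w \<Longrightarrow> braid_eq u w"
  unfolding braid_eq_def by (rule pres_eq.trans)

lemma braid_eq_sym: "braid_eq u v \<Longrightarrow> braid_eq v u"
  unfolding braid_eq_def by (rule pres_eq.sym)

lemma braid_eq_alt:
  assumes "label \<Gamma> {s, t} = Some m"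
  shows "braid_eq (alt_list s t m) (alt_list t s m)"
proof -
  have "s \<in> V" "t \<in> V" using defining_graph_label[OF graph assms] by auto
  then show ?thesis
    unfolding braid_eq_def positive_word_alt_list
    using assms by (intro pres_eq.relator) (auto simp: artin_relations_def)
qed

lemma reduced_word_Cons:
  assumes "reduced_word (s # u)"
  shows "s \<in> V" "reduced_word u" "\<sigma> s \<in> inversions (val (s # u))"
proof -
  show s: "s \<in> V" using assms by (simp add: reduced_word_def)
  show u: "reduced_word u"
    using assms unfolding reduced_word_def by (simp add: distinct_map)
  have uW: "val u \<in> W" using u val_W by (simp add: reduced_word_def)
  show "\<sigma> s \<in> inversions (val (s # u))"
  proof (rule ccontr)
    assume "\<sigma> s \<notin> inversions (val (s # u))"
    then have "len (\<sigma> s * (\<sigma> s * val u)) = Suc (len (\<sigma> s * val u))"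
      using len_generator_mult(1)[OF s, of "\<sigma> s * val u"] s uW by simp
    then show False
      using s reduced_word_len[OF assms] reduced_word_len[OF u] by simp
  qed
qed

text \<open>If the first letters differ, both are descents, and by \<open>two_descents\<close> the
  element has reduced words starting with either of the two full alternations and continuing
  identically. Each given word is compared by induction with the one that shares its first letter,
  and a single braid relation links these two.\<close>

theorem matsumoto:
  assumes "reduced_word u" "reduced_word v" "val u = val v"
  shows "braid_eq u v"
  using assms
proof (induction "length u" arbitrary: u v)
  case 0
  then have "length v = 0" using reduced_word_len by metis
  then show ?case using 0 by (simp add: braid_eq_refl)
next
  case (Suc n)
  have "length v = Suc n" using Suc reduced_word_len by metis
  then obtain s u' t v' where uv: "u = s # u'" "v = t # v'" "length u' = n" "length v' = n"
    using Suc(2) by (metis Suc_length_conv)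
  note u = reduced_word_Cons[OF Suc(3)[unfolded uv]]
      and v = reduced_word_Cons[OF Suc(4)[unfolded uv]]
  have cons: "braid_eq (a # x) (a # y)" if "a \<in> V" "braid_eq x y" for a x y
    using braid_eq_append[OF braid_eq_refl[of "[a]"] that(2)] that(1) by simp
  show ?case
  proof (cases "s = t")
    case True
    then have "val u' = val v'" using Suc(5) uv by simp
    then show ?thesis using Suc(1)[of u' v'] uv u v True cons by simp
  next
    case False
    have w: "val u \<in> W" using Suc(3) val_W by (simp add: reduced_word_def)
    obtain m w1 where m: "label \<Gamma> {s, t} = Some m" "val u = alt_elt s t m * w1" "w1 \<in> W"
        "len (val u) = m + len w1"
      using two_descents[OF u(1) v(1) False w] u(3) v(3) uv Suc(5) by metis
    obtain x where x: "reduced_word x" "val x = w1" using reduced_word_exists[OF m(3)] .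
    have half: "braid_eq (a # y) (alt_list a b m @ x)"
      if "a \<in> V" "b \<in> V" "reduced_word (a # y)" "length y = n" "val (a # y) = val u"
        "label \<Gamma> {a, b} = Some m" "val u = alt_elt a b m * w1" for a b y
    proof -
      obtain j where j: "m = Suc j" using defining_graph_label[OF graph m(1)] by (cases m) auto
      have eq: "val y = val (alt_list b a j @ x)"
        using that(5,7) x j by (simp add: mult.assoc)
      have "set (alt_list b a j @ x) \<subseteq> V"
        using set_alt_list[of b a j] that(1,2) x by (auto simp: reduced_word_def)
      moreover have y: "reduced_word y" using reduced_word_Cons(2)[OF that(3)] .
      moreover have "length (alt_list b a j @ x) = length y"
        using m(4) reduced_word_len[OF Suc(3)] reduced_word_len[OF x(1)] x(2) j that(4) Suc(2)
          by simp
      ultimately have "reduced_word (alt_list b a j @ x)"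
        using reduced_word_len[OF y] eq by (simp only: reduced_word_iff)
      then have "braid_eq y (alt_list b a j @ x)"
        using Suc(1)[OF that(4)[symmetric] y] eq by blast
      then show ?thesis using cons[OF that(1)] j by simp
    qed
    have mt: "label \<Gamma> {t, s} = Some m" using m(1) by (simp add: insert_commute)
    have "braid_eq u (alt_list s t m @ x)"
      using half[OF u(1) v(1) Suc(3)[unfolded uv(1)] uv(3) _ m(1,2)] by (simp only: uv(1))
    also have "braid_eq (alt_list s t m @ x) (alt_list t s m @ x)"
      using x(1) by (intro braid_eq_append braid_eq_alt[OF m(1)] braid_eq_refl) (simp add:
          reduced_word_def)
    also have "braid_eq (alt_list t s m @ x) v"
    proof (rule braid_eq_sym)
      have "val u = alt_elt t s m * w1" using m(2) braid_relation[OF m(1)] by (simp only:)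
      then show "braid_eq v (alt_list t s m @ x)"
        using half[OF v(1) u(1) Suc(4)[unfolded uv(2)] uv(4) _ mt] Suc(5) by (simp only: uv(2))
    qed
    finally show ?thesis .
  qed
qed

section \<open>Reflections and the longest element\<close>

lemma inversions_ginv:
  assumes "w \<in> W"
  shows "t \<in> inversions (ginv w) \<longleftrightarrow> w * t * ginv w \<in> inversions w"
proof -
  have "ginv w * (w * t * ginv w) * w = t" by (simp add: mult.assoc)
  then show ?thesis using inversions_mult[of w "ginv w" "w * t * ginv w"] assms by simp
qed

definition reflections :: "'w set" where
  "reflections = {g * \<sigma> s * ginv g | g s. g \<in> W \<and> s \<in> V}"

lemma conj_reflection:
  assumes "t \<in> reflections" "h \<in> W"
  shows "h * t * ginv h \<in> reflections"
proof -
  obtain g s where "t = g * \<sigma> s * ginv g" "g \<in> W" "s \<in> V" using assms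
    by (auto simp: reflections_def)
  then show ?thesis
    using assms(2) unfolding reflections_def
    by (intro CollectI exI[of _ "h * g"] exI[of _ s]) (auto simp: mult.assoc)
qed

lemma reflection_W: "t \<in> reflections \<Longrightarrow> t \<in> W"
  by (auto simp: reflections_def)

text \<open>In the cocycle expansion of \<open>g * \<sigma> s * ginv g\<close> the contributions of
  \<open>g\<close> and \<open>ginv g\<close> at \<open>t\<close> agree and cancel; that of the
  generator remains.\<close>

lemma reflection_inversion:
  assumes "t \<in> reflections"
  shows "t \<in> inversions t"
proof -
  obtain g s where t: "t = g * \<sigma> s * ginv g" and g: "g \<in> W" and s: "s \<in> V"
    using assms by (auto simp: reflections_def)
  have 1: "ginv g * t * g = \<sigma> s" by (simp add: t mult.assoc)
  have 2: "t \<in> inversions (g * (\<sigma> s * ginv g)) \<longleftrightarrow>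
      (t \<in> inversions g) \<noteq> (\<sigma> s \<in> inversions (\<sigma> s * ginv g))"
    using inversions_mult[of g "\<sigma> s * ginv g" t] g s 1 by simp
  have 3: "\<sigma> s \<in> inversions (\<sigma> s * ginv g) \<longleftrightarrow> \<sigma> s \<notin> inversions (ginv g)"
    using inversions_mult[of "\<sigma> s" "ginv g" "\<sigma> s"] g s by simp
  have "\<sigma> s \<in> inversions (ginv g) \<longleftrightarrow> t \<in> inversions g"
    using inversions_ginv[OF g] t by simp
  then show ?thesis using 2 3 t by (simp add: mult.assoc)
qed

lemma inversions_reflections: "w \<in> W \<Longrightarrow> inversions w \<subseteq> reflections"
proof -
  assume "w \<in> W"
  then obtain u where u: "set u \<subseteq> V" "val u = w" using W_list by blast
  have "set (refl_list u) \<subseteq> reflections" using u(1)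
  proof (induction u)
    case (Cons s u)
    have "\<sigma> s \<in> reflections"
      using Cons.prems unfolding reflections_def by (intro CollectI exI[of _ 1] exI[of _ s]) auto
    moreover have "\<sigma> s * t * ginv (\<sigma> s) \<in> reflections" if "t \<in> reflections" for t
      using conj_reflection[OF that, of "\<sigma> s"] Cons.prems by (simp del: ginv_generator)
    ultimately show ?case using Cons by auto
  qed simp
  then show "inversions w \<subseteq> reflections" using inversions_subset[OF u(1)] u(2) by blast
qed

text \<open>The witness is the square of a reduced word of the longest element: conjugation by the longest
  element permutes the generators and is an involution.\<close>

theorem central_positive_word:
  assumes fin: "finite W"
  obtains z where "set z \<subseteq> V" "\<And>s. s \<in> V \<Longrightarrow> braid_eq (s # z) (z @ [s])"
    "\<And>s. s \<in> V \<Longrightarrow> \<exists>x. braid_eq z (s # x)"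
proof -
  have "Max (len ` W) \<in> len ` W" using fin generated_by_one[of \<sigma> V] by (intro Max_in) blast+
  then obtain w where "w \<in> W" "len w = Max (len ` W)" by auto
  then have w: "w \<in> W" "\<And>w'. w' \<in> W \<Longrightarrow> len w' \<le> len w" using fin by auto
  \<comment> \<open>A reflection \<open>t\<close> that is no inversion of \<open>w\<close> would be
    one of \<open>t * w\<close>, and \<open>w = t * (t * w)\<close> would be shorter than
    \<open>t * w\<close>, against the maximality of \<open>w\<close>.\<close>
  have all: "inversions w = reflections"
  proof
    show "reflections \<subseteq> inversions w"
    proof
      fix t assume t: "t \<in> reflections"
      have tW: "t \<in> W" using t by (rule reflection_W)
      show "t \<in> inversions w"
      proof (rule ccontr)
        assume "t \<notin> inversions w"
        have "ginv t * t * t = t" by simp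
        then have "t \<in> inversions (t * w)"
          using inversions_mult[OF tW w(1), of t] reflection_inversion[OF t] \<open>t \<notin> inversions w\<close>
            by simp
        then have "len (t * (t * w)) < len (t * w)" using len_reflection_less tW w(1) by simp
        moreover have "t * t = 1" using t by (auto simp: reflections_def mult.assoc)
        then have "t * (t * w) = w" by (simp flip: mult.assoc)
        ultimately show False using w(2)[of "t * w"] tW w(1) by simp
      qed
    qed
  qed (rule inversions_reflections[OF w(1)])
  have inv1: "w = 1" if "w \<in> W" "inversions w = {}" for w
    using that len_0_iff[of w] by (simp add: len_def)
  have ww: "w * w = 1"
  proof (rule inv1)
    have "t \<notin> inversions (w * w)" for t
    proof (cases "t \<in> reflections")
      case True
      then have "ginv w * t * w \<in> reflections" using conj_reflection[of t "ginv w"] w(1) by simp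
      then show ?thesis using inversions_mult[OF w(1) w(1), of t] all True by simp
    next
      case False
      then show ?thesis using inversions_reflections[of "w * w"] w(1) by auto
    qed
    then show "inversions (w * w) = {}" by blast
  qed (use w in simp)
  then have gw: "ginv w = w" by (rule ginv_unique)
  have "\<exists>s' \<in> V. \<sigma> s * w = w * \<sigma> s'" if s: "s \<in> V" for s
  proof -
    define t where "t = w * \<sigma> s * w"
    have tr: "t \<in> reflections"
      unfolding t_def reflections_def using w(1) s gw
        by (intro CollectI exI[of _ w] exI[of _ s]) simp
    then have tW: "t \<in> W" by (rule reflection_W)
    \<comment> \<open>All reflections are inversions of \<open>w\<close>, so the contributions of
      the two outer factors \<open>w\<close> cancel except at \<open>t\<close>. An element with a
      single inversion has length 1 and is therefore a generator.\<close>
    have "inversions t = {t}"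
    proof (rule Set.set_eqI)
      fix x
      show "x \<in> inversions t \<longleftrightarrow> x \<in> {t}"
      proof (cases "x \<in> reflections")
        case False
        then show ?thesis using inversions_reflections[OF tW] tr by auto
      next
        case True
        let ?y = "w * x * w"
        have y: "?y \<in> reflections" using conj_reflection[OF True w(1)] gw by simp
        then have z: "\<sigma> s * ?y * \<sigma> s \<in> reflections" using conj_reflection[OF y, of "\<sigma> s"] s by simp
        have "x \<in> inversions t \<longleftrightarrow> (x \<in> inversions w) \<noteq> (?y \<in> inversions (\<sigma> s * w))"
          using inversions_mult[of w "\<sigma> s * w" x] w(1) s gw by (simp add: t_def mult.assoc)
        also have "\<dots> \<longleftrightarrow> ?y \<notin> inversions (\<sigma> s * w)" using True all by simp
        also have "\<dots> \<longleftrightarrow> (?y = \<sigma> s)"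
          using inversions_mult[of "\<sigma> s" w ?y] w(1) s z all by simp
        also have "\<dots> \<longleftrightarrow> x = t"
          using conj_eq_iff[of w x "\<sigma> s"] gw by (simp add: t_def)
        finally show ?thesis by simp
      qed
    qed
    then have "len t = 1" by (simp add: len_def)
    then obtain u where u: "reduced_word u" "val u = t" "length u = 1"
      using reduced_word_exists[OF tW] reduced_word_len by metis
    then obtain s' where "u = [s']" by (metis One_nat_def Suc_length_conv length_0_conv)
    then have "s' \<in> V" "\<sigma> s' = t" using u by (auto simp: reduced_word_def)
    moreover have "\<sigma> s * w = w * t" using ww by (simp add: t_def flip: mult.assoc)
    ultimately show ?thesis by auto
  qed
  then obtain \<pi> where \<pi>: "\<And>s. s \<in> V \<Longrightarrow> \<pi> s \<in> V" "\<And>s. s \<in> V \<Longrightarrow> \<sigma> s * w = w * \<sigma> (\<pi> s)" by metis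
  have \<pi>\<pi>: "\<pi> (\<pi> s) = s" if s: "s \<in> V" for s
  proof (rule generator_inj)
    have "\<sigma> s * (w * w) = w * w * \<sigma> (\<pi> (\<pi> s))"
      using \<pi>(2)[OF s] \<pi>(2)[OF \<pi>(1)[OF s]] by (metis mult.assoc)
    then show "\<sigma> (\<pi> (\<pi> s)) = \<sigma> s" using ww by simp
  qed (use \<pi> s in auto)
  obtain \<delta> where \<delta>: "reduced_word \<delta>" "val \<delta> = w" using reduced_word_exists[OF w(1)] .
  have \<delta>V: "set \<delta> \<subseteq> V" using \<delta>(1) by (simp add: reduced_word_def)
  \<comment> \<open>Every generator is a descent of the longest element. With \<open>x\<close> a
    reduced word of \<open>\<sigma> s * w\<close>, both extensions of \<open>x\<close> are reduced
    words of \<open>w\<close>, so Matsumoto's theorem identifies them with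
    \<open>\<delta>\<close>.\<close>
  have start: "\<exists>x. reduced_word x \<and> braid_eq \<delta> (s # x) \<and> braid_eq \<delta> (x @ [\<pi> s])" if s: "s \<in> V" for s
  proof -
    have "\<sigma> s \<in> reflections"
      using s unfolding reflections_def by (intro CollectI exI[of _ 1] exI[of _ s]) auto
    then have l: "Suc (len (\<sigma> s * w)) = len w" using len_generator_mult(2)[OF s w(1)] all by simp
    obtain x where x: "reduced_word x" "val x = \<sigma> s * w"
      using reduced_word_exists[of "\<sigma> s * w"] s w(1) by auto
    have xV: "set x \<subseteq> V" using x(1) by (simp add: reduced_word_def)
    have v: "val (s # x) = w" using x(2) s by simp
    have v': "val (x @ [\<pi> s]) = w" using x(2) \<pi>[OF s] by (simp add: mult.assoc)
    have "reduced_word (s # x)" "reduced_word (x @ [\<pi> s])"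
      unfolding reduced_word_iff v v' using l reduced_word_len[OF x(1)] x(2) xV s \<pi>(1)[OF s] by auto
    then show ?thesis using matsumoto[OF \<delta>(1)] v v' \<delta>(2) x(1) by metis
  qed
  have comm: "braid_eq (s # \<delta>) (\<delta> @ [\<pi> s])" if s: "s \<in> V" for s
  proof -
    obtain x where x: "reduced_word x" "braid_eq \<delta> (s # x)" "braid_eq \<delta> (x @ [\<pi> s])"
      using start[OF s] by blast
    have "braid_eq ([s] @ \<delta>) ([s] @ (x @ [\<pi> s]))"
      using s x(3) by (intro braid_eq_append braid_eq_refl) auto
    also have "braid_eq ([s] @ (x @ [\<pi> s])) (\<delta> @ [\<pi> s])"
      using braid_eq_append[OF braid_eq_sym[OF x(2)] braid_eq_refl[of "[\<pi> s]"]] \<pi>(1)[OF s] by simp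
    finally show ?thesis by simp
  qed
  show ?thesis
  proof
    show "set (\<delta> @ \<delta>) \<subseteq> V" using \<delta>V by simp
    fix s assume s: "s \<in> V"
    have "braid_eq ((s # \<delta>) @ \<delta>) ((\<delta> @ [\<pi> s]) @ \<delta>)"
      by (intro braid_eq_append comm s braid_eq_refl \<delta>V)
    also have "braid_eq ((\<delta> @ [\<pi> s]) @ \<delta>) (\<delta> @ (\<delta> @ [\<pi> (\<pi> s)]))"
      using braid_eq_append[OF braid_eq_refl[OF \<delta>V] comm[OF \<pi>(1)[OF s]]] by simp
    finally show "braid_eq (s # \<delta> @ \<delta>) ((\<delta> @ \<delta>) @ [s])" using \<pi>\<pi>[OF s] by simp
    obtain x where "braid_eq \<delta> (s # x)" using start[OF s] by blast
    from braid_eq_append[OF this braid_eq_refl[OF \<delta>V]]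
    show "\<exists>x. braid_eq (\<delta> @ \<delta>) (s # x)" by auto
  qed
qed

end

section \<open>Intersections of special subgroups\<close>

text \<open>The retraction of Charney and Paris onto the special subgroup generated by \<open>X\<close>, encoded as an
  action on pairs \<open>(u, a)\<close>: \<open>u\<close> represents a left coset of the parabolic subgroup of \<open>X\<close>, and \<open>a\<close>
  records the letters of \<open>X\<close> that a path in the coset space meets as loops.\<close>

locale coset_action = coxeter \<Gamma> \<sigma>
  for \<Gamma> :: "'a labelled_graph" and \<sigma> :: "'a \<Rightarrow> 'w :: mult_group" +
  fixes \<gamma> :: "'a \<Rightarrow> 'g :: mult_group" and X :: "'a set"
  assumes X_subset: "X \<subseteq> V"
    and relations: "satisfies_relations V (artin_relations \<Gamma>) \<gamma>"
begin

definition minimal :: "'w \<Rightarrow> bool" where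
  "minimal u \<longleftrightarrow> u \<in> W \<and> (\<forall>x \<in> X. len u < len (u * \<sigma> x))"

lemma len_right_mult:
  assumes "w \<in> W" "t \<in> V"
  shows "len (w * \<sigma> t) = Suc (len w) \<or> Suc (len (w * \<sigma> t)) = len w"
proof -
  have "len (w * \<sigma> t) = len (\<sigma> t * ginv w)"
    using len_ginv[of "w * \<sigma> t"] assms by simp
  moreover have "len (ginv w) = len w" using assms len_ginv by simp
  moreover have "len (\<sigma> t * ginv w) = Suc (len (ginv w)) \<or> Suc (len (\<sigma> t * ginv w)) = len (ginv w)"
    using len_generator_mult[OF assms(2), of "ginv w"] assms(1) by (metis generated_by_ginv)
  ultimately show ?thesis by simp
qed

text \<open>Deodhar's dichotomy. If some \<open>x\<close> shortens \<open>\<sigma> s * u\<close> but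
  not \<open>u\<close>, then by the cocycle rule \<open>u * \<sigma> x * ginv u\<close> is an
  inversion of \<open>\<sigma> s\<close>, hence equal to it, and \<open>s\<close> fixes the coset of
  \<open>u\<close>.\<close>

lemma minimal_step:
  assumes u: "minimal u" and s: "s \<in> V"
  shows "minimal (\<sigma> s * u) \<or> (\<exists>x \<in> X. \<sigma> s * u = u * \<sigma> x)"
proof (rule ccontr)
  assume contr: "\<not> ?thesis"
  have uW: "u \<in> W" using u by (simp add: minimal_def)
  have suW: "\<sigma> s * u \<in> W" using uW s by simp
  obtain x where x: "x \<in> X" "\<not> len (\<sigma> s * u) < len (\<sigma> s * u * \<sigma> x)"
    using contr suW by (auto simp: minimal_def)
  have xV: "x \<in> V" using x X_subset by blast
  then have less: "Suc (len (\<sigma> s * u * \<sigma> x)) = len (\<sigma> s * u)" using len_right_mult[OF suW xV] x(2)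
    by auto
  have ux: "len u < len (u * \<sigma> x)" using u x(1) by (simp add: minimal_def)
  have "\<sigma> x \<in> inversions (ginv (\<sigma> s * u))"
  proof (rule ccontr)
    assume "\<sigma> x \<notin> inversions (ginv (\<sigma> s * u))"
    then have "len (\<sigma> x * ginv (\<sigma> s * u)) = Suc (len (ginv (\<sigma> s * u)))"
      using len_generator_mult(1)[OF xV generated_by_ginv[OF suW]] by blast
    moreover have "\<sigma> x * ginv (\<sigma> s * u) = ginv (\<sigma> s * u * \<sigma> x)" using xV by simp
    ultimately have "len (ginv (\<sigma> s * u * \<sigma> x)) = Suc (len (ginv (\<sigma> s * u)))" by (simp only:)
    moreover have "\<sigma> s * u * \<sigma> x \<in> W" using uW s xV by simp
    ultimately have "len (\<sigma> s * u * \<sigma> x) = Suc (len (\<sigma> s * u))"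
      using len_ginv[OF suW] len_ginv[of "\<sigma> s * u * \<sigma> x"] by linarith
    then show False using less by simp
  qed
  moreover have "\<sigma> x \<notin> inversions (ginv u)"
  proof
    assume "\<sigma> x \<in> inversions (ginv u)"
    then have "len (\<sigma> x * ginv u) < len (ginv u)" using len_reflection_less uW by simp
    moreover have "\<sigma> x * ginv u = ginv (u * \<sigma> x)" using xV by simp
    ultimately have "len (ginv (u * \<sigma> x)) < len (ginv u)" by (simp only:)
    moreover have "u * \<sigma> x \<in> W" using uW xV by simp
    ultimately show False using ux len_ginv[OF uW] len_ginv[of "u * \<sigma> x"] by linarith
  qed
  moreover have "ginv (\<sigma> s * u) = ginv u * \<sigma> s" using s by simp
  ultimately have "u * \<sigma> x * ginv u \<in> inversions (\<sigma> s)"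
    using inversions_mult[of "ginv u" "\<sigma> s" "\<sigma> x"] uW s by simp
  then have "u * \<sigma> x * ginv u = \<sigma> s" using s by simp
  then have "\<sigma> s * u = u * \<sigma> x" by (metis ginv_mult_cancel left_ginv mult.assoc mult.right_neutral)
  then show False using contr x(1) by blast
qed

lemma minimal_step_exclusive:
  assumes "minimal u" "s \<in> V" "x \<in> X" "\<sigma> s * u = u * \<sigma> x"
  shows "\<not> minimal (\<sigma> s * u)"
proof
  assume "minimal (\<sigma> s * u)"
  then have "len (u * \<sigma> x) < len (u * \<sigma> x * \<sigma> x)" using assms(3,4) by (simp add: minimal_def)
  moreover have "u * \<sigma> x * \<sigma> x = u" using assms(3) X_subset by (simp add: mult.assoc subset_iff)
  ultimately show False using assms(1,3) by (auto simp: minimal_def)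
qed

text \<open>The letter recorded by the loop that \<open>s\<close> makes at the coset of
  \<open>u\<close>. It is unspecified when there is no loop; on states, \<open>move\<close> consults
  it only where \<open>partner_exists\<close> provides one.\<close>

definition partner :: "'a \<Rightarrow> 'w \<Rightarrow> 'a" where
  "partner s u = (THE x. x \<in> X \<and> \<sigma> s * u = u * \<sigma> x)"

lemma partner_eq:
  assumes "x \<in> X" "\<sigma> s * u = u * \<sigma> x"
  shows "partner s u = x"
  unfolding partner_def
proof (rule the_equality)
  fix y assume "y \<in> X \<and> \<sigma> s * u = u * \<sigma> y"
  then show "y = x" using assms X_subset generator_inj[of y x] by auto
qed (use assms in simp)

definition move :: "'a \<Rightarrow> 'w \<times> 'g \<Rightarrow> 'w \<times> 'g" where
  "move s = (\<lambda>(u, a). if minimal (\<sigma> s * u) then (\<sigma> s * u, a) else (u, \<gamma> (partner s u) * a))"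

text \<open>Steps between cosets undo themselves, because generators of the Coxeter group are
  involutions; only the record of a loop has to be inverted.\<close>

definition move_back :: "'a \<Rightarrow> 'w \<times> 'g \<Rightarrow> 'w \<times> 'g" where
  "move_back s = (\<lambda>(u, a). if minimal (\<sigma> s * u) then (\<sigma> s * u, a) else (u, ginv (\<gamma> (partner s u)) *
      a))"

definition states :: "('w \<times> 'g) set" where
  "states = {(u, a). minimal u}"

definition move_perm :: "'a \<Rightarrow> ('w \<times> 'g) perm" where
  "move_perm s = Perm (\<lambda>p. if p \<in> states then move s p else p)"

lemma perm_apply_move_perm:
  assumes s: "s \<in> V"
  shows "perm_apply (move_perm s) p = (if p \<in> states then move s p else p)"
proof -
  have "bij (\<lambda>p. if p \<in> states then move s p else p)"
    by (rule bij_if_inverse[where g = "move_back s"])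
      (use s in \<open>auto simp: states_def move_def move_back_def mult.assoc[symmetric] split:
          if_splits\<close>)
  then show ?thesis by (simp add: move_perm_def)
qed

lemma perm_apply_move_perm_state:
  "s \<in> V \<Longrightarrow> minimal u \<Longrightarrow> perm_apply (move_perm s) (u, a) = move s (u, a)"
  by (simp add: perm_apply_move_perm states_def)

lemma move_minimal: "minimal (\<sigma> s * u) \<Longrightarrow> move s (u, a) = (\<sigma> s * u, a)"
  by (simp add: move_def)

lemma move_loop:
  assumes "minimal u" "s \<in> V" "x \<in> X" "\<sigma> s * u = u * \<sigma> x"
  shows "move s (u, a) = (u, \<gamma> x * a)"
  using minimal_step_exclusive[OF assms] partner_eq[OF assms(3,4)] by (simp add: move_def)

text \<open>Reading the letters of a sequence \<open>c\<close> of period two upwards from the minimal element of a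
  dihedral coset visits \<open>vertex c w k\<close>.\<close>

definition vertex :: "(nat \<Rightarrow> 'a) \<Rightarrow> 'w \<Rightarrow> nat \<Rightarrow> 'w" where
  "vertex c w k = prod_list (map (\<lambda>i. \<sigma> (c i)) (rev [0..<k])) * w"

lemma vertex_0 [simp]: "vertex c w 0 = w"
  by (simp add: vertex_def)

lemma vertex_Suc: "vertex c w (Suc k) = \<sigma> (c k) * vertex c w k"
  by (simp add: vertex_def mult.assoc)

lemma vertex_alt:
  "vertex (\<lambda>i. if even i then t else s) w k = (if even k then alt_elt s t k else alt_elt t s k) * w"
proof (induction k)
  case (Suc k)
  then show ?case by (simp add: vertex_Suc mult.assoc)
qed simp

lemma vertex_commute_alt:
  assumes "label \<Gamma> {s, t} = Some m"
  shows "vertex (\<lambda>i. if even i then t else s) w m = vertex (\<lambda>i. if even i then s else t) w m"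
  using braid_relation[OF assms] by (simp add: vertex_alt)

lemma len_vertex:
  assumes "s \<in> V" "t \<in> V" "s \<noteq> t" "dihedral_minimal s t w" "within_order s t k"
  shows "len (vertex (\<lambda>i. if even i then t else s) w k) = k + len w"
  using len_alt_elt_mult[OF assms(1-3,5,4)] assms(1-3)
    len_alt_elt_mult[OF assms(2,1) not_sym[OF assms(3)] assms(5)[unfolded within_order_commute[of s
        t]]
      assms(4)[unfolded dihedral_minimal_commute[of s t]]]
  by (simp add: vertex_alt)

lemma vertex_Suc_front:
  "vertex (\<lambda>i. if even i then t else s) w (Suc k) =
      vertex (\<lambda>i. if even i then s else t) (\<sigma> t * w) k"
  by (induction k) (simp_all add: vertex_Suc)

lemma vertex_mult_right: "vertex c (w * x) k = vertex c w k * x"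
  by (simp add: vertex_def mult.assoc)

definition loops :: "'a \<Rightarrow> 'w \<Rightarrow> bool" where
  "loops s w \<longleftrightarrow> (\<exists>x \<in> X. \<sigma> s * w = w * \<sigma> x)"

text \<open>A loop of \<open>t\<close> at the bottom lets the first letter \<open>t\<close> of the
  path slide through \<open>w\<close> and reappear on the right as \<open>x\<close>. Cancelling it
  gives a shorter element of the same left coset.\<close>

lemma vertex_minimal_no_loop:
  assumes st: "s \<in> V" "t \<in> V" "s \<noteq> t" "dihedral_minimal s t w" and k: "within_order s t (Suc k)"
    and min: "minimal (vertex (\<lambda>i. if even i then t else s) w (Suc k))"
  shows "\<not> loops t w"
proof
  assume "loops t w"
  then obtain x where x: "x \<in> X" "\<sigma> t * w = w * \<sigma> x" by (auto simp: loops_def)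
  let ?u = "vertex (\<lambda>i. if even i then t else s) w (Suc k)"
  have "?u = vertex (\<lambda>i. if even i then s else t) w k * \<sigma> x"
    unfolding vertex_Suc_front x(2) vertex_mult_right ..
  then have "?u * \<sigma> x = vertex (\<lambda>i. if even i then s else t) w k"
    using x(1) X_subset by (auto simp: mult.assoc)
  moreover have "within_order t s k" using k by (auto simp: within_order_def insert_commute)
  then have "len (vertex (\<lambda>i. if even i then s else t) w k) = k + len w"
    using len_vertex[OF st(2,1) not_sym[OF st(3)]] st(4) dihedral_minimal_commute by blast
  ultimately have "len (?u * \<sigma> x) < len ?u" using len_vertex[OF st k] by simp
  then show False using min x(1) by (auto simp: minimal_def)
qed

lemma dihedral_length_one:
  assumes st: "s \<in> V" "t \<in> V" "s \<noteq> t" "dihedral_minimal s t w"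
    and e: "e \<in> generated_by \<sigma> {s, t}" "len (e * w) = Suc (len w)"
  shows "e = \<sigma> s \<or> e = \<sigma> t"
proof -
  obtain k where k: "within_order s t k" "e = alt_elt s t k \<or> e = alt_elt t s k"
    using dihedral_elements[OF e(1) st(1,2)] by blast
  have "len (alt_elt s t k * w) = k + len w" by (rule len_alt_elt_mult[OF st(1-3) k(1) st(4)])
  moreover have "len (alt_elt t s k * w) = k + len w"
    using len_alt_elt_mult[OF st(2,1) not_sym[OF st(3)]] k(1) st(4) within_order_commute
        dihedral_minimal_commute
    by blast
  ultimately have "k = 1" using k(2) e(2) by auto
  then show ?thesis using k(2) by auto
qed

text \<open>If the step fails, it is a loop; conjugated down to the bottom it becomes a dihedral
  element \<open>e\<close> with \<open>e * w = w * \<sigma> x\<close>, which has length one more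
  than \<open>w\<close>. So \<open>e\<close> is \<open>\<sigma> s\<close>, as \<open>t\<close> makes
  no loop there, and equality of two alternating elements makes \<open>m\<close> divide
  \<open>Suc k\<close>, the top of the polygon.\<close>

lemma vertex_minimal_Suc:
  assumes st: "label \<Gamma> {s, t} = Some m" "dihedral_minimal s t w" "minimal w" "\<not> loops t w"
    and k: "minimal (vertex (\<lambda>i. if even i then t else s) w k)" "k < m"
    and s: "loops s w \<Longrightarrow> Suc k < m"
  shows "minimal (vertex (\<lambda>i. if even i then t else s) w (Suc k))"
proof (rule ccontr)
  have V: "s \<in> V" "t \<in> V" "s \<noteq> t" using defining_graph_label[OF graph st(1)] by auto
  let ?c = "\<lambda>i::nat. if even i then t else s"
  let ?D = "if even k then alt_elt s t k else alt_elt t s k"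
  have u: "vertex ?c w k = ?D * w" by (rule vertex_alt)
  have c: "?c k \<in> V" using V by simp
  assume "\<not> minimal (vertex ?c w (Suc k))"
  then obtain x where x: "x \<in> X" "\<sigma> (?c k) * vertex ?c w k = vertex ?c w k * \<sigma> x"
    using minimal_step[OF k(1) c] by (auto simp: vertex_Suc)
  define e where "e = ginv ?D * \<sigma> (?c k) * ?D"
  have "e * w = ginv ?D * (\<sigma> (?c k) * vertex ?c w k)" unfolding e_def u by (simp only: mult.assoc)
  also have "\<dots> = w * \<sigma> x" by (simp only: x(2), simp only: u mult.assoc ginv_mult_cancel)
  finally have ew: "e * w = w * \<sigma> x" .
  have "?D \<in> generated_by \<sigma> {s, t}" using alt_elt_generated alt_elt_generated' by simp
  then have "e \<in> generated_by \<sigma> {s, t}" unfolding e_def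
    by (intro generated_by_mult generated_by_ginv) auto
  moreover have "len (e * w) = Suc (len w)"
  proof -
    have "w \<in> W" "x \<in> V" "len w < len (w * \<sigma> x)" using st(3) x(1) X_subset
      by (auto simp: minimal_def)
    then show ?thesis unfolding ew using len_right_mult[of w x] by auto
  qed
  ultimately have "e = \<sigma> s \<or> e = \<sigma> t" using dihedral_length_one[OF V st(2)] by blast
  then have es: "e = \<sigma> s" and ls: "loops s w" using st(4) ew x(1) by (auto simp: loops_def)
  have "\<sigma> (?c k) * ?D = ?D * e" unfolding e_def by (simp only: mult.assoc mult_ginv_cancel)
  then have "\<sigma> (?c k) * ?D = ?D * \<sigma> s" unfolding es .
  then have "alt_elt t s (Suc k) = alt_elt s t (Suc k)"
    using alt_prod_add[of "\<sigma> s" "\<sigma> t" k 1] alt_prod_add[of "\<sigma> t" "\<sigma> s" k 1]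
    by (cases "even k") auto
  from order_dvd[OF V _ this[symmetric]] obtain m' where "label \<Gamma> {s, t} = Some m'" "m' dvd Suc k"
    by blast
  then show False using st(1) s[OF ls] by (auto dest: dvd_imp_le)
qed

section \<open>Braid relations on one dihedral coset\<close>

lemma alt_apply_add:
  "alt_apply f s t (i + j) q =
     (if even i then alt_apply f s t j (alt_apply f s t i q) else alt_apply f t s j (alt_apply f s t
         i q))"
  by (induction i arbitrary: s t q) auto

text \<open>The minimal elements of the dihedral coset form a path of \<open>m\<close> vertices with
  a loop recording \<open>x\<close> at either end. From position \<open>p\<close>, one alternating
  word climbs, crosses the top loop and descends; the other descends, crosses the bottom loop and
  climbs. Both end at \<open>m - 1 - p\<close> with one \<open>x\<close> recorded.\<close>

lemma braid_one_loop:
  assumes lab: "label \<Gamma> {s, t} = Some m" and w: "dihedral_minimal s t w" "minimal w"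
    and loop: "\<not> loops t w" "x \<in> X" "\<sigma> s * w = w * \<sigma> x"
    and p: "p < m"
  defines "c \<equiv> \<lambda>i::nat. if even i then t else s"
  defines "f \<equiv> \<lambda>s. perm_apply (move_perm s)"
  shows "alt_apply f (c p) (c (Suc p)) m (vertex c w p, a) = (vertex c w (m - 1 - p), \<gamma> x * a)"
    and "alt_apply f (c (Suc p)) (c p) m (vertex c w p, a) = (vertex c w (m - 1 - p), \<gamma> x * a)"
proof -
  have V: "s \<in> V" "t \<in> V" "s \<noteq> t" "m \<ge> 2" using defining_graph_label[OF graph lab] by auto
  have cV: "c i \<in> V" for i using V by (simp add: c_def)
  have min: "minimal (vertex c w k)" if "k < m" for k
    using that
  proof (induction k)
    case (Suc k)
    then show ?case unfolding c_def using vertex_minimal_Suc[OF lab w loop(1), of k] by simp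
  qed (use w in simp)
  have f: "f s (vertex c w k, a) = move s (vertex c w k, a)" if "k < m" "s \<in> V" for s k a
    unfolding f_def using perm_apply_move_perm_state min that by simp
  have up: "f (c k) (vertex c w k, a) = (vertex c w (Suc k), a)" if "Suc k < m" for k a
    using f[of k "c k" a] that cV move_minimal[of "c k" "vertex c w k" a] min[of "Suc k"]
      by (simp add: vertex_Suc)
  have down: "f (c (Suc (Suc k))) (vertex c w (Suc k), a) = (vertex c w k, a)" if "Suc k < m"
      for k a
  proof -
    have "c (Suc (Suc k)) = c k" by (simp add: c_def)
    moreover have "\<sigma> (c k) * vertex c w (Suc k) = vertex c w k" using cV by (simp add: vertex_Suc)
    ultimately show ?thesis
      using f[of "Suc k" "c k" a] that cV move_minimal[of "c k" "vertex c w (Suc k)" a] min[of k]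
        by simp
  qed
  have bottom: "f (c (Suc 0)) (w, a) = (w, \<gamma> x * a)" for a
    using f[of 0 s a] V move_loop[OF w(2) V(1) loop(2,3)] by (simp add: c_def)
  have top: "f (c (m - 1)) (vertex c w (m - 1), a) = (vertex c w (m - 1), \<gamma> x * a)" for a
  proof -
    \<comment> \<open>The braid relation lets the step above the top be read along the other side of
      the polygon, which starts with the bottom loop; its letter slides to the right, so the top
      loop has the same partner \<open>x\<close>.\<close>
    have "vertex c w (Suc (m - 1)) = vertex (\<lambda>i. if even i then s else t) w (Suc (m - 1))"
      using vertex_commute_alt[OF lab, of w] V(4) unfolding c_def by simp
    also have "\<dots> = vertex c w (m - 1) * \<sigma> x"
      unfolding vertex_Suc_front loop(3) vertex_mult_right c_def ..
    finally have "\<sigma> (c (m - 1)) * vertex c w (m - 1) = vertex c w (m - 1) * \<sigma> x"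
      by (simp add: vertex_Suc)
    then show ?thesis
      using f[of "m - 1" "c (m - 1)" a] V(4) move_loop[OF min cV loop(2), of "m - 1" "m - 1" a] cV
        by simp
  qed
  have ups: "alt_apply f (c k) (c (Suc k)) j (vertex c w k, a) = (vertex c w (k + j), a)"
      if "k + j < m" for k j a
    using that
  proof (induction j arbitrary: k)
    case (Suc j)
    have "c (Suc (Suc k)) = c k" by (simp add: c_def)
    then show ?case using Suc.IH[of "Suc k"] Suc.prems up[of k a] by simp
  qed simp
  have downs: "alt_apply f (c (Suc k)) (c k) j (vertex c w k, a) = (vertex c w (k - j), a)"
      if "k < m" "j \<le> k" for k j a
    using that
  proof (induction j arbitrary: k)
    case (Suc j)
    then obtain k' where k': "k = Suc k'" by (cases k) auto
    have "c (Suc (Suc k')) = c k'" by (simp add: c_def)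
    then show ?case using Suc.IH[of k'] Suc.prems down[of k' a] k' by simp
  qed simp
  have par: "c (k + i) = (if even i then c k else c (Suc k))" for k i by (auto simp: c_def)
  have "alt_apply f (c p) (c (Suc p)) ((m - 1 - p) + Suc p) (vertex c w p, a) =
      alt_apply f (c (m - 1)) (c (Suc (m - 1))) (Suc p) (vertex c w (m - 1), a)"
    using ups[of p "m - 1 - p" a] p par[of p "m - 1 - p"] par[of "Suc p" "m - 1 - p"]
    by (simp only: alt_apply_add) (auto simp: c_def)
  also have "\<dots> = alt_apply f (c (Suc (m - 1))) (c (m - 1)) p (vertex c w (m - 1), \<gamma> x * a)"
    by (simp only: alt_apply.simps top)
  also have "\<dots> = (vertex c w (m - 1 - p), \<gamma> x * a)" using downs[of "m - 1" p] p by simp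
  finally show "alt_apply f (c p) (c (Suc p)) m (vertex c w p, a) =
      (vertex c w (m - 1 - p), \<gamma> x * a)"
    using p by simp
  have "alt_apply f (c (Suc p)) (c p) (p + Suc (m - 1 - p)) (vertex c w p, a) =
      alt_apply f (c (Suc 0)) (c 0) (Suc (m - 1 - p)) (w, a)"
    using downs[of p p a] p by (simp only: alt_apply_add) (auto simp: c_def)
  also have "\<dots> = alt_apply f (c 0) (c (Suc 0)) (m - 1 - p) (vertex c w 0, \<gamma> x * a)"
    by (simp only: alt_apply.simps bottom vertex_0)
  also have "\<dots> = (vertex c w (m - 1 - p), \<gamma> x * a)" using ups[of 0 "m - 1 - p"] p by simp
  finally show "alt_apply f (c (Suc p)) (c p) m (vertex c w p, a) =
      (vertex c w (m - 1 - p), \<gamma> x * a)"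
    using p by simp
qed

text \<open>Without loops at the bottom the climb succeeds along both sides up to the top of the
  polygon, so neither alternating word records a letter.\<close>

lemma braid_no_loop:
  assumes lab: "label \<Gamma> {s, t} = Some m" and w: "dihedral_minimal s t w" "minimal w"
    and loop: "\<not> loops t w" "\<not> loops s w" and d: "d \<in> generated_by \<sigma> {s, t}"
  shows "minimal (d * w)"
proof -
  have V: "s \<in> V" "t \<in> V" "s \<noteq> t" "m \<ge> 2" using defining_graph_label[OF graph lab] by auto
  have min: "minimal (vertex (\<lambda>i. if even i then t else s) w k)"
    if "k \<le> m" "label \<Gamma> {s, t} = Some m" "dihedral_minimal s t w" "\<not> loops t w" "\<not> loops s w"
        for s t k
    using that(1)
  proof (induction k)
    case (Suc k)
    then show ?case using vertex_minimal_Suc[OF that(2,3) w(2) that(4), of k] that(5) by simp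
  qed (use w in simp)
  obtain k where k: "within_order s t k" "d = alt_elt s t k \<or> d = alt_elt t s k"
    using dihedral_elements[OF d V(1,2)] by blast
  then have km: "k \<le> m" using lab by (simp add: within_order_def)
  have "minimal (alt_elt s t k * w)" "minimal (alt_elt t s k * w)"
    using min[OF km lab w(1) loop] min[OF km _ _ loop(2,1)] lab w(1) dihedral_minimal_commute[of s t
        w]
    unfolding vertex_alt by (auto simp: insert_commute split: if_splits)
  then show ?thesis using k(2) by blast
qed

text \<open>Conjugation by \<open>w\<close> carries \<open>s\<close> and \<open>t\<close> to
  \<open>x\<close> and \<open>y\<close>, so both pairs satisfy the same braid equalities. By
  \<open>order_dvd\<close> in both directions the label of \<open>x\<close> and \<open>y\<close> is
  again \<open>m\<close>, which makes the Artin relation for this pair available.\<close>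

lemma braid_two_loops:
  assumes lab: "label \<Gamma> {s, t} = Some m" and w: "minimal w"
    and loop: "x \<in> X" "\<sigma> s * w = w * \<sigma> x" "y \<in> X" "\<sigma> t * w = w * \<sigma> y"
  shows "alt_prod (\<gamma> x) (\<gamma> y) m = alt_prod (\<gamma> y) (\<gamma> x) m"
proof -
  have V: "s \<in> V" "t \<in> V" "s \<noteq> t" "m \<ge> 2" using defining_graph_label[OF graph lab] by auto
  have xyV: "x \<in> V" "y \<in> V" using loop X_subset by auto
  have conj: "alt_elt s t k * w = w * alt_elt x y k" "alt_elt t s k * w = w * alt_elt y x k" for k
    by (induction k) (simp_all add: mult.assoc, simp_all add: loop(2,4) mult.assoc[symmetric])
  have iff: "alt_elt s t k = alt_elt t s k \<longleftrightarrow> alt_elt x y k = alt_elt y x k" for k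
    using conj[of k] by (metis gmult_left_cancel gmult_right_cancel)
  have xy: "x \<noteq> y"
  proof
    assume "x = y"
    then have "\<sigma> s * w = \<sigma> t * w" using loop by simp
    then show False using generator_inj V by simp
  qed
  have "alt_elt x y m = alt_elt y x m" using iff braid_relation[OF lab] by blast
  then obtain m' where m': "label \<Gamma> {x, y} = Some m'" "m' dvd m"
    using order_dvd[OF xyV xy] V(4) by (metis zero_less_numeral less_le_trans)
  have "alt_elt s t m' = alt_elt t s m'" using iff braid_relation[OF m'(1)] by blast
  moreover have "m' > 0" using defining_graph_label[OF graph m'(1)] by simp
  ultimately have "m dvd m'" using order_dvd[OF V(1-3)] lab by (metis option.inject)
  then have "label \<Gamma> {x, y} = Some m" using m' dvd_antisym by metis
  then have "(alternating x y m, alternating y x m) \<in> artin_relations \<Gamma>"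
    by (auto simp: artin_relations_def)
  from relations[unfolded satisfies_relations_def, rule_format, OF this]
  have "word_val \<gamma> (alternating x y m) = word_val \<gamma> (alternating y x m)" using xyV by simp
  then show ?thesis by simp
qed

text \<open>The two sides of a braid relation move within one dihedral coset, and everything depends
  on which of \<open>s\<close> and \<open>t\<close> make a loop at its shortest element
  \<open>w\<close>: neither, one or both.\<close>

lemma move_satisfies: "satisfies_relations V (artin_relations \<Gamma>) move_perm"
  unfolding satisfies_relations_def
proof (intro allI impI)
  fix u v assume "(u, v) \<in> artin_relations \<Gamma>"
  then obtain s t m where uv: "u = alternating s t m" "v = alternating t s m"
      and lab: "label \<Gamma> {s, t} = Some m"
    by (auto simp: artin_relations_def)
  have V: "s \<in> V" "t \<in> V" "s \<noteq> t" "m \<ge> 2" using defining_graph_label[OF graph lab] by auto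
  let ?f = "\<lambda>s. perm_apply (move_perm s)"
  have on: "perm_apply (alt_prod (move_perm s) (move_perm t) m) (u, a) =
      perm_apply (alt_prod (move_perm t) (move_perm s) m) (u, a)" if u: "minimal u" for u a
  proof -
    have uW: "u \<in> W" using u by (simp add: minimal_def)
    obtain d w where d: "d \<in> generated_by \<sigma> {s, t}" "u = d * w" "dihedral_minimal s t w"
      using dihedral_minimal_exists[OF V(1,2) uW] .
    then have wW: "w \<in> W" by (simp add: dihedral_minimal_def)
    have d3': "dihedral_minimal t s w" using d(3) dihedral_minimal_commute by blast
    obtain k where k: "within_order s t k" "d = alt_elt s t k \<or> d = alt_elt t s k"
      using dihedral_elements[OF d(1) V(1,2)] by blast
    have k': "within_order t s k" using k(1) within_order_commute by blast
    have km: "k \<le> m" using k(1) lab by (simp add: within_order_def)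
    have lu: "len u = k + len w"
      using k(2) d(2) len_alt_elt_mult[OF V(1-3) k(1) d(3)] len_alt_elt_mult[OF V(2,1) not_sym[OF
          V(3)] k' d3']
      by auto
    \<comment> \<open>Lengths add in \<open>u = d * w\<close>, so a letter of \<open>X\<close> that
      does not lengthen \<open>w\<close> would not lengthen \<open>u\<close> either.\<close>
    have w: "minimal w"
      unfolding minimal_def
    proof (intro conjI ballI wW)
      fix x assume x: "x \<in> X"
      have xV: "x \<in> V" using x X_subset by blast
      have dW: "d \<in> W" using d(1) V dihedral_subset_W by blast
      have "len d \<le> k"
        using k(2) len_le_length[of "alt_list s t k"] len_le_length[of "alt_list t s k"]
          set_alt_list[of s t k] set_alt_list[of t s k] V by auto
      then have "len (u * \<sigma> x) \<le> k + len (w * \<sigma> x)"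
        using len_mult_le[OF dW, of "w * \<sigma> x"] wW xV d(2) by (simp add: mult.assoc)
      moreover have "len u < len (u * \<sigma> x)" using u x by (simp add: minimal_def)
      ultimately show "len w < len (w * \<sigma> x)" using lu by simp
    qed
    have lab': "label \<Gamma> {t, s} = Some m" using lab by (simp add: insert_commute)
    have uv: "u = vertex (\<lambda>i. if even i then t else s) w k \<or> u =
        vertex (\<lambda>i. if even i then s else t) w k"
      unfolding vertex_alt using k(2) d(2) by (cases "even k") auto
    have path: "?thesis"
      if lab: "label \<Gamma> {s', t'} = Some m" and st': "s' = s \<and> t' = t \<or> s' = t \<and> t' = s"
        and w': "dihedral_minimal s' t' w" and loop: "loops s' w" "\<not> loops t' w"
        and uv: "u = vertex (\<lambda>i. if even i then t' else s') w k \<or> u =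
            vertex (\<lambda>i. if even i then s' else t') w k"
      for s' t'
    proof -
      have V': "s' \<in> V" "t' \<in> V" "s' \<noteq> t'" using V st' by auto
      \<comment> \<open>A path whose first letter loops at the bottom leaves the minimal elements,
        so the minimal element \<open>u\<close> lies on the other side of the polygon.\<close>
      have no: "j = 0" if "u = vertex (\<lambda>i. if even i then s' else t') w j" "j \<le> m" for j
      proof (rule ccontr)
        assume "j \<noteq> 0"
        then obtain i where i: "j = Suc i" by (cases j) auto
        have "within_order t' s' (Suc i)" using that(2) i lab
          by (simp add: within_order_def insert_commute)
        moreover have "dihedral_minimal t' s' w" using w' dihedral_minimal_commute by blast
        ultimately have "\<not> loops s' w"
          using vertex_minimal_no_loop[OF V'(2,1) not_sym[OF V'(3)], of w i] u that(1) i by simp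
        then show False using loop by simp
      qed
      let ?c = "\<lambda>i::nat. if even i then t' else s'"
      have uk: "u = vertex ?c w k" using uv no[of k] km by (cases "k = 0") auto
      have "k \<noteq> m"
      proof
        assume "k = m"
        then have "u = vertex (\<lambda>i. if even i then s' else t') w m"
          using uk vertex_commute_alt[OF lab] by simp
        then show False using no[of m] V(4) by simp
      qed
      then have "k < m" using km by simp
      moreover obtain x where "x \<in> X" "\<sigma> s' * w = w * \<sigma> x" using loop by (auto simp: loops_def)
      ultimately have "alt_apply ?f s' t' m (u, a) = alt_apply ?f t' s' m (u, a)"
        using braid_one_loop[OF lab w' w loop(2), of x k a] uk by (cases "even k") simp_all
      then have "alt_apply ?f s t m (u, a) = alt_apply ?f t s m (u, a)" using st' by auto
      then show ?thesis
        using perm_apply_alternating[of move_perm ?f s t m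
            "(u, a)"] perm_apply_alternating[of move_perm ?f t s m "(u, a)"]
        by simp
    qed
    consider "loops s w" "loops t w" | "\<not> loops s w" "\<not> loops t w"
      | "loops s w" "\<not> loops t w" | "loops t w" "\<not> loops s w" by blast
    then show ?thesis
    proof cases
      case 1
      then obtain x y where xy: "x \<in> X" "\<sigma> s * w = w * \<sigma> x" "y \<in> X" "\<sigma> t * w = w * \<sigma> y"
        by (auto simp: loops_def)
      have "k = 0"
      proof (rule ccontr)
        assume "k \<noteq> 0"
        then obtain i where i: "k = Suc i" by (cases k) auto
        show False
          using uv vertex_minimal_no_loop[OF V(1-3) d(3), of i] 1
            vertex_minimal_no_loop[OF V(2,1) not_sym[OF V(3)] d3', of i] u k(1) k' i by auto
      qed
      then have uw: "u = w" using uv by auto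
      have f: "perm_apply (move_perm s) (w, a) = (w, \<gamma> x * a)"
          "perm_apply (move_perm t) (w, a) = (w, \<gamma> y * a)" for a
        using perm_apply_move_perm_state[OF _ w] V move_loop[OF w V(1) xy(1,2)] move_loop[OF w V(2)
            xy(3,4)] by simp_all
      have "perm_apply (alt_prod (move_perm s) (move_perm t) j) (w, a) =
          (w, alt_prod (\<gamma> x) (\<gamma> y) j * a)"
        "perm_apply (alt_prod (move_perm t) (move_perm s) j) (w, a) =
            (w, alt_prod (\<gamma> y) (\<gamma> x) j * a)" for j
        by (induction j) (simp_all add: f mult.assoc)
      then show ?thesis using braid_two_loops[OF lab w xy] uw by simp
    next
      case 2
      have min: "minimal (g * u)" if "g \<in> generated_by \<sigma> {s, t}" for g
        using braid_no_loop[OF lab d(3) w 2(2,1), of "g * d"] that d by (simp add: mult.assoc)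
      have f: "perm_apply (move_perm s') (g * u, a) = (\<sigma> s' * g * u, a)"
        if "g \<in> generated_by \<sigma> {s, t}" "s' \<in> {s, t}" for g s'
      proof -
        have "minimal (\<sigma> s' * g * u)" using min[of "\<sigma> s' * g"] that by simp
        then show ?thesis
          using perm_apply_move_perm_state[of s'
              "g * u" a] min[OF that(1)] that(2) V move_minimal[of s' "g * u" a]
          by (auto simp: mult.assoc)
      qed
      have "perm_apply (alt_prod (move_perm s) (move_perm t) j) (u, a) = (alt_elt s t j * u, a) \<and>
        perm_apply (alt_prod (move_perm t) (move_perm s) j) (u, a) = (alt_elt t s j * u, a)" for j
        by (induction j) (simp_all add: f alt_elt_generated alt_elt_generated')
      then show ?thesis using braid_relation[OF lab] by simp
    next
      case 3
      then show ?thesis using path[OF lab _ d(3)] uv by blast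
    next
      case 4
      then show ?thesis using path[OF lab' _ d3'] uv by blast
    qed
  qed
  have off: "perm_apply (alt_prod (move_perm s) (move_perm t) k) p = p"
      if "s \<in> V" "t \<in> V" "p \<notin> states" for s t k p
    using that by (induction k arbitrary: s t) (simp_all add: perm_apply_move_perm)
  show "word_val move_perm u = word_val move_perm v"
    unfolding uv word_val_alternating
  proof (rule perm_eqI)
    fix p
    show "perm_apply (alt_prod (move_perm s) (move_perm t) m) p =
        perm_apply (alt_prod (move_perm t) (move_perm s) m) p"
    proof (cases "p \<in> states")
      case True
      then obtain u a where "p = (u, a)" "minimal u" by (auto simp: states_def)
      then show ?thesis using on by simp
    qed (simp add: off V)
  qed
qed

section \<open>The retraction and its values on special subgroups\<close>

lemma perm_apply_ginv_move_perm:
  assumes s: "s \<in> V" and u: "minimal u"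
  shows "perm_apply (ginv (move_perm s)) (u, a) = move_back s (u, a)"
proof -
  have "perm_apply (move_perm s) (move_back s (u, a)) = (u, a)"
    using s u by (auto simp: perm_apply_move_perm states_def move_def move_back_def
        mult.assoc[symmetric])
  then show ?thesis by (metis left_ginv perm_apply_mult perm_apply_one)
qed

lemma minimal_one [simp]: "minimal 1"
  using X_subset by (auto simp: minimal_def len_def)

lemma partner_exists:
  assumes "minimal u" "s \<in> V" "\<not> minimal (\<sigma> s * u)"
  shows "partner s u \<in> X" "\<sigma> s * u = u * \<sigma> (partner s u)"
  using minimal_step[OF assms(1,2)] assms(3) partner_eq by auto

text \<open>At the trivial coset every letter of \<open>X\<close> is a loop and its own partner, so
  the record spells out the word.\<close>

lemma retraction_X:
  "w \<in> words X \<Longrightarrow> perm_apply (word_val move_perm w) (1, a) = (1, word_val \<gamma> w * a)"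
proof (induction w)
  case (Cons l w)
  obtain s b where l: "l = (s, b)" by fastforce
  have s: "s \<in> X" "s \<in> V" using Cons.prems l X_subset by auto
  have p: "\<not> minimal (\<sigma> s * 1)" "partner s 1 = s"
    using minimal_step_exclusive[OF minimal_one s(2,1)] partner_eq[OF s(1), of s 1] by auto
  have "perm_apply (letter_val move_perm l) (1, c) = (1, letter_val \<gamma> l * c)" for c
    using s p by (cases b)
      (simp_all add: l perm_apply_move_perm_state perm_apply_ginv_move_perm move_def move_back_def)
  then show ?case using Cons by (simp add: mult.assoc)
qed simp

text \<open>The coset representative never leaves the parabolic subgroup of \<open>Y\<close>. A loop
  partner is a conjugate of a letter of \<open>Y\<close> by such an element, hence a generator in
  that subgroup, hence a letter of \<open>Y\<close>.\<close>

lemma retraction_Y: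
  assumes Y: "Y \<subseteq> V"
  shows "w \<in> words Y \<Longrightarrow> perm_apply (word_val move_perm w) (1, 1) \<in>
    {(u, a). minimal u \<and> u \<in> generated_by \<sigma> Y \<and> a \<in> generated_by \<gamma> (X \<inter> Y)}"
proof (induction w)
  case (Cons l w)
  obtain s b where l: "l = (s, b)" by fastforce
  have s: "s \<in> Y" "s \<in> V" using Cons.prems l Y by auto
  obtain u a where u: "perm_apply (word_val move_perm w) (1, 1) = (u, a)" "minimal u"
    "u \<in> generated_by \<sigma> Y" "a \<in> generated_by \<gamma> (X \<inter> Y)"
    using Cons by auto
  have p: "partner s u \<in> X \<inter> Y" if "\<not> minimal (\<sigma> s * u)"
  proof -
    note q = partner_exists[OF u(2) s(2) that]
    have "\<sigma> (partner s u) = ginv u * (\<sigma> s * u)" unfolding q(2) by simp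
    then have "\<sigma> (partner s u) \<in> generated_by \<sigma> Y" using u(3) s(1) by simp
    then show ?thesis using generator_in_parabolic[OF Y] q(1) X_subset by blast
  qed
  show ?case
    using u s p by (cases b)
      (auto simp: l perm_apply_move_perm_state perm_apply_ginv_move_perm move_def move_back_def)
qed simp

end

text \<open>Two words for the same element act by the same permutation. Read along the word over
  \<open>X\<close>, it sends (1, 1) to (1, g); read along the word over \<open>Y\<close>, it leaves
  a record over the intersection.\<close>

theorem special_subgroup_inter:
  assumes graph: "defining_graph \<Gamma>" and pres: "presentation (vertices \<Gamma>) (artin_relations \<Gamma>) \<gamma>"
    and XY: "X \<subseteq> vertices \<Gamma>" "Y \<subseteq> vertices \<Gamma>"
  shows "generated_by \<gamma> X \<inter> generated_by \<gamma> Y \<subseteq> generated_by \<gamma> (X \<inter> Y)"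
proof
  fix g assume "g \<in> generated_by \<gamma> X \<inter> generated_by \<gamma> Y"
  then obtain u v where uv: "u \<in> words X" "v \<in> words Y" "g = word_val \<gamma> u" "g = word_val \<gamma> v"
    by (auto simp: generated_by_def)
  interpret A: presentation "vertices \<Gamma>" "artin_relations \<Gamma>" \<gamma> by (rule pres)
  interpret W: presentation "vertices \<Gamma>" "coxeter_relations \<Gamma>"
      "regular_gen (vertices \<Gamma>) (coxeter_relations \<Gamma>)"
    by (rule presentation_regular_gen)
  interpret coset_action \<Gamma> "regular_gen (vertices \<Gamma>) (coxeter_relations \<Gamma>)" \<gamma> X
    by standard (rule graph XY(1) A.satisfies)+
  have "u \<in> words (vertices \<Gamma>)" "v \<in> words (vertices \<Gamma>)"
    using uv(1,2) words_mono[OF XY(1)] words_mono[OF XY(2)] by auto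
  then have "word_val move_perm u = word_val move_perm v"
    using A.word_val_transfer[OF move_satisfies _ _ HOL.trans[OF uv(3)[symmetric] uv(4)]] by blast
  then show "g \<in> generated_by \<gamma> (X \<inter> Y)"
    using retraction_X[OF uv(1), of 1] retraction_Y[OF XY(2) uv(2)] uv(3) by simp
qed

section \<open>The center lies in the subgroup generated by the cone points\<close>

lemma central_in_cone_subgroup:
  assumes graph: "defining_graph \<Gamma>" and pres: "presentation (vertices \<Gamma>) (artin_relations \<Gamma>) \<gamma>"
    and z: "z \<in> generated_by \<gamma> (vertices \<Gamma>)" "\<And>x. x \<in> generated_by \<gamma> (vertices \<Gamma>) \<Longrightarrow> z * x = x * z"
  shows "z \<in> generated_by \<gamma> (cone_points \<Gamma>)"
proof -
  let ?V = "vertices \<Gamma>"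
  interpret presentation ?V "artin_relations \<Gamma>" \<gamma> by (rule pres)
  have one: "z \<in> generated_by \<gamma> (?V - {s})" if s: "s \<in> ?V" "s \<notin> cone_points \<Gamma>" for s
  proof -
    obtain t where t: "t \<in> ?V" "t \<noteq> s" "label \<Gamma> {s, t} = None"
      using s by (auto simp: cone_points_def adjacent_def)
    have not: "\<gamma> u \<notin> generated_by \<gamma> (?V - {s, t})" if "u \<in> {s, t}" for u
      by (rule burau_not_generated[OF pres artin_burau_relations[OF graph]]) (use that s t in auto)
    have "z \<in> generated_by \<gamma> (?V - {s, t})"
    proof (rule central_subset_amalgam[OF s(1) t(1) not_sym[OF t(2)] _ not not z])
      fix u v assume "(u, v) \<in> artin_relations \<Gamma>"
      then obtain a b m where uv: "u = alternating a b m" "v = alternating b a m"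
          "label \<Gamma> {a, b} = Some m"
        by (auto simp: artin_relations_def)
      have "a \<in> ?V" "b \<in> ?V" "a \<noteq> b" using defining_graph_label[OF graph uv(3)] by auto
      moreover have "{a, b} \<noteq> {s, t}" using uv(3) t(3) by auto
      ultimately consider "a \<in> ?V - {s}" "b \<in> ?V - {s}" | "a \<in> ?V - {t}" "b \<in> ?V - {t}"
        using t(2) by (auto simp: doubleton_eq_iff)
      then show "u \<in> words (?V - {s}) \<and> v \<in> words (?V - {s}) \<or>
          u \<in> words (?V - {t}) \<and> v \<in> words (?V - {t})"
        unfolding uv using alternating_words by metis
    qed auto
    moreover have "?V - {s, t} \<subseteq> ?V - {s}" by blast
    ultimately show ?thesis using generated_by_mono by blast
  qed
  \<comment> \<open>Each amalgam removes one non-cone vertex; the removals for different vertices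
    are combined by \<open>special_subgroup_inter\<close>.\<close>
  have "z \<in> generated_by \<gamma> (?V - F)" if "finite F" "F \<subseteq> ?V - cone_points \<Gamma>" for F
    using that
  proof (induction F)
    case (insert s F)
    then have "z \<in> generated_by \<gamma> (?V - F) \<inter> generated_by \<gamma> (?V - {s})" using one by auto
    then have "z \<in> generated_by \<gamma> ((?V - F) \<inter> (?V - {s}))"
      using special_subgroup_inter[OF graph pres, of "?V - F" "?V - {s}"] by blast
    moreover have "(?V - F) \<inter> (?V - {s}) = ?V - insert s F" by blast
    ultimately show ?case by simp
  qed (use z in simp)
  from this[of "?V - cone_points \<Gamma>"] have "z \<in> generated_by \<gamma> (?V - (?V - cone_points \<Gamma>))"
    using graph by (auto simp: defining_graph_def)
  moreover have "?V - (?V - cone_points \<Gamma>) = cone_points \<Gamma>" by (auto simp: cone_points_def)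
  ultimately show ?thesis by simp
qed

section \<open>Eigenvalues of commuting elements in the Burau representation\<close>

definition basis_vec :: "'a \<Rightarrow> 'a \<Rightarrow> real" where
  "basis_vec u = (\<lambda>x. if x = u then 1 else 0)"

text \<open>Full real linearity, with scaling and addition in a single equation.\<close>

definition additive_map :: "(('a \<Rightarrow> real) \<Rightarrow> 'a \<Rightarrow> real) \<Rightarrow> bool" where
  "additive_map f \<longleftrightarrow> (\<forall>a v w. f (\<lambda>x. a * v x + w x) = (\<lambda>x. a * f v x + f w x))"

lemma additive_mapD:
  "additive_map f \<Longrightarrow> f (\<lambda>x. a * v x + w x) = (\<lambda>x. a * f v x + f w x)"
  by (simp add: additive_map_def)

lemma additive_map_zero: "additive_map f \<Longrightarrow> f (\<lambda>_. 0) = (\<lambda>_. 0)"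
  using additive_mapD[of f 1 "\<lambda>_. 0" "\<lambda>_. 0"] by (simp add: fun_eq_iff)

lemma perm_apply_ginv_fixed: "perm_apply p v = v \<Longrightarrow> perm_apply (ginv p) v = v"
  by (metis left_ginv perm_apply_mult perm_apply_one)

lemma additive_map_burau: "additive_map (burau c V r s)"
proof -
  have "burau_coord c V r s (\<lambda>x. a * v x + w x) = a * burau_coord c V r s v + burau_coord c V r s w"
      for a v w
    by (simp add: burau_coord_def sum.distrib sum_distrib_left algebra_simps)
  then show ?thesis by (auto simp: additive_map_def burau_def algebra_simps)
qed

lemma additive_map_inverse:
  assumes "additive_map (perm_apply p)"
  shows "additive_map (perm_apply (ginv p))"
  unfolding additive_map_def
proof (intro allI)
  fix a :: real and v w
  have inv: "perm_apply p (perm_apply (ginv p) v) = v" for v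
    by (metis perm_apply_mult perm_apply_one right_ginv)
  have "perm_apply p (\<lambda>x. a * perm_apply (ginv p) v x + perm_apply (ginv p) w x) =
      (\<lambda>x. a * v x + w x)"
    using assms inv unfolding additive_map_def by metis
  then show "perm_apply (ginv p) (\<lambda>x. a * v x + w x) =
      (\<lambda>x. a * perm_apply (ginv p) v x + perm_apply (ginv p) w x)"
    by (metis left_ginv perm_apply_mult perm_apply_one)
qed

lemma additive_map_generated:
  assumes "g \<in> generated_by (artin_burau \<Gamma> r) K" "r \<noteq> 0"
  shows "additive_map (perm_apply g)"
  using assms(1)
proof (induction rule: generated_by_induct)
  case (mult s b x)
  have "additive_map (perm_apply (artin_burau \<Gamma> r s))" using additive_map_burau assms(2) by simp
  then have "additive_map (perm_apply (letter_val (artin_burau \<Gamma> r) (s, b)))"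
    by (cases b) (simp_all add: additive_map_inverse)
  then show ?case using mult.IH by (simp add: additive_map_def)
qed (simp add: additive_map_def)

lemma burau_basis_vec:
  "burau c V r s (basis_vec u) =
      (\<lambda>x. - burau_coord c V r s (basis_vec u) * basis_vec s x + basis_vec u x)"
  by (auto simp: burau_def basis_vec_def)

lemma burau_coord_basis_vec_same: "burau_coord c V r s (basis_vec s) = 1 + r\<^sup>2"
proof -
  have "(\<Sum>u \<in> V - {s}. c s u * basis_vec s u) = 0" by (rule sum.neutral) (auto simp: basis_vec_def)
  then show ?thesis by (simp add: burau_coord_def basis_vec_def)
qed

lemma burau_coord_basis_vec_other:
  assumes "finite V" "u \<in> V" "u \<noteq> s"
  shows "burau_coord c V r s (basis_vec u) = - 2 * r * c s u"
proof -
  have "(\<Sum>w \<in> V - {s}. c s w * basis_vec u w) = (\<Sum>w \<in> V - {s}. if w = u then c s u else 0)"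
    by (rule sum.cong) (auto simp: basis_vec_def)
  also have "\<dots> = c s u" using assms by simp
  finally show ?thesis using assms(3) by (simp add: burau_coord_def basis_vec_def)
qed

definition eigenvalue :: "('a \<Rightarrow> real) perm \<Rightarrow> 'a \<Rightarrow> real" where
  "eigenvalue z u = perm_apply z (basis_vec u) u"

context
  fixes \<Gamma> :: "'a labelled_graph" and r :: real
  assumes graph: "defining_graph \<Gamma>" and r: "r > 0"
begin

text \<open>The basis vector of \<open>u\<close> spans the eigenspace of its operator for
  \<open>- r^2\<close>, because the other eigenvalue 1 differs from it. An operator commuting with
  this one preserves the line.\<close>

lemma eigenvector:
  assumes "additive_map (perm_apply z)" "z * artin_burau \<Gamma> r u = artin_burau \<Gamma> r u * z"
  shows "perm_apply z (basis_vec u) = (\<lambda>x. eigenvalue z u * basis_vec u x)"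
proof -
  let ?b = "burau (cosine \<Gamma>) (vertices \<Gamma>) r u" and ?c = "burau_coord (cosine \<Gamma>) (vertices \<Gamma>) r u"
  define v where "v = perm_apply z (basis_vec u)"
  have zero: "perm_apply z (\<lambda>_. 0) = (\<lambda>_. 0)" by (rule additive_map_zero[OF assms(1)])
  have "?b (basis_vec u) = (\<lambda>x. - r\<^sup>2 * basis_vec u x + 0)"
    unfolding burau_basis_vec burau_coord_basis_vec_same by (simp add: algebra_simps)
  then have "perm_apply z (?b (basis_vec u)) = (\<lambda>x. - r\<^sup>2 * v x)"
    using additive_mapD[OF assms(1), of "- r\<^sup>2" "basis_vec u" "\<lambda>_. 0"] zero by (simp add: v_def)
  moreover have "perm_apply z (?b (basis_vec u)) = ?b v"
    using arg_cong[OF assms(2), of "\<lambda>p. perm_apply p (basis_vec u)"] r by (simp add: v_def)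
  ultimately have eq: "?b v x = - r\<^sup>2 * v x" for x by simp
  have "v x = 0" if "x \<noteq> u" for x
  proof -
    have "(1 + r\<^sup>2) * v x = 0" using eq[of x] that by (simp add: burau_def algebra_simps)
    moreover have "1 + r\<^sup>2 \<noteq> 0" using zero_le_power2[of r] by linarith
    ultimately show ?thesis by simp
  qed
  then show ?thesis by (auto simp: eigenvalue_def basis_vec_def fun_eq_iff v_def)
qed

lemma eigenvalue_mult:
  assumes "additive_map (perm_apply y)" "additive_map (perm_apply z)"
    "y * artin_burau \<Gamma> r u = artin_burau \<Gamma> r u * y" "z * artin_burau \<Gamma> r u = artin_burau \<Gamma> r u * z"
  shows "eigenvalue (y * z) u = eigenvalue y u * eigenvalue z u"
proof -
  have zero: "perm_apply y (\<lambda>_. 0) = (\<lambda>_. 0)" by (rule additive_map_zero[OF assms(1)])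
  have "perm_apply y (\<lambda>x. eigenvalue z u * basis_vec u x + 0) =
      (\<lambda>x. eigenvalue z u * perm_apply y (basis_vec u) x + 0)"
    using additive_mapD[OF assms(1), of "eigenvalue z u" "basis_vec u" "\<lambda>_. 0"] zero by simp
  then have "perm_apply (y * z) (basis_vec u) u = eigenvalue z u * perm_apply y (basis_vec u) u"
    by (simp only: perm_apply_mult eigenvector[OF assms(2,4)]) simp
  then show ?thesis unfolding eigenvalue_def[of "y * z"] eigenvalue_def[of y]
    by (simp only: mult.commute)
qed

lemma eigenvalue_outside:
  assumes "z \<in> generated_by (artin_burau \<Gamma> r) K" "s \<notin> K"
  shows "eigenvalue z s = 1"
  using burau_fixes_coordinate[OF assms(1) _ assms(2)] r by (simp add: eigenvalue_def basis_vec_def)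

text \<open>The operator of \<open>s\<close> adds to the basis vector of \<open>u\<close> a multiple
  of that of \<open>s\<close>, with a nonzero coefficient: the cosine is positive for labels from 3
  on and for a missing edge. Comparing the coordinate at \<open>s\<close> before and after commuting
  equates the scalars.\<close>

lemma eigenvalue_joined:
  assumes z: "additive_map (perm_apply z)"
    "z * artin_burau \<Gamma> r u = artin_burau \<Gamma> r u * z" "z * artin_burau \<Gamma> r s = artin_burau \<Gamma> r s * z"
    and us: "u \<in> vertices \<Gamma>" "s \<in> vertices \<Gamma>" "u \<noteq> s" "label \<Gamma> {s, u} \<noteq> Some 2"
  shows "eigenvalue z u = eigenvalue z s"
proof -
  let ?\<beta> = "burau_coord (cosine \<Gamma>) (vertices \<Gamma>) r s (basis_vec u)"
  have "cosine \<Gamma> s u > 0"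
  proof (cases "label \<Gamma> {s, u}")
    case (Some m)
    then have "m \<ge> 3" using defining_graph_label[OF graph Some] us(4) by (cases "m = 2") auto
    then have "pi / real m \<le> pi / 3" by (intro divide_left_mono) auto
    then have "pi / real m < pi / 2" using pi_gt_zero by linarith
    then have "cos (pi / real m) > 0" using \<open>m \<ge> 3\<close> by (intro cos_gt_zero) auto
    then show ?thesis by (simp add: cosine_def Some)
  qed (simp add: cosine_def)
  then have \<beta>: "?\<beta> \<noteq> 0"
    using burau_coord_basis_vec_other[of "vertices \<Gamma>" u s "cosine \<Gamma>" r] us graph r
      by (simp add: defining_graph_def)
  have "perm_apply z (burau (cosine \<Gamma>) (vertices \<Gamma>) r s (basis_vec u)) s =
      - ?\<beta> * perm_apply z (basis_vec s) s + perm_apply z (basis_vec u) s"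
    unfolding burau_basis_vec additive_mapD[OF z(1)] ..
  also have "\<dots> = - ?\<beta> * eigenvalue z s"
    unfolding eigenvector[OF z(1,2)] using us(3) by (simp add: eigenvalue_def basis_vec_def)
  finally have 1: "perm_apply z (burau (cosine \<Gamma>) (vertices \<Gamma>) r s (basis_vec u)) s =
      - ?\<beta> * eigenvalue z s" .
  have "perm_apply z (burau (cosine \<Gamma>) (vertices \<Gamma>) r s (basis_vec u)) =
      burau (cosine \<Gamma>) (vertices \<Gamma>) r s (perm_apply z (basis_vec u))"
    using arg_cong[OF z(3), of "\<lambda>p. perm_apply p (basis_vec u)"] r by simp
  also have "\<dots> = burau (cosine \<Gamma>) (vertices \<Gamma>) r s (\<lambda>x. eigenvalue z u * basis_vec u x)"
    unfolding eigenvector[OF z(1,2)] ..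
  finally have 2: "perm_apply z (burau (cosine \<Gamma>) (vertices \<Gamma>) r s (basis_vec u)) =
      burau (cosine \<Gamma>) (vertices \<Gamma>) r s (\<lambda>x. eigenvalue z u * basis_vec u x)" .
  have 3: "burau (cosine \<Gamma>) (vertices \<Gamma>) r s (\<lambda>x. eigenvalue z u * basis_vec u x) s =
      - eigenvalue z u * ?\<beta>"
  proof -
    have "burau_coord (cosine \<Gamma>) (vertices \<Gamma>) r s (\<lambda>x. eigenvalue z u * basis_vec u x) =
        eigenvalue z u * ?\<beta>"
      by (simp add: burau_coord_def sum_distrib_left algebra_simps)
    then show ?thesis using us(3) by (simp add: burau_def basis_vec_def)
  qed
  have "- ?\<beta> * eigenvalue z s = - eigenvalue z u * ?\<beta>" using 1 3 fun_cong[OF 2, of s] by linarith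
  then show ?thesis using \<beta> by simp
qed

text \<open>Label 2 has cosine 0, so every generator in \<open>K\<close> fixes the basis vector of
  \<open>u\<close>.\<close>

lemma eigenvalue_separated:
  assumes "z \<in> generated_by (artin_burau \<Gamma> r) K" "u \<in> vertices \<Gamma>"
    "\<And>s. s \<in> K \<Longrightarrow> s \<noteq> u \<and> label \<Gamma> {s, u} = Some 2"
  shows "eigenvalue z u = 1"
proof -
  have fix1: "perm_apply (artin_burau \<Gamma> r s) (basis_vec u) = basis_vec u" if s: "s \<in> K" for s
  proof -
    have "burau_coord (cosine \<Gamma>) (vertices \<Gamma>) r s (basis_vec u) = 0"
      using burau_coord_basis_vec_other[of "vertices \<Gamma>" u s "cosine \<Gamma>" r] assms(2,3) s graph
      by (auto simp: defining_graph_def cosine_def)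
    then show ?thesis using r by (simp add: burau_basis_vec)
  qed
  have "perm_apply z (basis_vec u) = basis_vec u" using assms(1)
  proof (induction rule: generated_by_induct)
    case (mult s b x)
    have "perm_apply (letter_val (artin_burau \<Gamma> r) (s, b)) (basis_vec u) = basis_vec u"
      using fix1[OF mult(1)] perm_apply_ginv_fixed by (cases b) (simp_all only: letter_val_simps)
    then show ?case using mult.IH by simp
  qed simp
  then show ?thesis by (simp add: eigenvalue_def basis_vec_def)
qed

end

text \<open>At \<open>r = 0\<close> the operators degenerate to coordinate projections.\<close>

lemma burau_step_tendsto:
  assumes "\<And>t. ((\<lambda>r. w r t) \<longlongrightarrow> L t) (at_right 0)"
  shows "((\<lambda>r. burau c V r s (w r) t) \<longlongrightarrow> (if t = s then 0 else L t)) (at_right 0)"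
proof (cases "t = s")
  case True
  have "((\<lambda>r. w r s - ((1 + r\<^sup>2) * w r s - 2 * r * (\<Sum>u \<in> V - {s}. c s u * w r u))) \<longlongrightarrow>
      L s - ((1 + 0\<^sup>2) * L s - 2 * 0 * (\<Sum>u \<in> V - {s}. c s u * L u))) (at_right 0)"
    by (intro tendsto_intros assms)
  then show ?thesis using True by (simp add: burau_def burau_coord_def)
next
  case False
  then show ?thesis using assms[of t] by (simp add: burau_def)
qed

lemma burau_word_tendsto: "\<exists>L. \<forall>t. ((\<lambda>r. foldr (burau c V r) x v t) \<longlongrightarrow> L t) (at_right 0)"
proof (induction x)
  case Nil
  show ?case by (intro exI[of _ v]) simp
next
  case (Cons s x)
  then obtain L where L: "\<And>t. ((\<lambda>r. foldr (burau c V r) x v t) \<longlongrightarrow> L t) (at_right 0)" by blast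
  show ?case
    using burau_step_tendsto[of "\<lambda>r. foldr (burau c V r) x v", OF L, of c V s]
    by (intro exI[of _ "\<lambda>t. if t = s then 0 else L t"]) simp
qed

text \<open>The first letter of the word acts last, and its limit kills the coordinate of
  \<open>s\<close>; of the remaining letters only convergence is used.\<close>

lemma burau_word_tendsto_zero: "((\<lambda>r. foldr (burau c V r) (s # x) v s) \<longlongrightarrow> 0) (at_right 0)"
proof -
  obtain L where L: "\<And>t. ((\<lambda>r. foldr (burau c V r) x v t) \<longlongrightarrow> L t) (at_right 0)"
    using burau_word_tendsto by blast
  show ?thesis using burau_step_tendsto[of "\<lambda>r. foldr (burau c V r) x v", OF L, of c V s s] by simp
qed

text \<open>The bound 1 is what makes the logarithm of a nonzero scalar negative. As only the first
  letter matters, the lemma applies at every letter with which a central word can be made to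
  start.\<close>

lemma eigenvalue_positive_word_small:
  "eventually (\<lambda>r. \<bar>eigenvalue (word_val (artin_burau \<Gamma> r) (positive_word (u # x))) u\<bar> < 1)
      (at_right 0)"
proof -
  have "perm_apply (word_val (artin_burau \<Gamma> r) (positive_word y)) v =
      foldr (burau (cosine \<Gamma>) (vertices \<Gamma>) r) y v"
    if "r \<noteq> 0" for r y v
    by (induction y) (simp_all add: that)
  then have eq: "eigenvalue (word_val (artin_burau \<Gamma> r) (positive_word (u # x))) u =
      foldr (burau (cosine \<Gamma>) (vertices \<Gamma>) r) (u # x) (basis_vec u) u" if "r > 0" for r
    unfolding eigenvalue_def using that by (metis less_irrefl)
  have "eventually (\<lambda>r. \<bar>foldr (burau (cosine \<Gamma>) (vertices \<Gamma>) r) (u # x) (basis_vec u) u\<bar> < 1)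
      (at_right 0)"
    using tendstoD[OF burau_word_tendsto_zero[of "cosine \<Gamma>" "vertices \<Gamma>" u x "basis_vec u"], of 1]
    by (simp add: dist_real_def)
  moreover have "eventually (\<lambda>r :: real. r > 0) (at_right 0)"
    by (simp add: eventually_at_right_less)
  ultimately show ?thesis by eventually_elim (simp only: eq)
qed

section \<open>Subgroups of lattices\<close>

text \<open>Sequences that vanish from index \<open>k\<close> on: lattices of all ranks are nested
  in one type, which suits inductions on the rank.\<close>

definition lattice_fun :: "nat \<Rightarrow> (nat \<Rightarrow> int) set" where
  "lattice_fun k = {f. \<forall>i \<ge> k. f i = 0}"

definition int_comb :: "'i set \<Rightarrow> ('i \<Rightarrow> int) \<Rightarrow> ('i \<Rightarrow> nat \<Rightarrow> int) \<Rightarrow> nat \<Rightarrow> int" where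
  "int_comb I n v = (\<lambda>j. \<Sum>i \<in> I. n i * v i j)"

definition lattice_subgroup :: "(nat \<Rightarrow> int) set \<Rightarrow> bool" where
  "lattice_subgroup M \<longleftrightarrow> (\<lambda>_. 0) \<in> M \<and> (\<forall>f \<in> M. \<forall>g \<in> M. (\<lambda>j. f j - g j) \<in> M)"

lemma lattice_subgroup_diff:
  "lattice_subgroup M \<Longrightarrow> f \<in> M \<Longrightarrow> g \<in> M \<Longrightarrow> (\<lambda>j. f j - g j) \<in> M"
  by (simp add: lattice_subgroup_def)

lemma lattice_subgroup_add:
  assumes "lattice_subgroup M" "f \<in> M" "g \<in> M"
  shows "(\<lambda>j. f j + g j) \<in> M"
proof -
  have "(\<lambda>j. 0 - g j) \<in> M" using assms unfolding lattice_subgroup_def by fast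
  then have "(\<lambda>j. f j - (0 - g j)) \<in> M" using assms unfolding lattice_subgroup_def by fast
  then show ?thesis by simp
qed

lemma lattice_subgroup_scale:
  assumes "lattice_subgroup M" "f \<in> M"
  shows "(\<lambda>j. c * f j) \<in> M"
proof -
  have nat: "(\<lambda>j. int n * f j) \<in> M" for n
  proof (induction n)
    case (Suc n)
    then show ?case using lattice_subgroup_add[OF assms(1) Suc assms(2)]
      by (simp add: algebra_simps)
  qed (use assms in \<open>simp add: lattice_subgroup_def\<close>)
  show ?thesis
  proof (cases "c \<ge> 0")
    case True
    then show ?thesis using nat[of "nat c"] by simp
  next
    case False
    have "(\<lambda>j. 0 - int (nat (- c)) * f j) \<in> M"
      using assms(1) nat[of "nat (- c)"] unfolding lattice_subgroup_def by fast
    then show ?thesis using False by simp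
  qed
qed

lemma int_comb_mem:
  assumes "lattice_subgroup M" "finite I" "\<And>i. i \<in> I \<Longrightarrow> v i \<in> M"
  shows "int_comb I n v \<in> M"
  using assms(2,3)
proof (induction I)
  case empty
  then show ?case using assms(1) by (simp add: int_comb_def lattice_subgroup_def)
next
  case (insert i I)
  have "int_comb (insert i I) n v = (\<lambda>j. n i * v i j + int_comb I n v j)"
    using insert by (simp add: int_comb_def)
  then show ?case
    using lattice_subgroup_add[OF assms(1) lattice_subgroup_scale[OF assms(1)]] insert by simp
qed

lemma lattice_subgroup_lattice_fun [simp]: "lattice_subgroup (lattice_fun k)"
  by (simp add: lattice_subgroup_def lattice_fun_def)

lemma lattice_fun_SucD:
  assumes "f \<in> lattice_fun (Suc k)" "f k = 0"
  shows "f \<in> lattice_fun k"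
  unfolding lattice_fun_def
proof (intro CollectI allI impI)
  fix i assume "k \<le> i"
  then show "f i = 0" using assms by (cases "i = k") (auto simp: lattice_fun_def)
qed

text \<open>Elements of \<open>M\<close> with last coordinate 0 have a basis by induction. If there
  are others, an element with the smallest positive last coordinate completes it, since division
  with remainder shows that its last coordinate divides all others.\<close>

lemma lattice_subgroup_basis:
  assumes "lattice_subgroup M" "M \<subseteq> lattice_fun k"
  shows "\<exists>r b. (\<forall>i<r. b i \<in> M) \<and> bij_betw (\<lambda>n. int_comb {..<r} n b) (lattice_fun r) M"
  using assms
proof (induction k arbitrary: M)
  case 0
  then have "M = {\<lambda>_. 0}" by (auto simp: lattice_subgroup_def lattice_fun_def)
  then show ?case
    by (intro exI[of _ 0]) (auto simp: bij_betw_def lattice_fun_def int_comb_def inj_on_def)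
next
  case (Suc k)
  define M0 where "M0 = {f \<in> M. f k = 0}"
  have M0: "lattice_subgroup M0" "M0 \<subseteq> lattice_fun k"
  proof -
    show "lattice_subgroup M0" using Suc.prems(1) by (auto simp: M0_def lattice_subgroup_def)
    show "M0 \<subseteq> lattice_fun k"
      using Suc.prems(2) lattice_fun_SucD unfolding M0_def by blast
  qed
  obtain r b where b: "\<And>i. i < r \<Longrightarrow> b i \<in> M0" "bij_betw (\<lambda>n. int_comb {..<r} n b) (lattice_fun r) M0"
    using Suc.IH[OF M0] by blast
  show ?case
  proof (cases "M = M0")
    case True
    then show ?thesis using b by blast
  next
    case False
    then obtain f1 where f1: "f1 \<in> M" "f1 k \<noteq> 0" by (auto simp: M0_def)
    define P where "P n \<longleftrightarrow> n > 0 \<and> (\<exists>f \<in> M. f k = int n)" for n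
    have "\<exists>n. P n"
    proof (cases "f1 k > 0")
      case True
      then show ?thesis using f1 by (intro exI[of _ "nat (f1 k)"]) (auto simp: P_def)
    next
      case neg: False
      have "(\<lambda>j. - 1 * f1 j) \<in> M" by (rule lattice_subgroup_scale[OF Suc.prems(1) f1(1)])
      then show ?thesis using f1 neg by (intro exI[of _ "nat (- f1 k)"]) (auto simp: P_def)
    qed
    define d where "d = (LEAST n. P n)"
    have d: "P d" "\<And>n. P n \<Longrightarrow> d \<le> n" unfolding d_def using \<open>\<exists>n. P n\<close>
      by (auto intro: LeastI_ex Least_le)
    obtain f0 where f0: "f0 \<in> M" "f0 k = int d" "d > 0" using d(1) by (auto simp: P_def)
    have dvd: "f k = (f k div int d) * int d" if f: "f \<in> M" for f
    proof (rule ccontr)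
      assume "f k \<noteq> (f k div int d) * int d"
      then have "f k mod int d \<noteq> 0" by (metis add.right_neutral div_mult_mod_eq)
      moreover have "f k mod int d \<ge> 0" using f0(3) by simp
      ultimately have pos: "f k mod int d > 0" by linarith
      have "(\<lambda>j. f j - (f k div int d) * f0 j) \<in> M"
        by (rule lattice_subgroup_diff[OF Suc.prems(1) f lattice_subgroup_scale[OF Suc.prems(1)
            f0(1)]])
      moreover have "f k - (f k div int d) * f0 k = f k mod int d"
        by (simp add: f0(2) minus_div_mult_eq_mod)
      ultimately have "P (nat (f k mod int d))"
        unfolding P_def using pos by (intro conjI bexI[of _
            "\<lambda>j. f j - (f k div int d) * f0 j"]) auto
      then have "int d \<le> f k mod int d" using d(2) pos by fastforce
      moreover have "f k mod int d < int d" using f0(3) by (intro pos_mod_bound) simp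
      ultimately show False by linarith
    qed
    define b' where "b' = b(r := f0)"
    have comb: "int_comb {..<Suc r} n b' = (\<lambda>j. int_comb {..<r} (n(r := 0)) b j + n r * f0 j)" for n
      unfolding int_comb_def b'_def by (auto simp: fun_eq_iff intro!: sum.cong)
    have b'M: "b' i \<in> M" if "i < Suc r" for i
      using that b(1)[of i] f0(1) by (auto simp: b'_def M0_def less_Suc_eq)
    have comb_k: "int_comb {..<r} n b k = 0" for n
      using int_comb_mem[OF M0(1), of "{..<r}" b n] b(1) by (simp add: M0_def)
    have "bij_betw (\<lambda>n. int_comb {..<Suc r} n b') (lattice_fun (Suc r)) M"
      unfolding bij_betw_def
    proof (intro conjI inj_onI)
      fix n n' assume n: "n \<in> lattice_fun (Suc r)" "n' \<in> lattice_fun (Suc r)"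
        and eq: "int_comb {..<Suc r} n b' = int_comb {..<Suc r} n' b'"
      have "n r * int d = n' r * int d"
        using fun_cong[OF eq, of k] unfolding comb by (simp add: comb_k f0(2))
      then have r: "n r = n' r" using f0(3) by simp
      have "int_comb {..<r} (n(r := 0)) b = int_comb {..<r} (n'(r := 0)) b"
        using eq unfolding comb by (simp add: fun_eq_iff r)
      moreover have "n(r := 0) \<in> lattice_fun r" "n'(r := 0) \<in> lattice_fun r"
        using n by (auto simp: lattice_fun_def)
      ultimately have "n(r := 0) = n'(r := 0)"
        using b(2) unfolding bij_betw_def inj_on_def by blast
      then show "n = n'" using r by (metis fun_upd_triv fun_upd_upd)
    next
      show "(\<lambda>n. int_comb {..<Suc r} n b') ` lattice_fun (Suc r) = M"
      proof (intro equalityI subsetI)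
        fix f assume "f \<in> (\<lambda>n. int_comb {..<Suc r} n b') ` lattice_fun (Suc r)"
        then show "f \<in> M" using int_comb_mem[OF Suc.prems(1)] b'M by auto
      next
        fix f assume f: "f \<in> M"
        let ?q = "f k div int d"
        have "(\<lambda>j. f j - ?q * f0 j) \<in> M"
          by (rule lattice_subgroup_diff[OF Suc.prems(1) f lattice_subgroup_scale[OF Suc.prems(1)
              f0(1)]])
        then have "(\<lambda>j. f j - ?q * f0 j) \<in> M0" using dvd[OF f] by (simp add: M0_def f0(2))
        then obtain n where n: "n \<in> lattice_fun r" "(\<lambda>j. f j - ?q * f0 j) = int_comb {..<r} n b"
          using b(2) unfolding bij_betw_def by blast
        have "n(r := 0) = n" using n(1) by (auto simp: lattice_fun_def fun_eq_iff)
        then have "int_comb {..<Suc r} (n(r := ?q)) b' = (\<lambda>j. int_comb {..<r} n b j + ?q * f0 j)"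
          unfolding comb by (simp only: fun_upd_upd fun_upd_same)
        also have "\<dots> = f" unfolding n(2)[symmetric] by simp
        finally have "int_comb {..<Suc r} (n(r := ?q)) b' = f" .
        moreover have "n(r := ?q) \<in> lattice_fun (Suc r)" using n(1) by (auto simp: lattice_fun_def)
        ultimately show "f \<in> (\<lambda>n. int_comb {..<Suc r} n b') ` lattice_fun (Suc r)"
          by (intro image_eqI[of _ _ "n(r := ?q)"]) (simp_all only:)
      qed
    qed
    then show ?thesis using b'M by blast
  qed
qed

lemma lattice_dependent:
  assumes "finite I" "card I > k" "\<And>i. i \<in> I \<Longrightarrow> v i \<in> lattice_fun k"
  shows "\<exists>n. (\<exists>i \<in> I. n i \<noteq> 0) \<and> int_comb I n v = (\<lambda>_. 0)"
  using assms
proof (induction k arbitrary: I v)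
  case 0
  then obtain i where "i \<in> I" by fastforce
  moreover have "int_comb I (\<lambda>_. 1) v = (\<lambda>_. 0)"
    using 0 by (auto simp: int_comb_def lattice_fun_def intro!: sum.neutral)
  ultimately show ?case by (intro exI[of _ "\<lambda>_. 1"]) auto
next
  case (Suc k)
  show ?case
  proof (cases "\<forall>i \<in> I. v i k = 0")
    case True
    then have "v i \<in> lattice_fun k" if "i \<in> I" for i
      using lattice_fun_SucD[OF Suc.prems(3)[OF that]] True that by blast
    then show ?thesis using Suc.IH[of I v] Suc.prems by simp
  next
    case False
    then obtain p where p: "p \<in> I" "v p k \<noteq> 0" by blast
    \<comment> \<open>Cross-multiplication with the pivot \<open>p\<close> eliminates coordinate
      \<open>k\<close> without leaving the integers; \<open>n'\<close> below undoes it on the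
      coefficients.\<close>
    define w where "w i = (\<lambda>j. v p k * v i j - v i k * v p j)" for i
    have "w i \<in> lattice_fun k" if "i \<in> I - {p}" for i
    proof -
      have "v i \<in> lattice_fun (Suc k)" "v p \<in> lattice_fun (Suc k)" using Suc.prems(3) that p by auto
      then have "w i \<in> lattice_fun (Suc k)" by (auto simp: w_def lattice_fun_def)
      then show ?thesis by (rule lattice_fun_SucD) (simp add: w_def)
    qed
    moreover have "card (I - {p}) > k" "finite (I - {p})" using Suc.prems p by auto
    ultimately obtain n where n: "\<exists>i \<in> I - {p}. n i \<noteq> 0" "int_comb (I - {p}) n w = (\<lambda>_. 0)"
      using Suc.IH[of "I - {p}" w] by blast
    define n' where "n' i = (if i = p then - (\<Sum>i \<in> I - {p}. n i * v i k) else v p k * n i)" for i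
    have "int_comb I n' v j = 0" for j
    proof -
      have "int_comb I n' v j = n' p * v p j + (\<Sum>i \<in> I - {p}. n' i * v i j)"
        unfolding int_comb_def using Suc.prems(1) p(1) by (rule sum.remove)
      also have "(\<Sum>i \<in> I - {p}. n' i * v i j) = (\<Sum>i \<in> I - {p}. v p k * n i * v i j)"
        by (rule sum.cong) (auto simp: n'_def)
      also have "n' p * v p j + (\<Sum>i \<in> I - {p}. v p k * n i * v i j) = int_comb (I - {p}) n w j"
        unfolding int_comb_def w_def n'_def
        by (simp add: sum_distrib_left sum_subtractf algebra_simps)
      finally show ?thesis using n(2) by simp
    qed
    moreover have "\<exists>i \<in> I. n' i \<noteq> 0" using n(1) p by (auto simp: n'_def)
    ultimately show ?thesis by blast
  qed
qed

section \<open>The rank of a sublattice from dual functionals\<close>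

definition lattice_additive :: "nat \<Rightarrow> ((nat \<Rightarrow> int) \<Rightarrow> real) \<Rightarrow> bool" where
  "lattice_additive k \<Lambda> \<longleftrightarrow>
     (\<forall>f \<in> lattice_fun k. \<forall>g \<in> lattice_fun k. \<Lambda> (\<lambda>j. f j + g j) = \<Lambda> f + \<Lambda> g)"

lemma lattice_additiveD:
  "lattice_additive k \<Lambda> \<Longrightarrow> f \<in> lattice_fun k \<Longrightarrow> g \<in> lattice_fun k \<Longrightarrow>
     \<Lambda> (\<lambda>j. f j + g j) = \<Lambda> f + \<Lambda> g"
  by (simp add: lattice_additive_def)

lemma lattice_additive_comb:
  assumes \<Lambda>: "lattice_additive k \<Lambda>" and I: "finite I" "\<And>i. i \<in> I \<Longrightarrow> v i \<in> lattice_fun k"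
  shows "\<Lambda> (int_comb I n v) = (\<Sum>i \<in> I. of_int (n i) * \<Lambda> (v i))"
proof -
  have zero: "\<Lambda> (\<lambda>_. 0) = 0"
  proof -
    have "(\<lambda>_. 0) \<in> lattice_fun k" by (simp add: lattice_fun_def)
    from lattice_additiveD[OF \<Lambda> this this] show ?thesis by simp
  qed
  have nat: "\<Lambda> (\<lambda>j. int n * f j) = n * \<Lambda> f" if f: "f \<in> lattice_fun k" for n f
  proof (induction n)
    case (Suc n)
    have "(\<lambda>j. int n * f j) \<in> lattice_fun k" using f by (auto simp: lattice_fun_def)
    then have "\<Lambda> (\<lambda>j. int n * f j + f j) = \<Lambda> (\<lambda>j. int n * f j) + \<Lambda> f"
      by (rule lattice_additiveD[OF \<Lambda> _ f])
    then show ?case using Suc by (simp add: algebra_simps)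
  qed (simp add: zero)
  have scale: "\<Lambda> (\<lambda>j. c * f j) = of_int c * \<Lambda> f" if f: "f \<in> lattice_fun k" for c f
  proof (cases "c \<ge> 0")
    case True
    then show ?thesis using nat[OF f, of "nat c"] by simp
  next
    case False
    have m: "(\<lambda>j. - c * f j) \<in> lattice_fun k" "(\<lambda>j. c * f j) \<in> lattice_fun k"
      using f by (auto simp: lattice_fun_def)
    have "\<Lambda> (\<lambda>j. - c * f j + c * f j) = \<Lambda> (\<lambda>j. - c * f j) + \<Lambda> (\<lambda>j. c * f j)"
      by (rule lattice_additiveD[OF \<Lambda> m])
    moreover have "\<Lambda> (\<lambda>j. - c * f j) = - of_int c * \<Lambda> f" using nat[OF f, of "nat (- c)"] False
      by simp
    ultimately show ?thesis using zero by simp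
  qed
  show ?thesis using I
  proof (induction I)
    case empty
    then show ?case using zero by (simp add: int_comb_def)
  next
    case (insert i I)
    have "int_comb I n v \<in> lattice_fun k" using insert by (intro int_comb_mem) auto
    moreover have "(\<lambda>j. n i * v i j) \<in> lattice_fun k" using insert.prems[of i]
      by (auto simp: lattice_fun_def)
    moreover have "int_comb (insert i I) n v = (\<lambda>j. n i * v i j + int_comb I n v j)"
      using insert by (simp add: int_comb_def)
    ultimately have "\<Lambda> (int_comb (insert i I) n v) = \<Lambda> (\<lambda>j. n i * v i j) + \<Lambda> (int_comb I n v)"
      using \<Lambda> unfolding lattice_additive_def by simp
    then show ?case using insert scale by simp
  qed
qed

text \<open>The elements \<open>d i\<close> with \<open>i < k'\<close> lie in \<open>M\<close> and
  are independent by duality, so the rank is at least \<open>k'\<close>. A basis of \<open>M\<close>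
  together with the remaining \<open>d i\<close> is independent too, because the functionals from
  \<open>k'\<close> on vanish on \<open>M\<close>; as all these lie in a lattice of rank
  \<open>k\<close>, the rank of \<open>M\<close> is at most \<open>k'\<close>.\<close>

lemma lattice_subgroup_rank:
  assumes M: "lattice_subgroup M" "M \<subseteq> lattice_fun k" and k': "k' \<le> k"
    and d: "\<And>i. i < k \<Longrightarrow> d i \<in> lattice_fun k" "\<And>i. i < k' \<Longrightarrow> d i \<in> M"
    and \<Lambda>: "\<And>i. i < k \<Longrightarrow> lattice_additive k (\<Lambda> i)"
      "\<And>i j. i < k \<Longrightarrow> j < k \<Longrightarrow> \<Lambda> i (d j) = 0 \<longleftrightarrow> i \<noteq> j"
      "\<And>i f. k' \<le> i \<Longrightarrow> i < k \<Longrightarrow> f \<in> M \<Longrightarrow> \<Lambda> i f = 0"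
  shows "\<exists>b. bij_betw (\<lambda>n. int_comb {..<k'} n b) (lattice_fun k') M"
proof -
  obtain r b where b: "\<And>i. i < r \<Longrightarrow> b i \<in> M" "bij_betw (\<lambda>n. int_comb {..<r} n b) (lattice_fun r) M"
    using lattice_subgroup_basis[OF M] by blast
  have "k' \<le> r"
  proof (rule ccontr)
    assume "\<not> k' \<le> r"
    have "\<exists>c \<in> lattice_fun r. d i = int_comb {..<r} c b" if "i < k'" for i
      using b(2) d(2)[OF that] unfolding bij_betw_def by blast
    then obtain c where c: "\<And>i. i < k' \<Longrightarrow> c i \<in> lattice_fun r"
        "\<And>i. i < k' \<Longrightarrow> d i = int_comb {..<r} (c i) b"
      by metis
    obtain n where n: "\<exists>i \<in> {..<k'}. n i \<noteq> 0" "int_comb {..<k'} n c = (\<lambda>_. 0)"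
      using lattice_dependent[of "{..<k'}" r c] c(1) \<open>\<not> k' \<le> r\<close> by auto
    have "int_comb {..<k'} n d j = 0" for j
    proof -
      have "int_comb {..<k'} n d j = (\<Sum>i<k'. \<Sum>l<r. n i * c i l * b l j)"
        unfolding int_comb_def using c(2)
          by (intro sum.cong) (auto simp: int_comb_def sum_distrib_left mult.assoc)
      also have "\<dots> = (\<Sum>l<r. int_comb {..<k'} n c l * b l j)"
        unfolding int_comb_def by (subst sum.swap) (simp add: sum_distrib_right)
      finally show ?thesis using n(2) by simp
    qed
    then have 0: "int_comb {..<k'} n d = (\<lambda>_. 0)" by blast
    obtain i where i: "i < k'" "n i \<noteq> 0" using n(1) by blast
    have ik: "i < k" using i k' by simp
    have "\<Lambda> i (int_comb {..<k'} n d) = (\<Sum>j<k'. of_int (n j) * \<Lambda> i (d j))"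
      using d(1) k' by (intro lattice_additive_comb[OF \<Lambda>(1)[OF ik]]) auto
    also have "\<dots> = (\<Sum>j<k'. if j = i then of_int (n i) * \<Lambda> i (d i) else 0)"
      using \<Lambda>(2)[OF ik] k' by (intro sum.cong) auto
    also have "\<dots> = of_int (n i) * \<Lambda> i (d i)" using i by simp
    finally have "\<Lambda> i (\<lambda>_. 0) \<noteq> 0" using 0 i \<Lambda>(2)[OF ik ik] by simp
    moreover have "\<Lambda> i (int_comb {} n d) = 0" by (subst lattice_additive_comb[OF \<Lambda>(1)[OF ik]]) auto
    ultimately show False by (simp add: int_comb_def)
  qed
  moreover have "r \<le> k'"
  proof (rule ccontr)
    assume "\<not> r \<le> k'"
    \<comment> \<open>The basis of \<open>M\<close> followed by the elements \<open>d i\<close> with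
      index from \<open>k'\<close> on, more than \<open>k\<close> vectors in total.\<close>
    define v where "v j = (if j < r then b j else d (k' + (j - r)))" for j
    let ?N = "r + (k - k')"
    have vL: "v j \<in> lattice_fun k" if "j < ?N" for j
      using that b(1) M(2) d(1) by (auto simp: v_def)
    have "k < ?N" using \<open>\<not> r \<le> k'\<close> k' by linarith
    then have "\<exists>n. (\<exists>j \<in> {..<?N}. n j \<noteq> 0) \<and> int_comb {..<?N} n v = (\<lambda>_. 0)"
      using vL by (intro lattice_dependent[of _ k]) simp_all
    then obtain n where n: "\<exists>j \<in> {..<?N}. n j \<noteq> 0" "int_comb {..<?N} n v = (\<lambda>_. 0)" by blast
    \<comment> \<open>This functional vanishes on \<open>M\<close> and on all other
      \<open>d j\<close>, so it isolates one coefficient.\<close>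
    have high: "n (r + i) = 0" if i: "i < k - k'" for i
    proof -
      have ik: "k' + i < k" using i by simp
      have "\<Lambda> (k' + i) (int_comb {..<?N} n v) = (\<Sum>j<?N. of_int (n j) * \<Lambda> (k' + i) (v j))"
        using vL by (intro lattice_additive_comb[OF \<Lambda>(1)[OF ik]]) auto
      also have "\<dots> = (\<Sum>j<?N. if j = r + i then of_int (n (r + i)) * \<Lambda> (k' + i) (d (k' + i)) else 0)"
      proof (rule sum.cong)
        fix j assume j: "j \<in> {..<?N}"
        show "of_int (n j) * \<Lambda> (k' + i) (v j) =
            (if j = r + i then of_int (n (r + i)) * \<Lambda> (k' + i) (d (k' + i)) else 0)"
        proof (cases "j < r")
          case True
          then show ?thesis using \<Lambda>(3)[OF _ ik] b(1) by (simp add: v_def)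
        next
          case False
          then show ?thesis using \<Lambda>(2)[OF ik, of "k' + (j - r)"] j by (auto simp: v_def)
        qed
      qed simp
      also have "\<dots> = of_int (n (r + i)) * \<Lambda> (k' + i) (d (k' + i))"
      proof -
        have "r + i \<in> {..<?N}" using i by simp
        then show ?thesis by (simp only: sum.delta finite_lessThan if_True)
      qed
      finally have "\<Lambda> (k' + i) (\<lambda>_. 0) = of_int (n (r + i)) * \<Lambda> (k' + i) (d (k' + i))" using n(2)
        by simp
      moreover have "\<Lambda> (k' + i) (int_comb {} n d) = 0"
        by (subst lattice_additive_comb[OF \<Lambda>(1)[OF ik]]) auto
      ultimately show ?thesis using \<Lambda>(2)[OF ik ik] by (simp add: int_comb_def)
    qed
    define n' where "n' j = (if j < r then n j else 0)" for j
    have "int_comb {..<r} n' b = int_comb {..<?N} n v"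
    proof
      fix l
      have "int_comb {..<?N} n v l = (\<Sum>j<r. n j * v j l) + (\<Sum>j=r..<?N. n j * v j l)"
        unfolding int_comb_def lessThan_atLeast0
          by (rule sum.atLeastLessThan_concat[symmetric]) auto
      also have "(\<Sum>j=r..<?N. n j * v j l) = 0"
        by (rule sum.neutral) (use high in \<open>force simp: le_iff_add\<close>)
      also have "(\<Sum>j<r. n j * v j l) = int_comb {..<r} n' b l"
        unfolding int_comb_def by (rule sum.cong) (auto simp: v_def n'_def)
      finally show "int_comb {..<r} n' b l = int_comb {..<?N} n v l" by simp
    qed
    also have "\<dots> = int_comb {..<r} (\<lambda>_. 0) b" using n(2) by (simp add: int_comb_def)
    finally have "n' = (\<lambda>_. 0)"
      using b(2) unfolding bij_betw_def inj_on_def lattice_fun_def n'_def by fastforce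
    then have "n j = 0" if "j < r" for j using that by (metis n'_def)
    moreover have "n j = 0" if "r \<le> j" "j < ?N" for j
      using high[of "j - r"] that by simp
    ultimately show False using n(1) by (meson lessThan_iff not_le)
  qed
  ultimately show ?thesis using b(2) by auto
qed

section \<open>Irreducible factors\<close>

text \<open>Membership in the irreducible decomposition, expressed without a decomposition list.
  Factors of \<open>\<Gamma>\<close> and of an induced subgraph thus become sets of graphs that can
  be compared by inclusion.\<close>

definition is_factor :: "'a labelled_graph \<Rightarrow> 'a labelled_graph \<Rightarrow> bool" where
  "is_factor \<Gamma> \<Delta> \<longleftrightarrow> defining_graph \<Delta> \<and> irreducible_graph \<Delta> \<and> vertices \<Delta> \<subseteq> vertices \<Gamma> \<and>
     induced_subgraph \<Gamma> (vertices \<Delta>) = \<Delta> \<and>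
     (\<forall>s \<in> vertices \<Delta>. \<forall>t \<in> vertices \<Gamma> - vertices \<Delta>. label \<Gamma> {s, t} = Some 2)"

lemma label_induced_subgraph: "e \<subseteq> K \<Longrightarrow> label (induced_subgraph \<Gamma> K) e = label \<Gamma> e"
  by (simp add: induced_subgraph_def)

lemma label_induced_subgraph_Some: "label (induced_subgraph \<Gamma> K) e = Some m \<Longrightarrow> label \<Gamma> e = Some m"
  by (auto simp: induced_subgraph_def restrict_map_def split: if_splits)

lemma vertices_induced_subgraph [simp]: "vertices (induced_subgraph \<Gamma> K) = K"
  by (simp add: induced_subgraph_def)

lemma induced_induced_subgraph:
  "K \<subseteq> L \<Longrightarrow> induced_subgraph (induced_subgraph \<Gamma> L) K = induced_subgraph \<Gamma> K"
  by (auto simp: induced_subgraph_def restrict_map_def fun_eq_iff)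

lemma factor_label: "is_factor \<Gamma> \<Delta> \<Longrightarrow> s \<in> vertices \<Delta> \<Longrightarrow> t \<in> vertices \<Delta> \<Longrightarrow> label \<Delta> {s, t} =
    label \<Gamma> {s, t}"
  using label_induced_subgraph[of "{s, t}" "vertices \<Delta>" \<Gamma>] by (simp add: is_factor_def)

lemma factor_subset:
  assumes "is_factor \<Gamma> \<Delta>" "is_factor \<Gamma> \<Theta>" "vertices \<Delta> \<inter> vertices \<Theta> \<noteq> {}"
  shows "vertices \<Delta> \<subseteq> vertices \<Theta>"
proof -
  have "vertices \<Delta> \<inter> vertices \<Theta> = {} \<or> vertices \<Delta> \<inter> vertices \<Theta> = vertices \<Delta>"
  proof (rule irreducible_graph_no_split)
    show "defining_graph \<Delta>" "irreducible_graph \<Delta>" using assms(1) by (auto simp: is_factor_def)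
    fix s t assume s: "s \<in> vertices \<Delta> \<inter> vertices \<Theta>"
        and t: "t \<in> vertices \<Delta> - vertices \<Delta> \<inter> vertices \<Theta>"
    have "t \<in> vertices \<Gamma> - vertices \<Theta>" using t assms(1) by (auto simp: is_factor_def)
    then have "label \<Gamma> {s, t} = Some 2" using s assms(2) by (auto simp: is_factor_def)
    then show "label \<Delta> {s, t} = Some 2" using factor_label[OF assms(1), of s t] s t by simp
  qed simp
  then show ?thesis using assms(3) by blast
qed

lemma factors_disjoint:
  assumes "is_factor \<Gamma> \<Delta>" "is_factor \<Gamma> \<Theta>" "\<Delta> \<noteq> \<Theta>"
  shows "vertices \<Delta> \<inter> vertices \<Theta> = {}"
proof (rule ccontr)
  assume "vertices \<Delta> \<inter> vertices \<Theta> \<noteq> {}"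
  then have "vertices \<Delta> = vertices \<Theta>"
    using factor_subset[OF assms(1,2)] factor_subset[OF assms(2,1)] by blast
  then show False using assms unfolding is_factor_def by metis
qed

lemma irreducible_decomposition_factors:
  assumes "irreducible_decomposition \<Gamma> \<Gamma>s"
  shows "distinct \<Gamma>s" "set \<Gamma>s = {\<Delta>. is_factor \<Gamma> \<Delta>}"
proof -
  have d: "\<forall>\<Delta> \<in> set \<Gamma>s. defining_graph \<Delta> \<and> irreducible_graph \<Delta>"
    "sorted_wrt (\<lambda>\<Delta> \<Delta>'. vertices \<Delta> \<inter> vertices \<Delta>' = {}) \<Gamma>s" "\<Gamma> = foldr two_join \<Gamma>s empty_graph"
    using assms by (auto simp: irreducible_decomposition_def)
  have "\<forall>\<Delta> \<in> set \<Gamma>s. vertices \<Delta> \<noteq> {}" using d(1) by (auto simp: irreducible_graph_def)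
  with d(2) show "distinct \<Gamma>s" by (induction \<Gamma>s) auto
  have V: "vertices \<Gamma> = (\<Union>\<Delta> \<in> set \<Gamma>s. vertices \<Delta>)" unfolding d(3) by simp
  have sub: "is_factor \<Gamma> \<Delta>" if "\<Delta> \<in> set \<Gamma>s" for \<Delta>
    using decomposition_structure[of \<Gamma>s \<Delta>] d(1,2) that V unfolding is_factor_def d(3)[symmetric]
      by auto
  show "set \<Gamma>s = {\<Delta>. is_factor \<Gamma> \<Delta>}"
  proof (intro equalityI subsetI CollectI)
    fix \<Delta> assume "\<Delta> \<in> {\<Delta>. is_factor \<Gamma> \<Delta>}"
    then have f: "is_factor \<Gamma> \<Delta>" by simp
    then have "vertices \<Delta> \<noteq> {}" "vertices \<Delta> \<subseteq> vertices \<Gamma>"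
      by (auto simp: is_factor_def irreducible_graph_def)
    then obtain \<Theta> where "\<Theta> \<in> set \<Gamma>s" "vertices \<Delta> \<inter> vertices \<Theta> \<noteq> {}" using V by blast
    then show "\<Delta> \<in> set \<Gamma>s" using factors_disjoint[OF f sub] by blast
  qed (rule sub)
qed

lemma num_spherical_factors_card:
  assumes "defining_graph \<Gamma>"
  shows "finite {\<Delta>. is_factor \<Gamma> \<Delta> \<and> spherical \<Delta>}"
    "num_spherical_factors \<Gamma> = card {\<Delta>. is_factor \<Gamma> \<Delta> \<and> spherical \<Delta>}"
proof -
  obtain \<Gamma>s where G: "irreducible_decomposition \<Gamma> \<Gamma>s"
    using irreducible_decomposition_exists[OF assms] by blast
  have eq: "set (filter spherical \<Gamma>s) = {\<Delta>. is_factor \<Gamma> \<Delta> \<and> spherical \<Delta>}"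
    using irreducible_decomposition_factors(2)[OF G] by auto
  show "finite {\<Delta>. is_factor \<Gamma> \<Delta> \<and> spherical \<Delta>}" unfolding eq[symmetric] by simp
  show "num_spherical_factors \<Gamma> = card {\<Delta>. is_factor \<Gamma> \<Delta> \<and> spherical \<Delta>}"
    unfolding num_spherical_factors_eq[OF G] eq[symmetric]
    using irreducible_decomposition_factors(1)[OF G] by (metis distinct_card distinct_filter)
qed

section \<open>Spherical factors and their central words\<close>

lemma coxeter_regular_gen:
  assumes "defining_graph \<Delta>"
  shows "coxeter \<Delta> (regular_gen (vertices \<Delta>) (coxeter_relations \<Delta>))"
proof -
  interpret presentation "vertices \<Delta>" "coxeter_relations \<Delta>"
      "regular_gen (vertices \<Delta>) (coxeter_relations \<Delta>)"
    by (rule presentation_regular_gen)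
  show ?thesis by standard (rule assms)
qed

lemma spherical_finite:
  assumes "spherical \<Delta>"
  shows "finite (generated_by (regular_gen (vertices \<Delta>) (coxeter_relations \<Delta>)) (vertices \<Delta>))"
proof -
  let ?G = "presented_group (vertices \<Delta>) (coxeter_relations \<Delta>)"
  have "finite (carrier ?G)" using assms
    by (simp add: spherical_def coxeter_group_def coxeter_relations_def)
  moreover have "generated_by (regular_gen (vertices \<Delta>) (coxeter_relations \<Delta>)) (vertices \<Delta>) \<subseteq>
      translation ?G ` carrier ?G"
    unfolding generated_by_def by (auto simp: word_val_regular_gen)
  ultimately show ?thesis by (meson finite_imageI finite_subset)
qed

text \<open>A missing edge gives alternating elements with any number of inversions, hence
  infinitely many group elements.\<close>

lemma spherical_complete:
  assumes "defining_graph \<Delta>" "spherical \<Delta>" "s \<in> vertices \<Delta>" "t \<in> vertices \<Delta>" "s \<noteq> t"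
  shows "label \<Delta> {s, t} \<noteq> None"
proof
  assume none: "label \<Delta> {s, t} = None"
  interpret coxeter \<Delta> "regular_gen (vertices \<Delta>) (coxeter_relations \<Delta>)"
    by (rule coxeter_regular_gen[OF assms(1)])
  have "within_order s t k" for k using none by (simp add: within_order_def)
  then have "card (inversions (alt_elt s t k)) = k" for k
    using inversions_alt_elt(2)[OF assms(3-5)] by blast
  then have "inj (alt_elt s t)" by (metis injI)
  moreover have "range (alt_elt s t) \<subseteq> W" using assms(3,4) by auto
  ultimately show False
    using spherical_finite[OF assms(2)] by (meson finite_subset range_inj_infinite)
qed

lemma spherical_central_word:
  assumes "defining_graph \<Delta>" "spherical \<Delta>"
  shows "\<exists>z. set z \<subseteq> vertices \<Delta> \<and> (\<forall>s \<in> vertices \<Delta>.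
    pres_eq (vertices \<Delta>) (artin_relations \<Delta>) (positive_word (s # z)) (positive_word (z @ [s])) \<and>
    (\<exists>x. pres_eq (vertices \<Delta>) (artin_relations \<Delta>) (positive_word z) (positive_word (s # x))))"
proof -
  interpret coxeter \<Delta> "regular_gen (vertices \<Delta>) (coxeter_relations \<Delta>)"
    by (rule coxeter_regular_gen[OF assms(1)])
  obtain z where "set z \<subseteq> V" "\<And>s. s \<in> V \<Longrightarrow> braid_eq (s # z) (z @ [s])"
    "\<And>s. s \<in> V \<Longrightarrow> \<exists>x. braid_eq z (s # x)"
    using central_positive_word[OF spherical_finite[OF assms(2)]] by blast
  then show ?thesis unfolding braid_eq_def by blast
qed

lemma spherical_factor_cone:
  assumes "is_factor \<Gamma> \<Delta>" "spherical \<Delta>"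
  shows "vertices \<Delta> \<subseteq> cone_points \<Gamma>"
proof
  fix s assume s: "s \<in> vertices \<Delta>"
  have "adjacent \<Gamma> s t" if t: "t \<in> vertices \<Gamma>" "t \<noteq> s" for t
  proof (cases "t \<in> vertices \<Delta>")
    case True
    then have "label \<Gamma> {s, t} \<noteq> None"
      using spherical_complete[of \<Delta> s t] assms factor_label[OF assms(1) s True] s t
        by (auto simp: is_factor_def)
    then show ?thesis by (auto simp: adjacent_def)
  next
    case False
    then show ?thesis using assms(1) s t by (auto simp: is_factor_def adjacent_def)
  qed
  then show "s \<in> cone_points \<Gamma>" using assms(1) s by (auto simp: cone_points_def is_factor_def)
qed

lemma factor_induced_subgraph:
  assumes "is_factor \<Gamma> \<Delta>" "vertices \<Delta> \<subseteq> K" "K \<subseteq> vertices \<Gamma>"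
  shows "is_factor (induced_subgraph \<Gamma> K) \<Delta>"
  using assms unfolding is_factor_def
  by (auto simp: induced_induced_subgraph label_induced_subgraph subset_iff)

lemma factor_of_induced_not_factor:
  assumes "is_factor (induced_subgraph \<Gamma> K) \<Delta>" "K \<subseteq> vertices \<Gamma>" "\<not> is_factor \<Gamma> \<Delta>"
  shows "\<exists>u \<in> vertices \<Delta>. \<exists>s \<in> vertices \<Gamma> - K. label \<Gamma> {s, u} \<noteq> Some 2"
proof (rule ccontr)
  assume contr: "\<not> ?thesis"
  have sub: "vertices \<Delta> \<subseteq> K" using assms(1) by (simp add: is_factor_def)
  have "label \<Gamma> {u, t} = Some 2" if u: "u \<in> vertices \<Delta>" and t: "t \<in> vertices \<Gamma> - vertices \<Delta>" for u t
  proof (cases "t \<in> K")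
    case True
    then have "label (induced_subgraph \<Gamma> K) {u, t} = Some 2"
      using assms(1) u t by (auto simp: is_factor_def)
    then show ?thesis by (rule label_induced_subgraph_Some)
  next
    case False
    then show ?thesis using contr u t by (auto simp: insert_commute)
  qed
  then have "is_factor \<Gamma> \<Delta>"
    using assms(1,2) sub by (auto simp: is_factor_def induced_induced_subgraph)
  then show False using assms(3) by simp
qed

text \<open>Equalities of words obtained in the Artin group of a factor can thereby be evaluated
  both at \<open>\<gamma>\<close> and in the Burau representation.\<close>

lemma factor_relations:
  assumes "is_factor (induced_subgraph \<Gamma> K) \<Delta>" "K \<subseteq> vertices \<Gamma>"
    "satisfies_relations (vertices \<Gamma>) (artin_relations \<Gamma>) f"
  shows "satisfies_relations (vertices \<Delta>) (artin_relations \<Delta>) f"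
proof -
  have sub: "vertices \<Delta> \<subseteq> vertices \<Gamma>" using assms(1,2) by (auto simp: is_factor_def)
  have "label \<Gamma> e = Some m" if "label \<Delta> e = Some m" for e m
  proof -
    have "label (induced_subgraph (induced_subgraph \<Gamma> K) (vertices \<Delta>)) e = Some m"
      using assms(1) that by (simp add: is_factor_def)
    then show ?thesis by (rule label_induced_subgraph_Some[OF label_induced_subgraph_Some])
  qed
  then have "artin_relations \<Delta> \<subseteq> artin_relations \<Gamma>" unfolding artin_relations_def by blast
  then show ?thesis
    using assms(3) words_mono[OF sub] unfolding satisfies_relations_def by blast
qed

section \<open>The center as a lattice\<close>

definition center_set :: "('a \<Rightarrow> 'g :: mult_group) \<Rightarrow> 'a set \<Rightarrow> 'g set" where
  "center_set f K = {z \<in> generated_by f K. \<forall>x \<in> generated_by f K. z * x = x * z}"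

lemma center_setI:
  "z \<in> generated_by f K \<Longrightarrow> (\<And>s. s \<in> K \<Longrightarrow> z * f s = f s * z) \<Longrightarrow> z \<in> center_set f K"
  using commute_generated_by[of K z f] by (simp add: center_set_def)

lemma center_set_generated: "z \<in> center_set f K \<Longrightarrow> z \<in> generated_by f K"
  unfolding center_set_def by blast

lemma center_set_commute: "z \<in> center_set f K \<Longrightarrow> x \<in> generated_by f K \<Longrightarrow> z * x = x * z"
  unfolding center_set_def by blast

lemma center_set_one: "1 \<in> center_set f K"
  by (simp add: center_set_def)

lemma center_set_mult:
  assumes "x \<in> center_set f K" "y \<in> center_set f K"
  shows "x * y \<in> center_set f K"
proof (rule center_setI)
  show "x * y \<in> generated_by f K"
    by (rule generated_by_mult[OF center_set_generated[OF assms(1)] center_set_generated[OF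
        assms(2)]])
  fix s assume "s \<in> K"
  then have "f s \<in> generated_by f K" by simp
  note c = center_set_commute[OF assms(1) this] center_set_commute[OF assms(2) this]
  have "x * y * f s = x * f s * y" by (simp only: mult.assoc c(2))
  then show "x * y * f s = f s * (x * y)" by (simp only: mult.assoc c(1))
qed

lemma center_set_ginv:
  assumes "x \<in> center_set f K"
  shows "ginv x \<in> center_set f K"
proof (rule center_setI)
  show "ginv x \<in> generated_by f K" by (rule generated_by_ginv[OF center_set_generated[OF assms]])
  fix s assume "s \<in> K"
  from center_set_commute[OF assms generated_by_gen[OF this], symmetric]
  show "ginv x * f s = f s * ginv x" by (rule commute_ginv[symmetric])
qed

definition lattice_iso :: "nat \<Rightarrow> ((nat \<Rightarrow> int) \<Rightarrow> 'g :: mult_group) \<Rightarrow> 'g set \<Rightarrow> bool" where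
  "lattice_iso k \<psi> M \<longleftrightarrow> bij_betw \<psi> (lattice_fun k) M \<and>
     (\<forall>f \<in> lattice_fun k. \<forall>g \<in> lattice_fun k. \<psi> (\<lambda>j. f j + g j) = \<psi> f * \<psi> g)"

text \<open>\<open>\<psi>\<close> is an unspecified isomorphism, so the center of the whole group is
  pulled back to a subgroup \<open>M\<close> of the lattice. The preimages \<open>d i\<close> of the
  central elements \<open>c i\<close> and the functionals \<open>\<Lambda> i\<close> have the
  duality that \<open>lattice_subgroup_rank\<close> asks for.\<close>

theorem center_lattice:
  assumes graph: "defining_graph \<Gamma>" and pres: "presentation (vertices \<Gamma>) (artin_relations \<Gamma>) \<gamma>"
    and T: "T = cone_points \<Gamma>"
    and \<psi>: "lattice_iso (num_spherical_factors (induced_subgraph \<Gamma> T)) \<psi> (center_set \<gamma> T)"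
  shows "\<exists>\<psi>'. lattice_iso (num_spherical_factors \<Gamma>) \<psi>' (center_set \<gamma> (vertices \<Gamma>))"
proof -
  let ?V = "vertices \<Gamma>" and ?D = "induced_subgraph \<Gamma> T"
  interpret presentation ?V "artin_relations \<Gamma>" \<gamma> by (rule pres)
  have TV: "T \<subseteq> ?V" using T by (auto simp: cone_points_def)
  have graphD: "defining_graph ?D" using defining_graph_induced[OF graph TV] .
  define F where "F = {\<Delta>. is_factor \<Gamma> \<Delta> \<and> spherical \<Delta>}"
  define F' where "F' = {\<Delta>. is_factor ?D \<Delta> \<and> spherical \<Delta>}"
  define k where "k = card F'"
  define k' where "k' = card F"
  have num: "num_spherical_factors \<Gamma> = k'" "num_spherical_factors ?D = k"
      and finF: "finite F" "finite F'"
    using num_spherical_factors_card[OF graph] num_spherical_factors_card[OF graphD]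
    by (auto simp: F_def F'_def k_def k'_def)
  have FF': "F \<subseteq> F'"
  proof
    fix \<Delta> assume "\<Delta> \<in> F"
    then have \<Delta>: "is_factor \<Gamma> \<Delta>" "spherical \<Delta>" by (auto simp: F_def)
    then have "vertices \<Delta> \<subseteq> T" unfolding T by (rule spherical_factor_cone)
    then show "\<Delta> \<in> F'" using factor_induced_subgraph[OF \<Delta>(1) _ TV] \<Delta>(2) by (simp add: F'_def)
  qed
  obtain xs ys where xy: "set xs = F" "distinct xs" "set ys = F' - F" "distinct ys"
    using finite_distinct_list[OF finF(1)] finite_distinct_list[of "F' - F"] finF(2) by auto
  \<comment> \<open>Factors of the whole graph get the indices below \<open>k'\<close>, the other
    spherical factors of \<open>T\<close> the indices from \<open>k'\<close> to
    \<open>k - 1\<close>.\<close>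
  define S where "S i = (xs @ ys) ! i" for i
  have lens: "length xs = k'" "length (xs @ ys) = k" "k' \<le> k"
    using xy FF' finF distinct_card[of xs] distinct_card[of "xs @ ys"] card_mono[of F' F]
    by (auto simp: k_def k'_def Un_absorb1)
  have SF: "S i \<in> F" if "i < k'" for i using that lens xy by (auto simp: S_def nth_append)
  have SF': "S i \<in> F'" if "i < k" for i
    using nth_mem[of i "xs @ ys"] that lens xy FF' by (auto simp: S_def)
  have SnF: "S i \<notin> F" if "k' \<le> i" "i < k" for i
  proof -
    have "i - k' < length ys" "S i = ys ! (i - k')" using that lens by (auto simp: S_def nth_append)
    then show ?thesis using nth_mem[of "i - k'" ys] xy(3) by auto
  qed
  have Sinj: "S i \<noteq> S j" if "i < k" "j < k" "i \<noteq> j" for i j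
    using nth_eq_iff_index_eq[of "xs @ ys" i j] that lens xy by (auto simp: S_def)
  have Sfac: "is_factor ?D (S i)" "spherical (S i)" "defining_graph (S i)" "vertices (S i) \<subseteq> T"
      "vertices (S i) \<noteq> {}"
    if "i < k" for i
    using SF'[OF that] by (auto simp: F'_def is_factor_def irreducible_graph_def)
  have Slabel: "label \<Gamma> {s, t} = Some 2" if "i < k" "s \<in> vertices (S i)" "t \<in> T - vertices (S i)"
      for i s t
  proof -
    have "label ?D {s, t} = Some 2" using Sfac(1)[OF that(1)] that(2,3)
      by (auto simp: is_factor_def)
    then show ?thesis by (rule label_induced_subgraph_Some)
  qed
  \<comment> \<open>The vertex at which the scalar of index \<open>i\<close> is read: arbitrary in a
    factor of the whole graph, otherwise one tied to some vertex outside \<open>T\<close> by a label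
    other than 2 or a missing edge.\<close>
  have "\<exists>u \<in> vertices (S i). S i \<notin> F \<longrightarrow> (\<exists>s \<in> ?V - T. label \<Gamma> {s, u} \<noteq> Some 2)" if i: "i < k" for i
  proof (cases "S i \<in> F")
    case True
    then show ?thesis using Sfac(5)[OF i] by blast
  next
    case False
    then have "\<not> is_factor \<Gamma> (S i)" using Sfac(2)[OF i] by (simp add: F_def)
    then show ?thesis using factor_of_induced_not_factor[OF Sfac(1)[OF i] TV] by blast
  qed
  then obtain u where u: "\<And>i. i < k \<Longrightarrow> u i \<in> vertices (S i)"
    "\<And>i. i < k \<Longrightarrow> S i \<notin> F \<Longrightarrow> \<exists>s \<in> ?V - T. label \<Gamma> {s, u i} \<noteq> Some 2"
    by metis
  have "\<exists>z x. set z \<subseteq> vertices (S i) \<and>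
      (\<forall>s \<in> vertices (S i). pres_eq (vertices (S i)) (artin_relations (S i)) (positive_word (s # z))
          (positive_word (z @ [s]))) \<and>
      pres_eq (vertices (S i)) (artin_relations (S i)) (positive_word z) (positive_word (u i # x))"
    if "i < k" for i
    using spherical_central_word[OF Sfac(3,2)[OF that]] u(1)[OF that] by blast
  then obtain z x where z: "\<And>i. i < k \<Longrightarrow> set (z i) \<subseteq> vertices (S i)"
    "\<And>i s. i < k \<Longrightarrow> s \<in> vertices (S i) \<Longrightarrow>
      pres_eq (vertices (S i)) (artin_relations (S i)) (positive_word (s # z i)) (positive_word (z i
          @ [s]))"
    "\<And>i. i < k \<Longrightarrow>
      pres_eq (vertices (S i)) (artin_relations (S i)) (positive_word (z i)) (positive_word (u i # x
          i))"
    by metis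
  define c where "c i = word_val \<gamma> (positive_word (z i))" for i
  have c_S: "c i \<in> generated_by \<gamma> (vertices (S i))" if "i < k" for i
    using z(1)[OF that] unfolding c_def generated_by_def by auto
  have c_commute: "c i * \<gamma> t = \<gamma> t * c i" if i: "i < k"
      and t: "t \<in> ?V" "\<And>s. s \<in> vertices (S i) \<Longrightarrow> t \<notin> vertices (S i) \<Longrightarrow> label \<Gamma> {s, t} = Some 2"
          for i t
  proof (cases "t \<in> vertices (S i)")
    case True
    have "word_val \<gamma> (positive_word (t # z i)) = word_val \<gamma> (positive_word (z i @ [t]))"
      by (rule word_val_pres_eq[OF z(2)[OF i True] factor_relations[OF Sfac(1)[OF i] TV satisfies]])
    then show ?thesis by (simp add: c_def)
  next
    case False
    have "\<gamma> t * \<gamma> s = \<gamma> s * \<gamma> t" if s: "s \<in> vertices (S i)" for s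
    proof -
      have "label \<Gamma> {s, t} = Some 2" using t(2) s False by blast
      then have "(alternating s t 2, alternating t s 2) \<in> artin_relations \<Gamma>"
        by (auto simp: artin_relations_def)
      moreover have "s \<in> ?V" using s Sfac(4)[OF i] TV by blast
      ultimately have "word_val \<gamma> (alternating s t 2) = word_val \<gamma> (alternating t s 2)"
        using satisfies[unfolded satisfies_relations_def, rule_format, of "alternating s t 2"
            "alternating t s 2"] t(1)
        by simp
      then show ?thesis by (simp add: numeral_2_eq_2)
    qed
    then show ?thesis using commute_generated_by[of "vertices (S i)" "\<gamma> t" \<gamma>, OF _ c_S[OF i]]
      by simp
  qed
  have c_T: "c i \<in> center_set \<gamma> T" if i: "i < k" for i
  proof (rule center_setI)
    show "c i \<in> generated_by \<gamma> T" using c_S[OF i] generated_by_mono[OF Sfac(4)[OF i]] by blast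
    show "c i * \<gamma> t = \<gamma> t * c i" if "t \<in> T" for t
      using c_commute[OF i, of t] Slabel[OF i] that TV by blast
  qed
  have c_V: "c i \<in> center_set \<gamma> ?V" if i: "i < k'" for i
  proof (rule center_setI)
    have ik: "i < k" using i lens by simp
    show "c i \<in> generated_by \<gamma> ?V"
      using c_S[OF ik] generated_by_mono[of "vertices (S i)" ?V \<gamma>] Sfac(4)[OF ik] TV by blast
    show "c i * \<gamma> t = \<gamma> t * c i" if "t \<in> ?V" for t
      using c_commute[OF ik that] SF[OF i] that by (auto simp: F_def is_factor_def)
  qed
  \<comment> \<open>There are finitely many factors, so one small parameter serves them all.\<close>
  have "eventually (\<lambda>r. \<forall>i \<in> {..<k}. \<bar>eigenvalue (word_val (artin_burau \<Gamma> r) (positive_word (u i # x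
      i))) (u i)\<bar> < 1) (at_right 0)"
    by (intro eventually_ball_finite ballI eigenvalue_positive_word_small) auto
  moreover have "eventually (\<lambda>r :: real. r > 0) (at_right 0)"
    by (simp add: eventually_at_right_less)
  ultimately have "eventually (\<lambda>r. r > 0 \<and>
      (\<forall>i \<in> {..<k}. \<bar>eigenvalue (word_val (artin_burau \<Gamma> r) (positive_word (u i # x i))) (u i)\<bar> <
          1)) (at_right 0)"
    by eventually_elim simp
  from eventually_happens[OF this] obtain r where "r > 0 \<and> (\<forall>i \<in> {..<k}.
      \<bar>eigenvalue (word_val (artin_burau \<Gamma> r) (positive_word (u i # x i))) (u i)\<bar> < 1)"
    using trivial_limit_at_right_real[of "0 :: real"] by blast
  then have r: "r > 0" "\<And>i. i < k \<Longrightarrow>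
      \<bar>eigenvalue (word_val (artin_burau \<Gamma> r) (positive_word (u i # x i))) (u i)\<bar> < 1"
    by blast+
  note burau_rel = artin_burau_relations[OF graph, of r]
  have r0: "r \<noteq> 0" using r by simp
  obtain \<phi> where \<phi>: "\<And>w. w \<in> words ?V \<Longrightarrow> \<phi> (word_val \<gamma> w) = word_val (artin_burau \<Gamma> r) w"
    using transfer_function[OF burau_rel[OF r0]] by blast
  have \<phi>_gen: "\<phi> g \<in> generated_by (artin_burau \<Gamma> r) K" if "g \<in> generated_by \<gamma> K" "K \<subseteq> ?V" for g K
    using that \<phi> words_mono[OF that(2)] unfolding generated_by_def by force
  have \<phi>_mult: "\<phi> (g * h) = \<phi> g * \<phi> h" if gh: "g \<in> generated_by \<gamma> ?V" "h \<in> generated_by \<gamma> ?V"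
      for g h
  proof -
    obtain v w where "v \<in> words ?V" "w \<in> words ?V" "g = word_val \<gamma> v" "h = word_val \<gamma> w"
      using gh by (auto simp: generated_by_def)
    then show ?thesis using \<phi>[of "v @ w"] \<phi> by simp
  qed
  have \<phi>_s: "\<phi> (\<gamma> s) = artin_burau \<Gamma> r s" if "s \<in> ?V" for s using \<phi>[of "[(s, True)]"] that by simp
  have TinV: "generated_by \<gamma> T \<subseteq> generated_by \<gamma> ?V" by (rule generated_by_mono[OF TV])
  have cenV: "g \<in> generated_by \<gamma> ?V" if "g \<in> center_set \<gamma> T" for g
    using that TinV by (auto simp: center_set_def)
  have \<phi>_add: "additive_map (perm_apply (\<phi> g))" if "g \<in> generated_by \<gamma> ?V" for g
    using additive_map_generated[OF \<phi>_gen[OF that] r0] by simp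
  have \<phi>_comm: "\<phi> g * artin_burau \<Gamma> r s = artin_burau \<Gamma> r s * \<phi> g"
    if "g \<in> generated_by \<gamma> ?V" "g * \<gamma> s = \<gamma> s * g" "s \<in> ?V" for g s
    using \<phi>_mult[of g "\<gamma> s"] \<phi>_mult[of "\<gamma> s" g] \<phi>_s that by simp
  have \<phi>_commT: "\<phi> g * artin_burau \<Gamma> r s = artin_burau \<Gamma> r s * \<phi> g" if "g \<in> center_set \<gamma> T" "s \<in> T"
      for g s
    using \<phi>_comm[OF cenV[OF that(1)], of s] that TV by (auto simp: center_set_def)
  have uT: "u i \<in> T" if "i < k" for i using u(1)[OF that] Sfac(4)[OF that] by blast
  have ev_mult: "eigenvalue (\<phi> (g * h)) (u i) = eigenvalue (\<phi> g) (u i) * eigenvalue (\<phi> h) (u i)"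
    if "g \<in> center_set \<gamma> T" "h \<in> center_set \<gamma> T" "i < k" for g h i
    using \<phi>_mult[OF cenV[OF that(1)] cenV[OF that(2)]]
      eigenvalue_mult[OF graph r(1) \<phi>_add[OF cenV[OF that(1)]] \<phi>_add[OF cenV[OF that(2)]]
        \<phi>_commT[OF that(1) uT[OF that(3)]] \<phi>_commT[OF that(2) uT[OF that(3)]]]
    by simp
  have ev_one: "eigenvalue (\<phi> 1) a = 1" for a
    using \<phi>[of "[]"] by (simp add: eigenvalue_def basis_vec_def)
  have ev_nz: "eigenvalue (\<phi> g) (u i) \<noteq> 0" if "g \<in> center_set \<gamma> T" "i < k" for g i
    using ev_mult[OF that(1) center_set_ginv[OF that(1)] that(2)] ev_one[of "u i"] by auto
  have \<psi>_bij: "bij_betw \<psi> (lattice_fun k) (center_set \<gamma> T)"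
    and \<psi>_add: "\<And>f g. f \<in> lattice_fun k \<Longrightarrow> g \<in> lattice_fun k \<Longrightarrow> \<psi> (\<lambda>j. f j + g j) = \<psi> f * \<psi> g"
    using \<psi> by (auto simp: lattice_iso_def num)
  have \<psi>_in: "\<psi> f \<in> center_set \<gamma> T" if "f \<in> lattice_fun k" for f using \<psi>_bij that
    by (auto simp: bij_betw_def)
  \<comment> \<open>The scalar is invertible but may be negative; the logarithm of its absolute
    value turns products in the center into sums.\<close>
  define \<Lambda> where "\<Lambda> i f = ln \<bar>eigenvalue (\<phi> (\<psi> f)) (u i)\<bar>" for i f
  have \<Lambda>_add: "lattice_additive k (\<Lambda> i)" if "i < k" for i
    unfolding lattice_additive_def \<Lambda>_def
    using \<psi>_add \<psi>_in ev_mult ev_nz that by (simp add: abs_mult ln_mult)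
  have VT: "center_set \<gamma> ?V \<subseteq> center_set \<gamma> T"
  proof
    fix g assume g: "g \<in> center_set \<gamma> ?V"
    then have "g \<in> generated_by \<gamma> T"
      using central_in_cone_subgroup[OF graph pres, of g] T by (auto simp: center_set_def)
    then show "g \<in> center_set \<gamma> T" using g TinV by (auto simp: center_set_def)
  qed
  define M where "M = {f \<in> lattice_fun k. \<psi> f \<in> center_set \<gamma> ?V}"
  have \<psi>0: "\<psi> (\<lambda>_. 0) = 1"
  proof -
    have "(\<lambda>_. 0) \<in> lattice_fun k" by (simp add: lattice_fun_def)
    from \<psi>_add[OF this this] have "\<psi> (\<lambda>_. 0) * 1 = \<psi> (\<lambda>_. 0) * \<psi> (\<lambda>_. 0)" by simp
    then show ?thesis by (simp only: gmult_left_cancel)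
  qed
  have M: "lattice_subgroup M"
    unfolding lattice_subgroup_def
  proof (intro conjI ballI)
    show "(\<lambda>_. 0) \<in> M" using \<psi>0 center_set_one by (simp add: M_def lattice_fun_def)
    fix f g assume fg: "f \<in> M" "g \<in> M"
    then have d: "(\<lambda>j. f j - g j) \<in> lattice_fun k" by (auto simp: M_def lattice_fun_def)
    have "\<psi> f = \<psi> (\<lambda>j. f j - g j) * \<psi> g" using \<psi>_add[OF d, of g] fg by (simp add: M_def)
    then have "\<psi> (\<lambda>j. f j - g j) = \<psi> f * ginv (\<psi> g)" by (simp add: mult.assoc)
    moreover have "\<psi> f \<in> center_set \<gamma> ?V" "\<psi> g \<in> center_set \<gamma> ?V" using fg by (auto simp: M_def)
    ultimately have "\<psi> (\<lambda>j. f j - g j) \<in> center_set \<gamma> ?V"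
      using center_set_mult center_set_ginv by metis
    then show "(\<lambda>j. f j - g j) \<in> M" using d by (simp add: M_def)
  qed
  define d where "d i = inv_into (lattice_fun k) \<psi> (c i)" for i
  have d: "d i \<in> lattice_fun k" "\<psi> (d i) = c i" if "i < k" for i
    using c_T[OF that] \<psi>_bij unfolding d_def bij_betw_def by (auto simp: inv_into_into f_inv_into_f)
  have \<Lambda>_d: "\<Lambda> i (d j) = 0 \<longleftrightarrow> i \<noteq> j" if ij: "i < k" "j < k" for i j
  proof (cases "i = j")
    case True
    have "word_val (artin_burau \<Gamma> r) (positive_word (z i)) =
        word_val (artin_burau \<Gamma> r) (positive_word (u i # x i))"
      by (rule word_val_pres_eq[OF z(3)[OF ij(1)] factor_relations[OF Sfac(1)[OF ij(1)] TV
          burau_rel[OF r0]]])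
    moreover have "set (z i) \<subseteq> ?V" using z(1)[OF ij(1)] Sfac(4)[OF ij(1)] TV by blast
    then have "\<phi> (c i) = word_val (artin_burau \<Gamma> r) (positive_word (z i))" using \<phi>
      by (simp add: c_def)
    ultimately have "\<bar>eigenvalue (\<phi> (c i)) (u i)\<bar> < 1" using r(2)[OF ij(1)] by simp
    then have "ln \<bar>eigenvalue (\<phi> (c i)) (u i)\<bar> < 0" using ev_nz[OF c_T[OF ij(1)] ij(1)]
      by (intro ln_less_zero) auto
    then show ?thesis using True d(2)[OF ij(1)] by (simp add: \<Lambda>_def)
  next
    case False
    have dis: "vertices (S j) \<inter> vertices (S i) = {}"
      by (rule factors_disjoint[OF Sfac(1)[OF ij(2)] Sfac(1)[OF ij(1)]]) (use Sinj ij False in auto)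
    have sub: "vertices (S j) \<subseteq> ?V" using Sfac(4)[OF ij(2)] TV by blast
    have "eigenvalue (\<phi> (c j)) (u i) = 1"
    proof (rule eigenvalue_separated[OF graph r(1) \<phi>_gen[OF c_S[OF ij(2)] sub]])
      show "u i \<in> ?V" using uT[OF ij(1)] TV by blast
      show "s \<noteq> u i \<and> label \<Gamma> {s, u i} = Some 2" if s: "s \<in> vertices (S j)" for s
        using Slabel[OF ij(2) s, of "u i"] u(1)[OF ij(1)] uT[OF ij(1)] dis s by blast
    qed
    then show ?thesis using False d(2)[OF ij(2)] by (simp add: \<Lambda>_def)
  qed
  have \<Lambda>_M: "\<Lambda> i f = 0" if i: "k' \<le> i" "i < k" and f: "f \<in> M" for i f
  proof -
    obtain s where s: "s \<in> ?V" "s \<notin> T" "label \<Gamma> {s, u i} \<noteq> Some 2" using u(2)[OF i(2) SnF[OF i]]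
      by blast
    have g: "\<psi> f \<in> center_set \<gamma> ?V" using f by (simp add: M_def)
    then have gV: "\<psi> f \<in> generated_by \<gamma> ?V" and gT: "\<psi> f \<in> generated_by \<gamma> T"
      using VT by (auto simp: center_set_def)
    have uV: "u i \<in> ?V" using uT[OF i(2)] TV by blast
    have comm: "\<psi> f * \<gamma> t = \<gamma> t * \<psi> f" if "t \<in> ?V" for t using g that by (simp add: center_set_def)
    have "u i \<noteq> s" using uT[OF i(2)] s(2) by blast
    then have "eigenvalue (\<phi> (\<psi> f)) (u i) = eigenvalue (\<phi> (\<psi> f)) s"
      using eigenvalue_joined[OF graph r(1) \<phi>_add[OF gV] \<phi>_comm[OF gV comm[OF uV] uV] \<phi>_comm[OF gV
          comm[OF s(1)] s(1)] uV s(1) _ s(3)]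
      by blast
    also have "\<dots> = 1" by (rule eigenvalue_outside[OF graph r(1) \<phi>_gen[OF gT TV] s(2)])
    finally show ?thesis by (simp add: \<Lambda>_def)
  qed
  have dM: "d i \<in> M" if "i < k'" for i
    using d[of i] c_V[OF that] that lens by (simp add: M_def)
  have Mk: "M \<subseteq> lattice_fun k" by (auto simp: M_def)
  obtain b where b: "bij_betw (\<lambda>n. int_comb {..<k'} n b) (lattice_fun k') M"
    using lattice_subgroup_rank[OF M Mk lens(3) d(1) dM \<Lambda>_add \<Lambda>_d \<Lambda>_M] by blast
  have "bij_betw \<psi> M (center_set \<gamma> ?V)"
  proof -
    have "\<psi> ` M = center_set \<gamma> ?V" using \<psi>_bij VT unfolding M_def bij_betw_def by force
    moreover have "inj_on \<psi> M" using \<psi>_bij Mk inj_on_subset unfolding bij_betw_def by blast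
    ultimately show ?thesis by (simp add: bij_betw_def)
  qed
  from bij_betw_trans[OF b this] have
      "bij_betw (\<psi> \<circ> (\<lambda>n. int_comb {..<k'} n b)) (lattice_fun k') (center_set \<gamma> ?V)" .
  moreover have "(\<psi> \<circ> (\<lambda>n. int_comb {..<k'} n b)) (\<lambda>j. f j + g j) =
      (\<psi> \<circ> (\<lambda>n. int_comb {..<k'} n b)) f * (\<psi> \<circ> (\<lambda>n. int_comb {..<k'} n b)) g"
    if "f \<in> lattice_fun k'" "g \<in> lattice_fun k'" for f g
  proof -
    have "int_comb {..<k'} (\<lambda>j. f j + g j) b =
        (\<lambda>j. int_comb {..<k'} f b j + int_comb {..<k'} g b j)"
      by (auto simp: int_comb_def algebra_simps sum.distrib)
    moreover have "int_comb {..<k'} f b \<in> lattice_fun k" "int_comb {..<k'} g b \<in> lattice_fun k"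
      using b that Mk unfolding bij_betw_def by blast+
    ultimately show ?thesis using \<psi>_add by simp
  qed
  ultimately show ?thesis unfolding num lattice_iso_def by blast
qed

section \<open>Transfer to the presented groups\<close>

text \<open>The direct product uses functions that are \<open>undefined\<close> outside
  \<open>{..<k}\<close>, whereas \<open>lattice_fun\<close> pads with 0; restriction mediates
  between the two.\<close>

lemma iso_product_integer_group:
  assumes closed: "\<And>x y. x \<in> carrier M \<Longrightarrow> y \<in> carrier M \<Longrightarrow> x \<otimes>\<^bsub>M\<^esub> y \<in> carrier M"
  shows "M \<cong> product_group {..<k} (\<lambda>_. integer_group) \<longleftrightarrow>
    (\<exists>h. bij_betw h (lattice_fun k) (carrier M) \<and>
      (\<forall>f \<in> lattice_fun k. \<forall>g \<in> lattice_fun k. h (\<lambda>j. f j + g j) = h f \<otimes>\<^bsub>M\<^esub> h g))"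
proof -
  let ?P = "product_group {..<k} (\<lambda>_. integer_group)"
  let ?res = "\<lambda>f :: nat \<Rightarrow> int. restrict f {..<k}"
  have bij: "bij_betw ?res (lattice_fun k) (carrier ?P)"
    by (rule bij_betw_byWitness[where f' = "\<lambda>g i. if i < k then g i else 0"])
      (auto simp: lattice_fun_def fun_eq_iff restrict_def PiE_def extensional_def)
  have mult: "?res (\<lambda>j. f j + g j) = ?res f \<otimes>\<^bsub>?P\<^esub> ?res g" for f g
    by (auto simp: restrict_def fun_eq_iff)
  show ?thesis
  proof
    assume "M \<cong> ?P"
    then obtain i where i: "i \<in> hom M ?P" "bij_betw i (carrier M) (carrier ?P)"
      by (auto simp: is_iso_def iso_def)
    define h where "h f = inv_into (carrier M) i (?res f)" for f
    have inv: "bij_betw (inv_into (carrier M) i) (carrier ?P) (carrier M)" using i(2)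
      by (rule bij_betw_inv_into)
    have "bij_betw h (lattice_fun k) (carrier M)"
      using bij_betw_trans[OF bij inv] unfolding h_def comp_def .
    moreover have "h (\<lambda>j. f j + g j) = h f \<otimes>\<^bsub>M\<^esub> h g" if fg: "f \<in> lattice_fun k" "g \<in> lattice_fun k"
        for f g
    proof -
      have hM: "h f \<in> carrier M" "h g \<in> carrier M" using calculation fg by (auto simp: bij_betw_def)
      have ih: "i (h f) = ?res f" if "f \<in> lattice_fun k" for f
        unfolding h_def using bij that i(2)
          by (intro bij_betw_inv_into_right) (auto simp: bij_betw_def)
      have "i (h f \<otimes>\<^bsub>M\<^esub> h g) = ?res (\<lambda>j. f j + g j)"
        unfolding hom_mult[OF i(1) hM] ih[OF fg(1)] ih[OF fg(2)] mult ..
      then show ?thesis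
        unfolding h_def[of "\<lambda>j. f j + g j"] using closed[OF hM] i(2)
        by (metis bij_betw_inv_into_left)
    qed
    ultimately show "\<exists>h. bij_betw h (lattice_fun k) (carrier M) \<and>
      (\<forall>f \<in> lattice_fun k. \<forall>g \<in> lattice_fun k. h (\<lambda>j. f j + g j) = h f \<otimes>\<^bsub>M\<^esub> h g)" by blast
  next
    assume "\<exists>h. bij_betw h (lattice_fun k) (carrier M) \<and>
      (\<forall>f \<in> lattice_fun k. \<forall>g \<in> lattice_fun k. h (\<lambda>j. f j + g j) = h f \<otimes>\<^bsub>M\<^esub> h g)"
    then obtain h where h: "bij_betw h (lattice_fun k) (carrier M)"
      "\<And>f g. f \<in> lattice_fun k \<Longrightarrow> g \<in> lattice_fun k \<Longrightarrow> h (\<lambda>j. f j + g j) = h f \<otimes>\<^bsub>M\<^esub> h g" by blast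
    define i where "i x = ?res (inv_into (lattice_fun k) h x)" for x
    have inv: "bij_betw (inv_into (lattice_fun k) h) (carrier M) (lattice_fun k)"
      using h(1) by (rule bij_betw_inv_into)
    have i: "bij_betw i (carrier M) (carrier ?P)"
      using bij_betw_trans[OF inv bij] unfolding i_def comp_def .
    moreover have "i (x \<otimes>\<^bsub>M\<^esub> y) = i x \<otimes>\<^bsub>?P\<^esub> i y" if xy: "x \<in> carrier M" "y \<in> carrier M" for x y
    proof -
      obtain f g where fg: "f \<in> lattice_fun k" "g \<in> lattice_fun k" "x = h f" "y = h g"
        using xy h(1)[THEN bij_betw_imp_surj_on, symmetric] by blast
      have "(\<lambda>j. f j + g j) \<in> lattice_fun k" using fg by (auto simp: lattice_fun_def)
      from bij_betw_inv_into_left[OF h(1) this]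
      have "inv_into (lattice_fun k) h (x \<otimes>\<^bsub>M\<^esub> y) = (\<lambda>j. f j + g j)"
        by (simp only: h(2)[OF fg(1,2)] fg(3,4))
      moreover have "inv_into (lattice_fun k) h x = f" "inv_into (lattice_fun k) h y = g"
        using h(1) fg by (auto simp: bij_betw_inv_into_left)
      ultimately show ?thesis unfolding i_def by (simp only: mult)
    qed
    ultimately have "i \<in> iso M ?P" by (auto simp: iso_def hom_def bij_betw_def)
    then show "M \<cong> ?P" by (auto simp: is_iso_def)
  qed
qed

text \<open>\<open>M\<close> is described only by its carrier and its product, so that the special
  subgroup on \<open>K\<close> and the whole Artin group are covered at once; both are translated
  inside the whole group.\<close>

lemma translation_center:
  fixes \<Gamma> :: "'a labelled_graph"
  defines "R \<equiv> artin_relations \<Gamma>" and "V \<equiv> vertices \<Gamma>"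
  assumes K: "K \<subseteq> V" and M: "carrier M = (\<lambda>w. pres_rel V R `` {w}) ` words K"
    "monoid.mult M = monoid.mult (artin_group \<Gamma>)"
  shows "bij_betw (translation (artin_group \<Gamma>)) (carrier (center M)) (center_set (regular_gen V R)
      K)"
    and "\<And>x y. x \<in> carrier (center M) \<Longrightarrow> y \<in> carrier (center M) \<Longrightarrow>
      translation (artin_group \<Gamma>) (x \<otimes>\<^bsub>center M\<^esub> y)
          = translation (artin_group \<Gamma>) x * translation (artin_group \<Gamma>) y"
    and "\<And>x y. x \<in> carrier (center M) \<Longrightarrow> y \<in> carrier (center M) \<Longrightarrow>
        x \<otimes>\<^bsub>center M\<^esub> y \<in> carrier (center M)"
proof -
  let ?G = "artin_group \<Gamma>" and ?\<gamma> = "regular_gen V R"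
  let ?t = "translation ?G"
  interpret group ?G by (rule group_artin_group)
  have G: "?G = presented_group V R" by (simp add: artin_group_def R_def V_def)
  have sub: "carrier M \<subseteq> carrier ?G" unfolding M(1) G using words_mono[OF K] by auto
  have inj: "inj_on ?t (carrier M)" using inj_on_translation sub inj_on_subset by blast
  have val: "?t (pres_rel V R `` {w}) = word_val ?\<gamma> w" if "w \<in> words K" for w
    using word_val_regular_gen[of w V R] words_mono[OF K] that by (auto simp: G)
  have img: "?t ` carrier M = generated_by ?\<gamma> K"
    unfolding M(1) generated_by_def image_image using val by simp
  have closed: "x \<otimes>\<^bsub>?G\<^esub> y \<in> carrier M" if xy: "x \<in> carrier M" "y \<in> carrier M" for x y
  proof -
    obtain u v where uv: "u \<in> words K" "v \<in> words K" "x = pres_rel V R `` {u}"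
        "y = pres_rel V R `` {v}"
      using xy unfolding M(1) by blast
    then have "x \<otimes>\<^bsub>?G\<^esub> y = pres_rel V R `` {u @ v}"
      using words_mono[OF K] mult_pres_class[of u V v R] by (auto simp: G)
    then show ?thesis unfolding M(1) using uv by auto
  qed
  have tm: "?t (x \<otimes>\<^bsub>?G\<^esub> y) = ?t x * ?t y" if "x \<in> carrier M" "y \<in> carrier M" for x y
    using translation_mult that sub by blast
  have comm: "x \<otimes>\<^bsub>?G\<^esub> y = y \<otimes>\<^bsub>?G\<^esub> x \<longleftrightarrow> ?t x * ?t y = ?t y * ?t x"
      if xy: "x \<in> carrier M" "y \<in> carrier M" for x y
    using tm[OF xy] tm[OF xy(2,1)] inj_on_eq_iff[OF inj closed[OF xy] closed[OF xy(2,1)]] by simp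
  have cen: "carrier (center M) = {z \<in> carrier M. \<forall>g \<in> carrier M. z \<otimes>\<^bsub>?G\<^esub> g = g \<otimes>\<^bsub>?G\<^esub> z}"
    by (simp add: center_def M(2))
  have cm: "monoid.mult (center M) = monoid.mult ?G" by (simp add: center_def M(2))
  have "?t ` carrier (center M) = center_set ?\<gamma> K"
    unfolding cen center_set_def img[symmetric] using comm by auto
  moreover have "inj_on ?t (carrier (center M))" by (rule inj_on_subset[OF inj]) (auto simp: cen)
  ultimately show "bij_betw ?t (carrier (center M)) (center_set ?\<gamma> K)" by (simp add: bij_betw_def)
  show "?t (x \<otimes>\<^bsub>center M\<^esub> y) = ?t x * ?t y" if "x \<in> carrier (center M)" "y \<in> carrier (center M)"
      for x y
    unfolding cm using that by (intro tm) (auto simp: cen)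
  show "x \<otimes>\<^bsub>center M\<^esub> y \<in> carrier (center M)"
      if xy: "x \<in> carrier (center M)" "y \<in> carrier (center M)" for x y
  proof -
    have xM: "x \<in> carrier M" "y \<in> carrier M" using xy by (auto simp: cen)
    have "x \<otimes>\<^bsub>?G\<^esub> y \<otimes>\<^bsub>?G\<^esub> g = g \<otimes>\<^bsub>?G\<^esub> (x \<otimes>\<^bsub>?G\<^esub> y)" if g: "g \<in> carrier M" for g
    proof -
      have c: "x \<in> carrier ?G" "y \<in> carrier ?G" "g \<in> carrier ?G" using xM g sub by auto
      have "x \<otimes>\<^bsub>?G\<^esub> g = g \<otimes>\<^bsub>?G\<^esub> x" "y \<otimes>\<^bsub>?G\<^esub> g = g \<otimes>\<^bsub>?G\<^esub> y" using xy g by (auto simp: cen)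
      then show ?thesis using c by (metis m_assoc)
    qed
    then show ?thesis using closed[OF xM] by (simp add: cen cm)
  qed
qed

lemma center_lattice_iso_iff:
  fixes \<Gamma> :: "'a labelled_graph"
  defines "R \<equiv> artin_relations \<Gamma>" and "V \<equiv> vertices \<Gamma>"
  assumes K: "K \<subseteq> V" and M: "carrier M = (\<lambda>w. pres_rel V R `` {w}) ` words K"
    "monoid.mult M = monoid.mult (artin_group \<Gamma>)"
  shows "center M \<cong> product_group {..<k} (\<lambda>_. integer_group) \<longleftrightarrow>
    (\<exists>\<psi>. lattice_iso k \<psi> (center_set (regular_gen V R) K))"
proof -
  note t = translation_center[OF K[unfolded V_def] M[unfolded V_def R_def], folded V_def R_def]
  let ?t = "translation (artin_group \<Gamma>)" and ?L = "lattice_fun k"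
  have iso: "center M \<cong> product_group {..<k} (\<lambda>_. integer_group) \<longleftrightarrow>
      (\<exists>h. bij_betw h ?L (carrier (center M)) \<and>
        (\<forall>f \<in> ?L. \<forall>g \<in> ?L. h (\<lambda>j. f j + g j) = h f \<otimes>\<^bsub>center M\<^esub> h g))"
    by (rule iso_product_integer_group) (rule t(3))
  show ?thesis
  proof
    assume "center M \<cong> product_group {..<k} (\<lambda>_. integer_group)"
    then obtain h where h: "bij_betw h ?L (carrier (center M))"
      "\<forall>f \<in> ?L. \<forall>g \<in> ?L. h (\<lambda>j. f j + g j) = h f \<otimes>\<^bsub>center M\<^esub> h g"
      unfolding iso by blast
    have "lattice_iso k (?t \<circ> h) (center_set (regular_gen V R) K)"
      unfolding lattice_iso_def
    proof (intro conjI ballI)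
      show "bij_betw (?t \<circ> h) ?L (center_set (regular_gen V R) K)"
        by (rule bij_betw_trans[OF h(1) t(1)])
      fix f g assume fg: "f \<in> ?L" "g \<in> ?L"
      then have "h f \<in> carrier (center M)" "h g \<in> carrier (center M)" using h(1)
        by (auto simp: bij_betw_def)
      then show "(?t \<circ> h) (\<lambda>j. f j + g j) = (?t \<circ> h) f * (?t \<circ> h) g" using h(2) fg t(2) by simp
    qed
    then show "\<exists>\<psi>. lattice_iso k \<psi> (center_set (regular_gen V R) K)" by blast
  next
    assume "\<exists>\<psi>. lattice_iso k \<psi> (center_set (regular_gen V R) K)"
    then obtain \<psi> where \<psi>: "bij_betw \<psi> ?L (center_set (regular_gen V R) K)"
      "\<And>f g. f \<in> ?L \<Longrightarrow> g \<in> ?L \<Longrightarrow> \<psi> (\<lambda>j. f j + g j) = \<psi> f * \<psi> g"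
      by (auto simp: lattice_iso_def)
    define h where "h f = inv_into (carrier (center M)) ?t (\<psi> f)" for f
    have bh: "bij_betw h ?L (carrier (center M))"
      using bij_betw_trans[OF \<psi>(1) bij_betw_inv_into[OF t(1)]] unfolding h_def comp_def .
    have th: "?t (h f) = \<psi> f" if "f \<in> ?L" for f
      unfolding h_def using \<psi>(1) that
        by (intro bij_betw_inv_into_right[OF t(1)]) (auto simp: bij_betw_def)
    have "h (\<lambda>j. f j + g j) = h f \<otimes>\<^bsub>center M\<^esub> h g" if fg: "f \<in> ?L" "g \<in> ?L" for f g
    proof -
      have hc: "h f \<in> carrier (center M)" "h g \<in> carrier (center M)" using bh fg
        by (auto simp: bij_betw_def)
      have "?t (h f \<otimes>\<^bsub>center M\<^esub> h g) = \<psi> (\<lambda>j. f j + g j)" using t(2)[OF hc] th fg \<psi>(2) by simp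
      then show ?thesis
        unfolding h_def[of "\<lambda>j. f j + g j"] using t(3)[OF hc] t(1) by (metis bij_betw_inv_into_left)
    qed
    then show "center M \<cong> product_group {..<k} (\<lambda>_. integer_group)"
      unfolding iso using bh by blast
  qed
qed

lemma carrier_special_subgroup:
  fixes \<Gamma> :: "'a labelled_graph"
  defines "R \<equiv> artin_relations \<Gamma>" and "V \<equiv> vertices \<Gamma>"
  assumes K: "K \<subseteq> V"
  shows "carrier (special_subgroup \<Gamma> K) = (\<lambda>w. pres_rel V R `` {w}) ` words K"
proof -
  let ?G = "artin_group \<Gamma>" and ?c = "\<lambda>w. pres_rel V R `` {w}"
  interpret group ?G by (rule group_artin_group)
  have G: "?G = presented_group V R" by (simp add: artin_group_def R_def V_def)
  have gen: "pres_gen V R ` K \<subseteq> carrier ?G" using K by (auto simp: G pres_gen_def)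
  have car: "carrier (special_subgroup \<Gamma> K) = generate ?G (pres_gen V R ` K)"
    using gen by (simp add: special_subgroup_def subgroup_generated_def Int_absorb1 R_def V_def)
  have inv: "inv\<^bsub>?G\<^esub> (pres_gen V R s) = ?c [(s, False)]" if "s \<in> V" for s
    using inv_pres_gen[OF that] by (simp only: G)
  have mult: "?c u \<otimes>\<^bsub>?G\<^esub> ?c v = ?c (u @ v)" if "u \<in> words K" "v \<in> words K" for u v
    using that words_mono[OF K] mult_pres_class[of u V v R] by (auto simp: G)
  have "?c w \<in> generate ?G (pres_gen V R ` K)" if "w \<in> words K" for w
    using that
  proof (induction w)
    case Nil
    show ?case using generate.one[of ?G] by (simp add: G one_presented_group)
  next
    case (Cons l w)
    obtain s b where l: "l = (s, b)" by fastforce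
    have s: "s \<in> K" "s \<in> V" using Cons.prems l K by auto
    have "?c [l] \<in> generate ?G (pres_gen V R ` K)"
    proof (cases b)
      case True
      then show ?thesis using s(1) by (auto simp: l pres_gen_def intro: generate.incl)
    next
      case False
      then show ?thesis using generate.inv[of "pres_gen V R s"
          "pres_gen V R ` K" ?G] inv[OF s(2)] s(1) l by simp
    qed
    then have "?c [l] \<otimes>\<^bsub>?G\<^esub> ?c w \<in> generate ?G (pres_gen V R ` K)"
      using Cons by (intro generate.eng) auto
    then show ?case using mult[of "[l]" w] Cons.prems by simp
  qed
  moreover have "x \<in> ?c ` words K" if "x \<in> generate ?G (pres_gen V R ` K)" for x
    using that
  proof induction
    case one
    show ?case by (rule image_eqI[of _ _ "[]"]) (simp_all add: G one_presented_group)
  next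
    case (incl h)
    then obtain s where "s \<in> K" "h = pres_gen V R s" by blast
    then show ?case by (intro image_eqI[of _ _ "[(s, True)]"]) (simp_all add: pres_gen_def)
  next
    case (inv h)
    then obtain s where "s \<in> K" "h = pres_gen V R s" by blast
    then show ?case using \<open>\<And>s. s \<in> V \<Longrightarrow> inv\<^bsub>?G\<^esub> (pres_gen V R s) = ?c [(s, False)]\<close> K
      by (intro image_eqI[of _ _ "[(s, False)]"]) auto
  next
    case (eng g h)
    then obtain u v where "u \<in> words K" "v \<in> words K" "g = ?c u" "h = ?c v" by blast
    then show ?case by (intro image_eqI[of _ _ "u @ v"]) (simp_all add: mult)
  qed
  ultimately show ?thesis unfolding car by blast
qed

theorem theorem1p2:
  fixes \<Gamma> :: "'a labelled_graph" and T :: "'a set"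
  assumes "defining_graph \<Gamma>"
    and "T = cone_points \<Gamma>"
    and "satisfies_center_conjecture (special_subgroup \<Gamma> T) (induced_subgraph \<Gamma> T)"
  shows "satisfies_center_conjecture (artin_group \<Gamma>) \<Gamma>"
proof -
  have TV: "T \<subseteq> vertices \<Gamma>" using assms(2) by (auto simp: cone_points_def)
  have special: "monoid.mult (special_subgroup \<Gamma> T) = monoid.mult (artin_group \<Gamma>)"
    by (simp add: special_subgroup_def subgroup_generated_def)
  have whole: "carrier (artin_group \<Gamma>) =
      (\<lambda>w. pres_rel (vertices \<Gamma>) (artin_relations \<Gamma>) `` {w}) ` words (vertices \<Gamma>)"
    by (simp add: artin_group_def carrier_presented_group)
  obtain \<psi> where "lattice_iso (num_spherical_factors (induced_subgraph \<Gamma> T)) \<psi>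
      (center_set (regular_gen (vertices \<Gamma>) (artin_relations \<Gamma>)) T)"
    using assms(3) unfolding satisfies_center_conjecture_def
      center_lattice_iso_iff[OF TV carrier_special_subgroup[OF TV] special] by blast
  from center_lattice[OF assms(1) presentation_regular_gen assms(2) this] show ?thesis
    unfolding satisfies_center_conjecture_def center_lattice_iso_iff[OF subset_refl whole HOL.refl]
        .
qed

end
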